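(* Consider the piecewise smooth system $\dot X=f(X)+\varepsilon g(X)$ in $\mathbb{R}^3$, where $f(x,y,z)=(-y,x,h(x,y))$, $h$ satisfies hypotheses H1 and H2 stated in the context, and $g$ is the radial cylindrical perturbation of degree $n$ given in the context by the polynomials $\Psi^{+}$ (for $y>0$) and $\Psi^{-}$ (for $y<0$). Consider cylindrical coordinates $x=r\cos\theta$, $y=r\sin\theta$, $z=z$ with $r>0$, and suppose that the real-valued function $$\psi^n_{z_0}(r)=r\left[\int_{0}^{\pi}\Psi^{+}(r\cos\theta,r\sin\theta,z_0+I_h(\theta))\,d\theta+\int_{\pi}^{2\pi}\Psi^{-}(r\cos\theta,r\sin\theta,z_0+I_h(\theta))\,d\theta\right]$$ has a zero $r_0=r_0(z_0)$ such that $(\partial\psi^n_{z_0}/\partial r)(r_0(z_0))\neq 0$. Let $S=\{z_0\in\mathbb{R}:(\partial\psi^n_{z_0}/\partial r)(r_0(z_0))\neq 0\}$ and define $\psi_n:\mathbb{R}_+\times S\to\mathbb{R}$ by $\psi_n(r,z_0)=\psi^n_{z_0}(r)$. Then, for $|\varepsilon|$ sufficiently small and for each fixed $z_0\in S$, the following statements hold: (i) there exists a $2\pi$-periodic solution $X(t,z_0,\varepsilon)$ of the system $\dot X=f(X)+\varepsilon g(X)$ such that $X(0,z_0,\varepsilon)\to(r_0(z_0),0,z_0)$ as $\varepsilon\to 0$; (ii) the trajectory of each point starting on $\psi_n^{-1}(0)$ is $2\pi$-periodic. In other words, the system $\dot X=f(X)+\varepsilon g(X)$ has a piecewise smooth manifold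 $\mathfrak{M}$, homeomorphic to the revolution manifold $\widetilde{\mathfrak{M}}=\mathbb{S}^1\times\psi_n^{-1}(0)\subset\mathbb{R}^3$, filled by closed orbits.
   Context: Setting. $X=(x,y,z)\in\mathbb{R}^3$, $\varepsilon$ is a small real parameter, $\mathbb{R}_+=(0,\infty)$. The $z$-axis is excluded from consideration, and $h$ is a continuous real-valued function of $(x,y)\neq(0,0)$ satisfying: H1: $h(x,y)=\varphi(x^2+y^2)\,\overline{h}(x,y)$ with $\overline{h}(x,y)=x\,P_1(x^2,y^2)+xy\,P_2(x^2,y^2)+y\,P_3(x^2,y^2)$, where $P_1,P_2,P_3$ are polynomial functions and $\varphi:(0,\infty)\to\mathbb{R}$ is an arbitrary continuous function. H2: $h$ expressed in cylindrical coordinates does not depend on the radius: $\frac{\partial}{\partial r}\,h(r\cos\theta,r\sin\theta)\equiv 0$. Radial cylindrical perturbation of degree $n$: $g=g^+$ for $y>0$ and $g=g^-$ for $y<0$, where $g^{\pm}(x,y,z)=(x\Psi^{\pm}(x,y,z),\,y\Psi^{\pm}(x,y,z),\,0)$ and $\Psi^{\pm}(x,y,z)=\sum_{0\le i+j+k\le n-1}a^{\pm}_{ijk}x^iy^jz^k$ with $a^{\pm}_{ijk}\in\mathbb{R}$. Trajectories on the discontinuity plane $\{y=0\}$ are defined by Filippov's convention; every point with $y=0$, $x\ne0$ is a crossing point (for $|\varepsilon|$ small), where trajectories of one of the vector fields $f+\varepsilon g^{\pm}$ are continued by trajectories of the other. Periodic solutions are of crossing type. Notation: $I_h(\theta)=\int_0^\theta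 h(\cos s,\sin s)\,ds$. A point $(r,z_0)$ of the $(r,z_0)$-plane, in particular of $\psi_n^{-1}(0)$, is identified with the point $(x,y,z)=(r,0,z_0)$ of the half-plane $\theta=0$. $\mathbb{S}^1\times\psi_n^{-1}(0)\subset\mathbb{R}^3$ denotes the set obtained by rotating $\psi_n^{-1}(0)$ around the $z$-axis.
   Formalization: In (ii), the 2π-periodic trajectories start at points of the half-plane θ=0 that tend to the points of ψ_n^{-1}(0) as ε→0, not exactly on it (false as written), and ψ_n^{-1}(0) means only its points (r_0(z_0),z_0) where ∂ψ/∂r≠0; degenerate zeros over S are excluded. *)

theory Defs
  imports "HOL-Analysis.Analysis"
begin

type_synonym point3 = "real \<times> real \<times> real"

abbreviation ycoord :: "point3 \<Rightarrow> real" where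
  "ycoord p \<equiv> fst (snd p)"


subsection \<open>The unperturbed field and its hypotheses\<close>

definition hyp_H1 :: "(real \<times> real \<Rightarrow> real) \<Rightarrow> bool" where
  "hyp_H1 h \<longleftrightarrow>
    (\<exists>(\<phi> :: real \<Rightarrow> real) (P1 :: real \<times> real \<Rightarrow> real) P2 P3.
       continuous_on {0<..} \<phi> \<and>
       real_polynomial_function P1 \<and> real_polynomial_function P2 \<and> real_polynomial_function P3 \<and>
       (\<forall>x y. (x, y) \<noteq> (0, 0) \<longrightarrow>
          h (x, y) = \<phi> (x\<^sup>2 + y\<^sup>2) *
            (x * P1 (x\<^sup>2, y\<^sup>2) + x * y * P2 (x\<^sup>2, y\<^sup>2) + y * P3 (x\<^sup>2, y\<^sup>2))))"

definition hyp_H2 :: "(real \<times> real \<Rightarrow> real) \<Rightarrow> bool" where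
  "hyp_H2 h \<longleftrightarrow>
    (\<forall>\<theta>. \<forall>r>0. ((\<lambda>\<rho>. h (\<rho> * cos \<theta>, \<rho> * sin \<theta>)) has_real_derivative 0) (at r))"

definition base_field :: "(real \<times> real \<Rightarrow> real) \<Rightarrow> point3 \<Rightarrow> point3" where
  "base_field h = (\<lambda>(x, y, z). (- y, x, h (x, y)))"


subsection \<open>Radial cylindrical perturbations of degree n\<close>

text \<open>Everywhere below \<open>n \<ge> 1\<close>; \<open>a i j k\<close> is only used for \<open>i + j + k \<le> n - 1\<close>.\<close>

definition Psi :: "nat \<Rightarrow> (nat \<Rightarrow> nat \<Rightarrow> nat \<Rightarrow> real) \<Rightarrow> point3 \<Rightarrow> real" where
  "Psi n a = (\<lambda>(x, y, z).
     \<Sum>(i, j, k) \<in> {(i, j, k). i + j + k \<le> n - 1}. a i j k * x ^ i * y ^ j * z ^ k)"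

definition radial_field :: "nat \<Rightarrow> (nat \<Rightarrow> nat \<Rightarrow> nat \<Rightarrow> real) \<Rightarrow> point3 \<Rightarrow> point3" where
  "radial_field n a = (\<lambda>(x, y, z). (x * Psi n a (x, y, z), y * Psi n a (x, y, z), 0))"

definition perturbed_field ::
  "(real \<times> real \<Rightarrow> real) \<Rightarrow> nat \<Rightarrow> (nat \<Rightarrow> nat \<Rightarrow> nat \<Rightarrow> real) \<Rightarrow> real \<Rightarrow> point3 \<Rightarrow> point3" where
  "perturbed_field h n a \<epsilon> X = base_field h X + \<epsilon> *\<^sub>R radial_field n a X"


subsection \<open>Filippov solutions of crossing type\<close>

text \<open>
  Solutions, defined for all times, of the system given by \<open>Fp\<close> on \<open>y > 0\<close> and by \<open>Fm\<close> on
  \<open>y < 0\<close>. At a time when \<open>y = 0\<close> the point must be a crossing point (the components of both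
  fields normal to the plane are nonzero with the same sign), and the trajectory of one field is
  continued by that of the other. For \<open>perturbed_field\<close> the normal component on \<open>y = 0\<close> is \<open>x\<close>
  on both sides, so every point off the \<open>z\<close>-axis is a crossing point and solutions of this kind
  never meet the \<open>z\<close>-axis.
\<close>

definition crossing_solution ::
  "(point3 \<Rightarrow> point3) \<Rightarrow> (point3 \<Rightarrow> point3) \<Rightarrow> (real \<Rightarrow> point3) \<Rightarrow> bool" where
  "crossing_solution Fp Fm X \<longleftrightarrow>
    (\<forall>t.
      (ycoord (X t) > 0 \<longrightarrow> (X has_vector_derivative Fp (X t)) (at t)) \<and>
      (ycoord (X t) < 0 \<longrightarrow> (X has_vector_derivative Fm (X t)) (at t)) \<and>
      (ycoord (X t) = 0 \<longrightarrow>
         (ycoord (Fm (X t)) > 0 \<and> ycoord (Fp (X t)) > 0 \<and>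
          (X has_vector_derivative Fm (X t)) (at_left t) \<and>
          (X has_vector_derivative Fp (X t)) (at_right t)) \<or>
         (ycoord (Fm (X t)) < 0 \<and> ycoord (Fp (X t)) < 0 \<and>
          (X has_vector_derivative Fp (X t)) (at_left t) \<and>
          (X has_vector_derivative Fm (X t)) (at_right t))))"

definition periodic_crossing_solution ::
  "real \<Rightarrow> (point3 \<Rightarrow> point3) \<Rightarrow> (point3 \<Rightarrow> point3) \<Rightarrow> (real \<Rightarrow> point3) \<Rightarrow> bool" where
  "periodic_crossing_solution T Fp Fm X \<longleftrightarrow>
    crossing_solution Fp Fm X \<and> (\<forall>t. X (t + T) = X t)"

definition filled_by_closed_orbits ::
  "real \<Rightarrow> (point3 \<Rightarrow> point3) \<Rightarrow> (point3 \<Rightarrow> point3) \<Rightarrow> point3 set \<Rightarrow> bool" where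
  "filled_by_closed_orbits T Fp Fm M \<longleftrightarrow>
    (\<forall>p\<in>M. \<exists>X. periodic_crossing_solution T Fp Fm X \<and> X 0 = p \<and> range X \<subseteq> M)"


subsection \<open>The averaged function and its zeros\<close>

text \<open>\<open>I_h h \<theta>\<close> is only used for \<open>\<theta> \<ge> 0\<close>.\<close>

definition I_h :: "(real \<times> real \<Rightarrow> real) \<Rightarrow> real \<Rightarrow> real" where
  "I_h h \<theta> = integral {0..\<theta>} (\<lambda>s. h (cos s, sin s))"

definition psi ::
  "(real \<times> real \<Rightarrow> real) \<Rightarrow> nat \<Rightarrow> (nat \<Rightarrow> nat \<Rightarrow> nat \<Rightarrow> real) \<Rightarrow> (nat \<Rightarrow> nat \<Rightarrow> nat \<Rightarrow> real) \<Rightarrow>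
   real \<Rightarrow> real \<Rightarrow> real" where
  "psi h n ap am z0 r = r *
    (integral {0..pi} (\<lambda>\<theta>. Psi n ap (r * cos \<theta>, r * sin \<theta>, z0 + I_h h \<theta>)) +
     integral {pi..2 * pi} (\<lambda>\<theta>. Psi n am (r * cos \<theta>, r * sin \<theta>, z0 + I_h h \<theta>)))"

text \<open>\<open>r0\<close> is a value \<open>r\<^sub>0(z\<^sub>0)\<close>: a zero of \<open>psi\<close> with nonvanishing radial derivative. There may be
  several of them for the same \<open>z0\<close>.\<close>

definition simple_zero ::
  "(real \<times> real \<Rightarrow> real) \<Rightarrow> nat \<Rightarrow> (nat \<Rightarrow> nat \<Rightarrow> nat \<Rightarrow> real) \<Rightarrow> (nat \<Rightarrow> nat \<Rightarrow> nat \<Rightarrow> real) \<Rightarrow>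
   real \<Rightarrow> real \<Rightarrow> bool" where
  "simple_zero h n ap am z0 r0 \<longleftrightarrow>
    r0 > 0 \<and> psi h n ap am z0 r0 = 0 \<and> deriv (psi h n ap am z0) r0 \<noteq> 0"

definition S_set ::
  "(real \<times> real \<Rightarrow> real) \<Rightarrow> nat \<Rightarrow> (nat \<Rightarrow> nat \<Rightarrow> nat \<Rightarrow> real) \<Rightarrow> (nat \<Rightarrow> nat \<Rightarrow> nat \<Rightarrow> real) \<Rightarrow>
   real set" where
  "S_set h n ap am = {z0. \<exists>r0. simple_zero h n ap am z0 r0}"

text \<open>
  The preimage of \<open>0\<close> under \<open>psi\<close>, made of the points \<open>(r\<^sub>0(z\<^sub>0), z\<^sub>0)\<close>. A degenerate zero that
  happens to lie over a point of \<open>S_set\<close> is not of this form and is left out: near such a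
  point the zero set need not be a curve and need not persist for nonzero \<open>\<epsilon>\<close>.
  If all zeros over \<open>S_set\<close> are simple, this is the whole preimage.
\<close>

definition psi_zeros ::
  "(real \<times> real \<Rightarrow> real) \<Rightarrow> nat \<Rightarrow> (nat \<Rightarrow> nat \<Rightarrow> nat \<Rightarrow> real) \<Rightarrow> (nat \<Rightarrow> nat \<Rightarrow> nat \<Rightarrow> real) \<Rightarrow>
   (real \<times> real) set" where
  "psi_zeros h n ap am =
    {(r, z0). r > 0 \<and> z0 \<in> S_set h n ap am \<and> psi h n ap am z0 r = 0 \<and>
              deriv (psi h n ap am z0) r \<noteq> 0}"

definition revolution :: "(real \<times> real) set \<Rightarrow> point3 set" where
  "revolution N = {(r * cos \<theta>, r * sin \<theta>, z) | r \<theta> z. (r, z) \<in> N}"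


subsection \<open>Piecewise smooth surfaces\<close>

text \<open>\<open>k\<close> times continuous differentiability; meant for open \<open>U\<close>. The derivatives are taken
  along fixed vectors \<open>v\<close> in order to stay in one type.\<close>

primrec Ck_on :: "nat \<Rightarrow> ('a::euclidean_space \<Rightarrow> 'b::euclidean_space) \<Rightarrow> 'a set \<Rightarrow> bool" where
  "Ck_on 0 f U \<longleftrightarrow> continuous_on U f"
| "Ck_on (Suc k) f U \<longleftrightarrow>
     (\<forall>x\<in>U. f differentiable (at x)) \<and>
     (\<forall>v. Ck_on k (\<lambda>x. frechet_derivative f (at x) v) U)"

definition smooth_on :: "('a::euclidean_space \<Rightarrow> 'b::euclidean_space) \<Rightarrow> 'a set \<Rightarrow> bool" where
  "smooth_on f U \<longleftrightarrow> (\<forall>k. Ck_on k f U)"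

text \<open>
  An embedded topological surface with local parametrizations that are continuous selections of
  finitely many smooth immersions. (Continuous selections of finitely many smooth maps are
  the piecewise smooth maps.)
\<close>

definition piecewise_smooth_surface :: "point3 set \<Rightarrow> bool" where
  "piecewise_smooth_surface M \<longleftrightarrow>
    (\<forall>p\<in>M. \<exists>(U :: (real \<times> real) set) W \<sigma> \<tau> (G :: (real \<times> real \<Rightarrow> point3) set).
       open U \<and> open W \<and> p \<in> W \<and> homeomorphism U (M \<inter> W) \<sigma> \<tau> \<and> finite G \<and>
       (\<forall>u\<in>U. \<exists>g\<in>G. \<sigma> u = g u) \<and>
       (\<forall>g\<in>G. smooth_on g U \<and> (\<forall>u\<in>U. inj (frechet_derivative g (at u)))))"

end

theory Submission
  imports Defs
begin

text \<open>
  In cylindrical coordinates the angle moves with speed one and \<open>z\<close> is a constant plus a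
  \<open>2\<pi>\<close>-periodic function \<open>J\<close> of the angle, so only the scalar equation
  \<open>dr/d\<theta> = \<epsilon> r \<Psi>\<^sup>\<plusminus>\<close> with parameter \<open>z\<^sub>0\<close> remains. An orbit closes up iff the solution
  of the \<open>+\<close> equation at \<open>\<pi>\<close> meets that of the \<open>-\<close> equation at \<open>-\<pi>\<close>; divided by \<open>\<epsilon>\<close> this
  condition is a perturbation of the averaged function, whose simple zeros therefore persist,
  uniformly on compact parts of the curve of simple zeros. Differences of solutions satisfy a linear
  scalar equation, which gives the smooth dependence on \<open>z\<^sub>0\<close> by bootstrapping.

  The bound on \<open>\<epsilon>\<close> can be chosen independent of the zero: every component of the curve of simple
  zeros is a graph over an open \<open>z\<close>-interval, so the whole curve embeds into a compact part
  of itself, and these embeddings can be made to converge pointwise to the identity as \<open>\<epsilon>\<close> tends to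
  \<open>0\<close>. Statement (i) then follows from (ii).
\<close>

section \<open>Calculus of \<open>C\<^sup>k\<close> maps\<close>

text \<open>Starting both half-turns at \<theta> = 0, one forwards and one backwards, avoids
  composing two flows: the closing condition compares two solutions with the same initial value. One
  quantity, the difference of the integrals of the r-derivatives of the two right-hand sides, then
  controls everything. Where it is nonzero, the average is monotone in r, the zero of the perturbed
  condition is unique, and the initial radius can be differentiated in z.

  The curve of simple zeros is in general not compact: zeros may run to infinity, to the axis or
  towards degenerate zeros, and each of these may force the admissible \<epsilon> to 0. Only the
  homeomorphism type of the surface is prescribed, which is the freedom used to stay in a compact
  part. A component that closes up would not fit into an interval; none does, because r is locally a
  function of z.

  Division by \<epsilon> excludes \<epsilon> = 0. There every orbit off the axis is periodic because
  \<open>J\<close> is, so a cylinder serves, and limits as \<epsilon> tends to 0 do not see this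
  choice. Periodicity of \<open>J\<close> comes from the parities in H1.\<close>

lemma Ck_on_cong:
  assumes "open U" "\<And>x. x \<in> U \<Longrightarrow> f x = g x"
  shows "Ck_on k f U \<longleftrightarrow> Ck_on k g U"
  using assms(2)
proof (induction k arbitrary: f g)
  case 0
  then show ?case by (auto cong: continuous_on_cong)
next
  case (Suc k)
  have imp: "Ck_on (Suc k) g U" if *: "Ck_on (Suc k) f U" and eq: "\<And>x. x \<in> U \<Longrightarrow> f x = g x" for f g :: "'a \<Rightarrow> 'b"
  proof -
    have d: "(g has_derivative frechet_derivative f (at x)) (at x)" if "x \<in> U" for x
      using * that eq assms(1)
      by (auto simp: frechet_derivative_works intro: has_derivative_transform_within_open)
    then have "frechet_derivative g (at x) = frechet_derivative f (at x)" if "x \<in> U" for x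
      using frechet_derivative_at that by metis
    then have "Ck_on k (\<lambda>x. frechet_derivative g (at x) v) U" for v
      using Suc.IH[of "\<lambda>x. frechet_derivative f (at x) v" "\<lambda>x. frechet_derivative g (at x) v"] * by auto
    then show ?thesis using d by (auto simp: differentiable_def)
  qed
  show ?case using imp[of f g] imp[of g f] Suc.prems by metis
qed

text \<open>Lets the derivative be supplied as a formula. It agrees with
  \<open>frechet_derivative\<close> on \<open>U\<close>, and \<open>Ck_on_cong\<close> carries the
  regularity over.\<close>

lemma Ck_on_SucI:
  assumes "open U" "\<And>x. x \<in> U \<Longrightarrow> (f has_derivative f' x) (at x)"
    "\<And>v. Ck_on k (\<lambda>x. f' x v) U"
  shows "Ck_on (Suc k) f U"
proof -
  have "frechet_derivative f (at x) = f' x" if "x \<in> U" for x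
    using frechet_derivative_at assms(2) that by metis
  then have "Ck_on k (\<lambda>x. frechet_derivative f (at x) v) U" for v
    using Ck_on_cong[OF assms(1), of "\<lambda>x. frechet_derivative f (at x) v" "\<lambda>x. f' x v"] assms(3) by auto
  then show ?thesis using assms(2) by (auto simp: differentiable_def)
qed

lemma Ck_on_SucD:
  assumes "Ck_on (Suc k) f U" "x \<in> U"
  shows "(f has_derivative frechet_derivative f (at x)) (at x)"
  using assms by (auto simp: frechet_derivative_works)

lemma Ck_on_Suc_imp: "Ck_on (Suc k) f U \<Longrightarrow> Ck_on k f U"
proof (induction k arbitrary: f)
  case 0
  then show ?case
    by (auto intro!: continuous_at_imp_continuous_on differentiable_imp_continuous_within)
next
  case (Suc k)
  then show ?case unfolding Ck_on.simps(2)[of "Suc k"] Ck_on.simps(2)[of k] by (meson Ck_on.simps(2))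
qed

lemma Ck_on_continuous: "Ck_on k f U \<Longrightarrow> continuous_on U f"
  by (induction k) (auto dest: Ck_on_Suc_imp simp del: Ck_on.simps(2) simp: Ck_on.simps(1))

lemma Ck_on_subset: "Ck_on k f U \<Longrightarrow> V \<subseteq> U \<Longrightarrow> Ck_on k f V"
  by (induction k arbitrary: f) (auto intro: continuous_on_subset)

lemma Ck_on_const: "open U \<Longrightarrow> Ck_on k (\<lambda>x. c) U"
proof (induction k arbitrary: c)
  case (Suc k)
  show ?case by (rule Ck_on_SucI[where f' = "\<lambda>x v. 0"]) (use Suc in auto)
qed auto

lemma Ck_on_linear:
  assumes "open U" "bounded_linear f"
  shows "Ck_on k f U"
proof (cases k)
  case 0
  then show ?thesis using assms by (auto simp: linear_continuous_on)
next
  case (Suc m)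
  show ?thesis unfolding Suc
    by (rule Ck_on_SucI[where f' = "\<lambda>x. f"])
      (use assms in \<open>auto intro: Ck_on_const bounded_linear_imp_has_derivative\<close>)
qed

lemma Ck_on_add:
  assumes "open U" "Ck_on k f U" "Ck_on k g U"
  shows "Ck_on k (\<lambda>x. f x + g x) U"
  using assms(2,3)
proof (induction k arbitrary: f g)
  case 0
  then show ?case by (auto intro: continuous_on_add)
next
  case (Suc k)
  show ?case
    by (rule Ck_on_SucI[OF assms(1) has_derivative_add[OF Ck_on_SucD[OF Suc.prems(1)] Ck_on_SucD[OF Suc.prems(2)]]])
      (use Suc in auto)
qed

lemma Ck_on_scaleR:
  fixes f :: "'a::euclidean_space \<Rightarrow> real"
  assumes "open U" "Ck_on k f U" "Ck_on k g U"
  shows "Ck_on k (\<lambda>x. f x *\<^sub>R g x) U"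
  using assms(2,3)
proof (induction k arbitrary: f g)
  case 0
  then show ?case by (auto intro: continuous_on_scaleR)
next
  case (Suc k)
  show ?case
    by (rule Ck_on_SucI[OF assms(1) has_derivative_scaleR[OF Ck_on_SucD[OF Suc.prems(1)] Ck_on_SucD[OF Suc.prems(2)]]])
      (use Suc Ck_on_Suc_imp[OF Suc.prems(1)] Ck_on_Suc_imp[OF Suc.prems(2)] in \<open>auto intro!: Ck_on_add assms(1)\<close>)
qed

lemma Ck_on_mult:
  fixes f g :: "'a::euclidean_space \<Rightarrow> real"
  assumes "open U" "Ck_on k f U" "Ck_on k g U"
  shows "Ck_on k (\<lambda>x. f x * g x) U"
  using Ck_on_scaleR[OF assms] by simp

lemma Ck_on_minus:
  fixes f g :: "'a::euclidean_space \<Rightarrow> real"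
  assumes "open U" "Ck_on k f U" "Ck_on k g U"
  shows "Ck_on k (\<lambda>x. f x - g x) U"
  using Ck_on_add[OF assms(1,2) Ck_on_mult[OF assms(1) Ck_on_const[OF assms(1)] assms(3)], of "-1"] by simp

lemma Ck_on_sum:
  assumes "open U" "\<And>i. i \<in> A \<Longrightarrow> Ck_on k (f i) U"
  shows "Ck_on k (\<lambda>x. \<Sum>i\<in>A. f i x) U"
proof (cases "finite A")
  case True
  then show ?thesis using assms(2)
    by (induction A) (auto intro: Ck_on_const Ck_on_add assms(1))
qed (auto intro: Ck_on_const assms(1))

lemma Ck_on_power:
  fixes f :: "'a::euclidean_space \<Rightarrow> real"
  assumes "open U" "Ck_on k f U"
  shows "Ck_on k (\<lambda>x. f x ^ m) U"
  by (induction m) (auto intro: Ck_on_const Ck_on_mult assms)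

lemma Ck_on_Pair:
  assumes "open U" "Ck_on k f U" "Ck_on k g U"
  shows "Ck_on k (\<lambda>x. (f x, g x)) U"
  using assms(2,3)
proof (induction k arbitrary: f g)
  case 0
  then show ?case by (auto intro: continuous_on_Pair)
next
  case (Suc k)
  show ?case
    by (rule Ck_on_SucI[OF assms(1) has_derivative_Pair[OF Ck_on_SucD[OF Suc.prems(1)] Ck_on_SucD[OF Suc.prems(2)]]])
      (use Suc in auto)
qed

lemma Ck_on_compose:
  fixes f :: "'a::euclidean_space \<Rightarrow> 'b::euclidean_space" and g :: "'b \<Rightarrow> 'c::euclidean_space"
  assumes "open U" "open V" "Ck_on k g V" "Ck_on k f U" "f ` U \<subseteq> V"
  shows "Ck_on k (\<lambda>x. g (f x)) U"
  using assms(3,4,5)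
proof (induction k arbitrary: g f)
  case 0
  then show ?case by (auto intro: continuous_on_compose2)
next
  case (Suc k)
  let ?Dg = "\<lambda>x. frechet_derivative g (at x)" and ?Df = "\<lambda>x. frechet_derivative f (at x)"
  have d: "((\<lambda>x. g (f x)) has_derivative (\<lambda>v. ?Dg (f x) (?Df x v))) (at x)" if "x \<in> U" for x
    using has_derivative_compose[OF Ck_on_SucD[OF Suc.prems(2) that] Ck_on_SucD[OF Suc.prems(1)]]
      that Suc.prems(3) by auto
  \<comment> \<open>The chain rule applies \<open>?Dg\<close> to a moving vector, while
    \<open>Ck_on\<close> speaks about fixed vectors only; expanding in the basis separates the
    two.\<close>
  have exp: "?Dg (f x) (?Df x v) = (\<Sum>b\<in>Basis. (?Df x v \<bullet> b) *\<^sub>R ?Dg (f x) b)" if "x \<in> U" for x v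
  proof -
    have "linear (?Dg (f x))"
      using Ck_on_SucD[OF Suc.prems(1)] that Suc.prems(3) by (blast intro: has_derivative_linear)
    then show ?thesis
      by (subst euclidean_representation[of "?Df x v", symmetric])
        (simp add: linear_sum linear_cmul o_def del: euclidean_representation)
  qed
  have "Ck_on k (\<lambda>x. \<Sum>b\<in>Basis. (?Df x v \<bullet> b) *\<^sub>R ?Dg (f x) b) U" for v
  proof (intro Ck_on_sum Ck_on_scaleR assms(1))
    fix b :: 'b
    have "Ck_on k (\<lambda>y. ?Dg y b) V" using Suc.prems(1) by simp
    then show "Ck_on k (\<lambda>x. ?Dg (f x) b) U"
      using Suc.IH[of "\<lambda>y. ?Dg y b" f] Suc.prems Ck_on_Suc_imp by blast
    have "Ck_on k (\<lambda>x. ?Df x v) U" using Suc.prems(2) by simp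
    have "Ck_on k (\<lambda>x. F x \<bullet> b) U" if "Ck_on k F U" for F :: "'a \<Rightarrow> 'b"
      using that
    proof (induction k arbitrary: F)
      case 0
      then show ?case by (auto intro: continuous_intros)
    next
      case (Suc k)
      show ?case
        by (rule Ck_on_SucI[OF assms(1) has_derivative_inner_left[OF Ck_on_SucD[OF Suc.prems]]])
         (use Suc in auto)
    qed
    then show "Ck_on k (\<lambda>x. ?Df x v \<bullet> b) U" using \<open>Ck_on k (\<lambda>x. ?Df x v) U\<close> by blast
  qed
  then have "Ck_on k (\<lambda>x. ?Dg (f x) (?Df x v)) U" for v
    using Ck_on_cong[OF assms(1) exp, of "\<lambda>x. x"] by auto
  then show ?case using Ck_on_SucI[OF assms(1) d] by blast
qed

lemma Ck_on_exp: "Ck_on k (exp :: real \<Rightarrow> real) UNIV"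
proof (induction k)
  case 0
  then show ?case by (auto intro: continuous_intros)
next
  case (Suc k)
  show ?case
    by (rule Ck_on_SucI[where f' = "\<lambda>x v. exp x * v"])
     (use Suc in \<open>auto intro!: Ck_on_mult Ck_on_const derivative_eq_intros\<close>)
qed

lemma Ck_on_sin_cos:
  "Ck_on k (sin :: real \<Rightarrow> real) UNIV \<and> Ck_on k (cos :: real \<Rightarrow> real) UNIV"
proof (induction k)
  case 0
  then show ?case by (auto intro: continuous_on_sin continuous_on_cos continuous_on_id)
next
  case (Suc k)
  have "Ck_on k (\<lambda>x. cos x * v) UNIV" "Ck_on k (\<lambda>x. sin x * - v) UNIV" for v :: real
    by (intro Ck_on_mult Ck_on_const open_UNIV conjunct1[OF Suc] conjunct2[OF Suc])+
  moreover have "(sin has_derivative (\<lambda>v. cos x * v)) (at x)"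
    "(cos has_derivative (\<lambda>v. sin x * - v)) (at x)" for x :: real
    using DERIV_sin[of x] DERIV_cos[of x] unfolding has_field_derivative_def
    by (auto elim!: has_derivative_eq_rhs simp: fun_eq_iff)
  ultimately show ?case
    using Ck_on_SucI[OF open_UNIV, of sin "\<lambda>x v. cos x * v" k]
      Ck_on_SucI[OF open_UNIV, of cos "\<lambda>x v. sin x * - v" k] by blast
qed

lemma Ck_on_inverse: "Ck_on k (inverse :: real \<Rightarrow> real) (- {0})"
proof (induction k)
  case 0
  then show ?case by (auto intro: continuous_on_inverse)
next
  case (Suc k)
  have "Ck_on k (\<lambda>x. inverse x * inverse x * - v) (- {0})" for v :: real
    by (intro Ck_on_mult Ck_on_const Suc) auto
  moreover have "(inverse has_derivative (\<lambda>v. inverse x * inverse x * - v)) (at x)" if "x \<in> - {0}" for x :: real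
    using DERIV_inverse[of x UNIV] that unfolding has_field_derivative_def
    by (auto elim!: has_derivative_eq_rhs simp: fun_eq_iff power2_eq_square)
  ultimately show ?case
    using Ck_on_SucI[of "- {0}" inverse "\<lambda>x v. inverse x * inverse x * - v" k] by blast
qed

lemma Ck_on_divide:
  fixes f g :: "'a::euclidean_space \<Rightarrow> real"
  assumes "open U" "Ck_on k f U" "Ck_on k g U" "\<And>x. x \<in> U \<Longrightarrow> g x \<noteq> 0"
  shows "Ck_on k (\<lambda>x. f x / g x) U"
  unfolding divide_inverse
  by (intro Ck_on_mult assms(1,2) Ck_on_compose[OF assms(1) _ Ck_on_inverse assms(3)])
    (use assms(4) in auto)

lemma Ck_on_real_polynomial:
  assumes "open U" "real_polynomial_function p"
  shows "Ck_on k p U"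
  using assms(2)
  by induction (auto intro: Ck_on_const Ck_on_add Ck_on_mult Ck_on_linear assms(1))

lemmas Ck_on_fst = Ck_on_linear[OF _ bounded_linear_fst]
lemmas Ck_on_snd = Ck_on_linear[OF _ bounded_linear_snd]

section \<open>Functions of two real variables through their partial derivatives\<close>

lemma has_derivative_partials:
  fixes f :: "real \<times> real \<Rightarrow> real"
  assumes U: "open U"
    and f1: "\<And>x. x \<in> U \<Longrightarrow> ((\<lambda>t. f (t, snd x)) has_real_derivative f1 x) (at (fst x))"
    and f2: "\<And>x. x \<in> U \<Longrightarrow> ((\<lambda>s. f (fst x, s)) has_real_derivative f2 x) (at (snd x))"
    and cont: "continuous_on U f2" and x: "x \<in> U"
  shows "(f has_derivative (\<lambda>v. f1 x * fst v + f2 x * snd v)) (at x)"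
proof -
  obtain \<theta> z where xe: "x = (\<theta>, z)" by fastforce
  obtain A B where AB: "open A" "open B" "(\<theta>, z) \<in> A \<times> B" "A \<times> B \<subseteq> U"
    using open_prod_elim[OF U] x xe by metis
  obtain e where e: "e > 0" "ball z e \<subseteq> B"
    using AB openE[of B z] by auto
  define Y where "Y = ball z e"
  have Y: "open Y" "convex Y" "z \<in> Y" "Y \<subseteq> B" using e by (auto simp: Y_def)
  \<comment> \<open>\<open>has_derivative_partialsI\<close> wants the second partial derivative as a
    continuous operator-valued map on a convex set; hence the multiple of the identity operator and
    the ball \<open>Y\<close>.\<close>
  define fy where "fy = (\<lambda>a b. f2 (a, b) *\<^sub>R (id_blinfun :: real \<Rightarrow>\<^sub>L real))"
  have fyx: "((\<lambda>s. f (a, s)) has_derivative blinfun_apply (fy a b)) (at b within Y)"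
    if "a \<in> A" "b \<in> Y" for a b
  proof -
    have "(a, b) \<in> U" using that AB(4) Y by auto
    from f2[OF this] show ?thesis
      unfolding has_field_derivative_def fy_def
      by (auto intro: has_derivative_at_withinI elim!: has_derivative_eq_rhs simp: scaleR_blinfun.rep_eq)
  qed
  have "continuous_on U (\<lambda>p. f2 p *\<^sub>R (id_blinfun :: real \<Rightarrow>\<^sub>L real))"
    using cont by (intro continuous_intros)
  then have c: "continuous (at (\<theta>, z) within A \<times> Y) (\<lambda>(x, y). fy x y)"
    unfolding fy_def case_prod_unfold
    by (simp only: prod.collapse)
      (rule continuous_on_subset[of U, THEN continuous_on_eq_continuous_within[THEN iffD1], rule_format],
        use AB Y in auto)
  have "((\<lambda>(x, y). (\<lambda>a b. f (a, b)) x y) has_derivative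
      (\<lambda>(tx, ty). (\<lambda>a. f1 (\<theta>, z) * a) tx + blinfun_apply (fy \<theta> z) ty)) (at (\<theta>, z) within A \<times> Y)"
  proof (rule has_derivative_partialsI[OF _ fyx c Y(3,2)])
    show "((\<lambda>xa. f (xa, z)) has_derivative (*) (f1 (\<theta>, z))) (at \<theta> within A)"
      using f1[OF x] xe by (auto simp: has_field_derivative_def intro: has_derivative_at_withinI)
  qed
  moreover have "at (\<theta>, z) within A \<times> Y = at (\<theta>, z)"
    using AB Y by (intro at_within_open) (auto intro: open_Times)
  ultimately show ?thesis
    by (auto simp: xe fy_def scaleR_blinfun.rep_eq case_prod_unfold elim!: has_derivative_eq_rhs)
qed

lemma Ck_on_partialsI:
  fixes f :: "real \<times> real \<Rightarrow> real"
  assumes U: "open U"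
    and f1: "\<And>x. x \<in> U \<Longrightarrow> ((\<lambda>t. f (t, snd x)) has_real_derivative f1 x) (at (fst x))"
    and f2: "\<And>x. x \<in> U \<Longrightarrow> ((\<lambda>s. f (fst x, s)) has_real_derivative f2 x) (at (snd x))"
    and C: "Ck_on k f1 U" "Ck_on k f2 U"
  shows "Ck_on (Suc k) f U"
proof (rule Ck_on_SucI[OF U])
  show "(f has_derivative (\<lambda>v. f1 x * fst v + f2 x * snd v)) (at x)" if "x \<in> U" for x
    by (rule has_derivative_partials[OF U f1 f2 Ck_on_continuous[OF C(2)] that])
  show "Ck_on k (\<lambda>x. f1 x * fst v + f2 x * snd v) U" for v
    by (intro Ck_on_add Ck_on_mult C Ck_on_const U)
qed

lemma Ck_on_partial:
  fixes f :: "real \<times> real \<Rightarrow> real"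
  assumes C: "Ck_on (Suc k) f U" and x: "x \<in> U"
  shows "((\<lambda>s. f (fst x, s)) has_real_derivative frechet_derivative f (at x) (0, 1)) (at (snd x))"
proof -
  have "((\<lambda>s. (fst x, s)) has_derivative (\<lambda>h. (0, h))) (at (snd x))"
    by (auto intro!: derivative_eq_intros)
  from has_derivative_compose[OF this, of f] Ck_on_SucD[OF C x]
  have d: "((\<lambda>s. f (fst x, s)) has_derivative (\<lambda>h. frechet_derivative f (at x) (0, h))) (at (snd x))"
    by simp
  have "linear (frechet_derivative f (at x))"
    using Ck_on_SucD[OF C x] by (rule has_derivative_linear)
  then have "frechet_derivative f (at x) (0, h) = frechet_derivative f (at x) (0, 1) * h" for h
    using linear_cmul[of "frechet_derivative f (at x)" h "(0, 1)"] by simp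
  then have "(\<lambda>h. frechet_derivative f (at x) (0, h)) = (*) (frechet_derivative f (at x) (0, 1))"
    by (rule ext)
  then show ?thesis using d unfolding has_field_derivative_def by simp
qed

section \<open>Integrals from 0 with a parameter\<close>

text \<open>After rescaling this is the integral from \<open>0\<close> to \<open>\<theta>\<close>, oriented also when \<open>\<theta> < 0\<close>.\<close>

definition Jint :: "(real \<times> 'p \<Rightarrow> real) \<Rightarrow> real \<times> 'p \<Rightarrow> real" where
  "Jint f x = integral {0..1} (\<lambda>\<tau>. fst x * f (\<tau> * fst x, snd x))"

lemma scaled_mem:
  fixes \<theta> T :: real
  assumes "\<bar>\<theta>\<bar> < T" "0 \<le> \<tau>" "\<tau> \<le> 1"
  shows "\<bar>\<tau> * \<theta>\<bar> < T"
proof -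
  have "\<bar>\<tau> * \<theta>\<bar> \<le> 1 * \<bar>\<theta>\<bar>" unfolding abs_mult using assms by (intro mult_right_mono) auto
  then show ?thesis using assms by simp
qed

lemma scaled_mem':
  fixes \<theta> T :: real
  assumes "- T < \<theta>" "\<theta> < T" "0 \<le> \<tau>" "\<tau> \<le> 1"
  shows "- T < \<tau> * \<theta>" "\<tau> * \<theta> < T"
  using scaled_mem[of \<theta> T \<tau>] assms by (auto simp: abs_less_iff)

lemma Jint_continuous:
  fixes f :: "real \<times> 'p::topological_space \<Rightarrow> real"
  assumes "continuous_on ({-T<..<T} \<times> P) f"
  shows "continuous_on ({-T<..<T} \<times> P) (Jint f)"
proof -
  have "continuous_on (({-T<..<T} \<times> P) \<times> cbox 0 1) (\<lambda>(x, \<tau>). fst x * f (\<tau> * fst x, snd x))"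
    unfolding case_prod_unfold
    by (intro continuous_intros continuous_on_compose2[OF assms])
      (auto intro: scaled_mem')
  from integral_continuous_on_param[OF this] show ?thesis by (simp add: Jint_def[abs_def])
qed

lemma Jint_eq_antiderivative:
  assumes "\<And>t. \<bar>t\<bar> < T \<Longrightarrow> (\<Phi> has_real_derivative f (t, p)) (at t)" "\<bar>\<theta>\<bar> < T"
  shows "Jint f (\<theta>, p) = \<Phi> \<theta> - \<Phi> 0"
proof -
  have "((\<lambda>\<tau>. \<theta> * f (\<tau> * \<theta>, p)) has_integral \<Phi> (1 * \<theta>) - \<Phi> (0 * \<theta>)) {0..1}"
  proof (rule fundamental_theorem_of_calculus)
    fix \<tau> :: real assume t: "\<tau> \<in> {0..1}"
    have "((\<lambda>\<tau>. \<Phi> (\<tau> * \<theta>)) has_real_derivative f (\<tau> * \<theta>, p) * \<theta>) (at \<tau>)"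
      by (rule DERIV_chain2[OF assms(1)]) (use t assms(2) scaled_mem in \<open>auto intro!: derivative_eq_intros\<close>)
    then show "((\<lambda>\<tau>. \<Phi> (\<tau> * \<theta>)) has_vector_derivative \<theta> * f (\<tau> * \<theta>, p)) (at \<tau> within {0..1})"
      by (metis has_field_derivative_at_within has_real_derivative_iff_has_vector_derivative mult.commute)
  qed simp
  from integral_unique[OF this] show ?thesis
    by (simp only: Jint_def fst_conv snd_conv mult_1_left mult_zero_left)
qed

lemma ex_antiderivative:
  assumes "continuous_on {-T<..<T} g" "\<bar>\<theta>\<bar> < T" 
  obtains \<Phi> T' where "\<bar>\<theta>\<bar> < T'" "T' \<le> T" "\<And>t. \<bar>t\<bar> < T' \<Longrightarrow> (\<Phi> has_real_derivative g t) (at t)"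
proof -
  \<comment> \<open>A compact subinterval allows integration from its left end, which covers
    negative times as well.\<close>
  obtain T' where T': "\<bar>\<theta>\<bar> < T'" "T' < T" using assms(2) dense by blast
  have c: "continuous_on {-T'..T'} g" by (rule continuous_on_subset[OF assms(1)]) (use T' in auto)
  have "((\<lambda>u. integral {-T'..u} g) has_real_derivative g t) (at t)" if "\<bar>t\<bar> < T'" for t
  proof -
    have "((\<lambda>u. integral {-T'..u} g) has_real_derivative g t) (at t within {-T'..T'})"
      by (rule integral_has_real_derivative[OF c]) (use that in auto)
    moreover have "at t within {-T'..T'} = at t"
      by (rule at_within_interior) (use that in auto)
    ultimately show ?thesis by simp
  qed
  then show ?thesis using that[of T'] T' by auto
qed

lemma Jint_has_derivative:
  assumes "continuous_on {-T<..<T} (\<lambda>t. f (t, p))" "\<bar>\<theta>\<bar> < T"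
  shows "((\<lambda>t. Jint f (t, p)) has_real_derivative f (\<theta>, p)) (at \<theta>)"
proof -
  obtain \<Phi> T' where *: "\<bar>\<theta>\<bar> < T'" "T' \<le> T" "\<And>t. \<bar>t\<bar> < T' \<Longrightarrow> (\<Phi> has_real_derivative f (t, p)) (at t)"
    using ex_antiderivative[OF assms] by blast
  have "((\<lambda>t. \<Phi> t - \<Phi> 0) has_real_derivative f (\<theta>, p)) (at \<theta>)"
    using *(3)[OF *(1)] by (auto intro!: derivative_eq_intros)
  then show ?thesis
  proof (rule has_field_derivative_transform_within_open[where S = "{-T'<..<T'}"])
    show "\<Phi> x - \<Phi> 0 = Jint f (x, p)" if "x \<in> {- T'<..<T'}" for x
      using Jint_eq_antiderivative[of T' \<Phi> f p x] * that by auto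
  qed (use * in auto)
qed

lemma Jint_0 [simp]: "Jint f (0, p) = 0"
  by (simp add: Jint_def)

lemma Jint_cmult: "Jint (\<lambda>x. c * f x) x = c * Jint f x"
  by (simp add: Jint_def mult.left_commute)

lemma Jint_cong:
  assumes "\<And>t. \<bar>t\<bar> \<le> \<bar>\<theta>\<bar> \<Longrightarrow> f (t, p) = g (t, p)"
  shows "Jint f (\<theta>, p) = Jint g (\<theta>, p)"
proof -
  have "\<bar>\<tau> * \<theta>\<bar> \<le> \<bar>\<theta>\<bar>" if "0 \<le> \<tau>" "\<tau> \<le> 1" for \<tau>
    using mult_right_mono[of \<tau> 1 "\<bar>\<theta>\<bar>"] that by (simp add: abs_mult)
  then show ?thesis unfolding Jint_def by (intro integral_cong) (use assms in auto)
qed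

lemma Jint_diff_bound:
  assumes f: "continuous_on {-T<..<T} (\<lambda>t. f (t, p))" and g: "continuous_on {-T<..<T} (\<lambda>t. g (t, p))"
    and \<theta>: "\<bar>\<theta>\<bar> < T"
    and b: "\<And>t. \<bar>t\<bar> \<le> \<bar>\<theta>\<bar> \<Longrightarrow> \<bar>f (t, p) - g (t, p)\<bar> \<le> M"
  shows "\<bar>Jint f (\<theta>, p) - Jint g (\<theta>, p)\<bar> \<le> \<bar>\<theta>\<bar> * M"
proof -
  have M: "M \<ge> 0" using b[of 0] by auto
  have i: "(\<lambda>\<tau>. \<theta> * k (\<tau> * \<theta>, p)) integrable_on {0..1}"
    if "continuous_on {-T<..<T} (\<lambda>t. k (t, p))" for k
  proof -
    have "- T < \<theta>" "\<theta> < T" using \<theta> by auto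
    then show ?thesis
      by (intro integrable_continuous_interval continuous_intros continuous_on_compose2[OF that])
        (auto intro: scaled_mem')
  qed
  have "((\<lambda>\<tau>. \<theta> * f (\<tau> * \<theta>, p) - \<theta> * g (\<tau> * \<theta>, p)) has_integral Jint f (\<theta>, p) - Jint g (\<theta>, p)) {0..1}"
    unfolding Jint_def fst_conv snd_conv
    by (intro has_integral_diff integrable_integral i f g)
  from has_integral_bound_real[OF _ _ this, of "\<bar>\<theta>\<bar> * M" "{}"] M show ?thesis
  proof -
    have "norm (\<theta> * f (\<tau> * \<theta>, p) - \<theta> * g (\<tau> * \<theta>, p)) \<le> \<bar>\<theta>\<bar> * M" if "\<tau> \<in> {0..1}" for \<tau>
    proof -
      have "\<bar>\<tau> * \<theta>\<bar> \<le> \<bar>\<theta>\<bar>" using mult_right_mono[of \<tau> 1 "\<bar>\<theta>\<bar>"] that by (simp add: abs_mult)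
      then have "\<bar>\<theta>\<bar> * \<bar>f (\<tau> * \<theta>, p) - g (\<tau> * \<theta>, p)\<bar> \<le> \<bar>\<theta>\<bar> * M"
        using b by (intro mult_left_mono) auto
      then show ?thesis by (simp add: abs_mult right_diff_distrib[symmetric])
    qed
    then show ?thesis
      using has_integral_bound_real[of "\<bar>\<theta>\<bar> * M" "{}", OF _ _ \<open>(_ has_integral _) {0..1}\<close>] M by auto
  qed
qed

lemma Jint_pos:
  assumes "continuous_on {-T<..<T} (\<lambda>t. f (t, p))" "0 \<le> \<theta>" "\<theta> < T"
  shows "Jint f (\<theta>, p) = integral {0..\<theta>} (\<lambda>t. f (t, p))"
proof -
  have "((\<lambda>t. f (t, p)) has_integral Jint f (\<theta>, p) - Jint f (0, p)) {0..\<theta>}"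
    by (rule fundamental_theorem_of_calculus[OF assms(2)])
     (rule has_vector_derivative_at_within, unfold has_real_derivative_iff_has_vector_derivative[symmetric],
        rule Jint_has_derivative[OF assms(1)], use assms in auto)
  then show ?thesis by (simp add: integral_unique)
qed

lemma Jint_partial:
  fixes f :: "real \<times> real \<Rightarrow> real"
  assumes Z: "open Z" "z \<in> Z" and \<theta>: "\<bar>\<theta>\<bar> < T"
    and f: "continuous_on ({-T<..<T} \<times> Z) f" "continuous_on ({-T<..<T} \<times> Z) f2"
    and d: "\<And>x. x \<in> {-T<..<T} \<times> Z \<Longrightarrow> ((\<lambda>s. f (fst x, s)) has_real_derivative f2 x) (at (snd x))"
  shows "((\<lambda>s. Jint f (\<theta>, s)) has_real_derivative Jint f2 (\<theta>, z)) (at z)"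
proof -
  obtain e where e: "e > 0" "ball z e \<subseteq> Z" using Z openE by blast
  have m: "(\<tau> * \<theta>, s) \<in> {-T<..<T} \<times> Z" if "s \<in> ball z e" "\<tau> \<in> cbox 0 1" for s \<tau>
    using that e scaled_mem[OF \<theta>, of \<tau>] by (auto simp: abs_less_iff)
  have "((\<lambda>s. integral (cbox 0 1) (\<lambda>\<tau>. \<theta> * f (\<tau> * \<theta>, s))) has_field_derivative
      integral (cbox 0 1) (\<lambda>\<tau>. \<theta> * f2 (\<tau> * \<theta>, z))) (at z within ball z e)"
  proof (rule leibniz_rule_field_derivative)
    fix s \<tau> :: real assume *: "s \<in> ball z e" "\<tau> \<in> cbox 0 1"
    show "((\<lambda>s. \<theta> * f (\<tau> * \<theta>, s)) has_field_derivative \<theta> * f2 (\<tau> * \<theta>, s)) (at s within ball z e)"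
      using d[OF m[OF *]] by (intro has_field_derivative_at_within[OF DERIV_cmult]) simp
  next
    fix s assume *: "s \<in> ball z e"
    show "(\<lambda>\<tau>. \<theta> * f (\<tau> * \<theta>, s)) integrable_on cbox 0 1"
      by (intro integrable_continuous continuous_intros continuous_on_compose2[OF f(1)]) (use m[OF *] in auto)
  next
    show "continuous_on (ball z e \<times> cbox 0 1) (\<lambda>(s, \<tau>). \<theta> * f2 (\<tau> * \<theta>, s))"
      unfolding case_prod_unfold
      by (intro continuous_intros continuous_on_compose2[OF f(2)]) (use m in auto)
  qed (use e in auto)
  then show ?thesis using e by (simp add: Jint_def at_within_open[of z "ball z e"])
qed

text \<open>The partial derivative in the upper limit is \<open>f\<close> itself, the one in the
  parameter is again a \<open>Jint\<close>, of a function with one derivative less; so induction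
  applies.\<close>

lemma Ck_on_Jint:
  fixes f :: "real \<times> real \<Rightarrow> real"
  assumes Z: "open Z"
  shows "Ck_on k f ({-T<..<T} \<times> Z) \<Longrightarrow> Ck_on k (Jint f) ({-T<..<T} \<times> Z)"
proof (induction k arbitrary: f)
  case 0
  then show ?case by (auto intro: Jint_continuous)
next
  case (Suc k)
  let ?U = "{-T<..<T} \<times> Z"
  let ?f2 = "\<lambda>x. frechet_derivative f (at x) (0, 1)"
  have c2: "Ck_on k ?f2 ?U" using Suc.prems by simp
  have cont: "continuous_on ?U f" using Ck_on_continuous[OF Suc.prems] .
  have "((\<lambda>t. Jint f (t, snd x)) has_real_derivative f x) (at (fst x))" if "x \<in> ?U" for x
    using Jint_has_derivative[of T f "snd x" "fst x"] that
      continuous_on_compose2[OF cont, of "{-T<..<T}" "\<lambda>t. (t, snd x)"] by (force intro: continuous_intros)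
  moreover have "((\<lambda>s. Jint f (fst x, s)) has_real_derivative Jint ?f2 x) (at (snd x))" if "x \<in> ?U" for x
    using Jint_partial[OF Z, of "snd x" "fst x" T f ?f2] that cont Ck_on_continuous[OF c2] Ck_on_partial[OF Suc.prems]
    by (auto simp: abs_less_iff)
  moreover have "open ?U" using Z by (auto intro: open_Times)
  ultimately show ?case
    by (intro Ck_on_partialsI[of ?U "Jint f" f "Jint ?f2" k] Suc.IH[OF c2] Ck_on_Suc_imp[OF Suc.prems])
qed

section \<open>Scalar differential equations\<close>

text \<open>Variation of constants: multiplying \<open>D\<close> by the integrating factor
  \<open>exp (- Jint a)\<close> leaves a function whose derivative is known.\<close>

lemma linear_ode_solution:
  fixes a b :: "real \<times> 'p \<Rightarrow> real"
  assumes a: "continuous_on {-T<..<T} (\<lambda>t. a (t, p))" and b: "continuous_on {-T<..<T} (\<lambda>t. b (t, p))"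
    and D: "\<And>t. \<bar>t\<bar> < T \<Longrightarrow> (D has_real_derivative a (t, p) * D t + b (t, p)) (at t)"
    and \<theta>: "\<bar>\<theta>\<bar> < T"
  shows "D \<theta> = exp (Jint a (\<theta>, p)) * (D 0 + Jint (\<lambda>x. b x * exp (- Jint a x)) (\<theta>, p))"
proof -
  have "Jint (\<lambda>x. b x * exp (- Jint a x)) (\<theta>, p) = D \<theta> * exp (- Jint a (\<theta>, p)) - D 0 * exp (- Jint a (0, p))"
  proof (rule Jint_eq_antiderivative[OF _ \<theta>])
    fix t assume t: "\<bar>t\<bar> < T"
    show "((\<lambda>t. D t * exp (- Jint a (t, p))) has_real_derivative b (t, p) * exp (- Jint a (t, p))) (at t)"
      using D[OF t] Jint_has_derivative[of T a p t] a t
      by (auto intro!: derivative_eq_intros simp: algebra_simps)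
  qed
  then show ?thesis by (simp add: algebra_simps flip: exp_add)
qed

text \<open>The mean of \<open>g\<close> along the segment from \<open>q\<close> to
  \<open>q'\<close>. For a partial derivative \<open>g\<close> this is Hadamard's replacement of the
  difference quotient, which stays continuous where the two points coincide.\<close>

definition slope :: "(real \<times> real \<times> real \<Rightarrow> real) \<Rightarrow> real \<Rightarrow> real \<times> real \<Rightarrow> real \<times> real \<Rightarrow> real" where
  "slope g t q q' = integral {0..1} (\<lambda>\<tau>. g (t, fst q + \<tau> * (fst q' - fst q), snd q + \<tau> * (snd q' - snd q)))"


lemma slope_continuous:
  assumes g: "continuous_on UNIV g" and c: "continuous_on S t" "continuous_on S q" "continuous_on S q'"
  shows "continuous_on S (\<lambda>x. slope g (t x) (q x) (q' x))"
proof -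
  have "continuous_on (S \<times> cbox 0 1) (\<lambda>(x, \<tau>). g (t x, fst (q x) + \<tau> * (fst (q' x) - fst (q x)),
      snd (q x) + \<tau> * (snd (q' x) - snd (q x))))"
    unfolding case_prod_unfold
    by (intro continuous_intros continuous_on_compose2[OF g] continuous_on_compose2[OF c(1)]
        continuous_on_compose2[OF c(2)] continuous_on_compose2[OF c(3)]) auto
  from integral_continuous_on_param[OF this] show ?thesis by (simp add: slope_def[abs_def])
qed

lemma slope_diag [simp]: "slope g t q q = g (t, q)"
  by (simp add: slope_def)

lemma slope_bound:
  assumes g: "continuous_on UNIV g"
    and "\<And>\<tau>. 0 \<le> \<tau> \<Longrightarrow> \<tau> \<le> 1 \<Longrightarrow>
      \<bar>g (t, fst q + \<tau> * (fst q' - fst q), snd q + \<tau> * (snd q' - snd q)) - c\<bar> \<le> B"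
  shows "\<bar>slope g t q q' - c\<bar> \<le> B"
proof -
  let ?f = "\<lambda>\<tau>. g (t, fst q + \<tau> * (fst q' - fst q), snd q + \<tau> * (snd q' - snd q))"
  have f: "?f integrable_on {0..1}"
    by (intro integrable_continuous_interval continuous_intros continuous_on_compose2[OF g]) auto
  have "B \<ge> 0" using assms(2)[of 0] by auto
  have "((\<lambda>\<tau>. ?f \<tau> - c) has_integral slope g t q q' - c) {0..1}"
    using has_integral_diff[OF integrable_integral[OF f] has_integral_const_real[of c 0 1]]
    by (simp add: slope_def)
  from has_integral_bound_real[OF \<open>B \<ge> 0\<close> _ this, of "{}"] assms(2) show ?thesis by simp
qed

abbreviation dr :: "(real \<times> real \<times> real \<Rightarrow> real) \<Rightarrow> real \<times> real \<times> real \<Rightarrow> real" where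
  "dr G x \<equiv> frechet_derivative G (at x) (0, 1, 0)"

abbreviation dz :: "(real \<times> real \<times> real \<Rightarrow> real) \<Rightarrow> real \<times> real \<times> real \<Rightarrow> real" where
  "dz G x \<equiv> frechet_derivative G (at x) (0, 0, 1)"

lemma hadamard:
  assumes G: "Ck_on 1 G UNIV"
  shows "G (t, q') - G (t, q) = slope (dr G) t q q' * (fst q' - fst q) + slope (dz G) t q q' * (snd q' - snd q)"
proof -
  have D: "(G has_derivative frechet_derivative G (at x)) (at x)" for x
    using Ck_on_SucD[of 0 G UNIV] G by simp
  have c: "continuous_on UNIV (\<lambda>x. frechet_derivative G (at x) v)" for v
    using G unfolding One_nat_def Ck_on.simps by blast
  define w where "w = q' - q"
  define \<gamma> where "\<gamma> = (\<lambda>\<tau>::real. (t, fst q + \<tau> * fst w, snd q + \<tau> * snd w))"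
  have I: "((\<lambda>\<tau>. dr G (\<gamma> \<tau>) * fst w + dz G (\<gamma> \<tau>) * snd w) has_integral G (\<gamma> 1) - G (\<gamma> 0)) {0..1}"
  proof (rule fundamental_theorem_of_calculus)
    fix \<tau> :: real
    have l: "linear (frechet_derivative G (at (\<gamma> \<tau>)))" using D by (rule has_derivative_linear)
    have "(\<gamma> has_derivative (\<lambda>h. h *\<^sub>R (0, fst w, snd w))) (at \<tau>)"
      unfolding \<gamma>_def by (auto intro!: derivative_eq_intros simp: scaleR_prod_def)
    from has_derivative_compose[OF this D]
    have "((\<lambda>\<tau>. G (\<gamma> \<tau>)) has_derivative (\<lambda>h. frechet_derivative G (at (\<gamma> \<tau>)) (h *\<^sub>R (0, fst w, snd w)))) (at \<tau>)" .
    moreover have "frechet_derivative G (at (\<gamma> \<tau>)) (h *\<^sub>R (0, fst w, snd w))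
       = h *\<^sub>R (dr G (\<gamma> \<tau>) * fst w + dz G (\<gamma> \<tau>) * snd w)" for h
    proof -
      have "(0, fst w, snd w) = fst w *\<^sub>R (0, 1, 0) + snd w *\<^sub>R (0 :: real, 0, 1)" by simp
      then show ?thesis by (simp only: linear_add[OF l] linear_cmul[OF l]) (simp add: algebra_simps)
    qed
    ultimately have "((\<lambda>\<tau>. G (\<gamma> \<tau>)) has_vector_derivative dr G (\<gamma> \<tau>) * fst w + dz G (\<gamma> \<tau>) * snd w) (at \<tau>)"
      by (simp add: has_vector_derivative_def)
    then show "((\<lambda>\<tau>. G (\<gamma> \<tau>)) has_vector_derivative dr G (\<gamma> \<tau>) * fst w + dz G (\<gamma> \<tau>) * snd w) (at \<tau> within {0..1})"
      by (rule has_vector_derivative_at_within)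
  qed simp
  have i: "(\<lambda>\<tau>. frechet_derivative G (at (\<gamma> \<tau>)) v) integrable_on {0..1}" for v
    unfolding \<gamma>_def by (intro integrable_continuous_interval continuous_intros continuous_on_compose2[OF c]) auto
  have "((\<lambda>\<tau>. dr G (\<gamma> \<tau>) * fst w + dz G (\<gamma> \<tau>) * snd w) has_integral
      slope (dr G) t q q' * fst w + slope (dz G) t q q' * snd w) {0..1}"
    using has_integral_add[OF has_integral_mult_left[OF integrable_integral[OF i]] has_integral_mult_left[OF integrable_integral[OF i]]]
    by (simp add: slope_def \<gamma>_def w_def)
  from has_integral_unique[OF this I] show ?thesis by (simp add: \<gamma>_def w_def)
qed

text \<open>Differences of solutions solve a linear equation, hence are given by an explicit formula.\<close>

lemma solution_difference:
  fixes u w :: "real \<Rightarrow> real"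
  assumes G: "Ck_on 1 G UNIV"
    and u: "\<And>t. \<bar>t\<bar> < T \<Longrightarrow> (u has_real_derivative \<epsilon> * G (t, u t, z)) (at t)"
    and w: "\<And>t. \<bar>t\<bar> < T \<Longrightarrow> (w has_real_derivative \<epsilon> * G (t, w t, z')) (at t)"
    and A: "\<And>t. \<bar>t\<bar> < T \<Longrightarrow> A (t, p) = slope (dr G) t (u t, z) (w t, z')"
    and B: "\<And>t. \<bar>t\<bar> < T \<Longrightarrow> B (t, p) = slope (dz G) t (u t, z) (w t, z')"
    and \<theta>: "\<bar>\<theta>\<bar> < T"
  shows "w \<theta> - u \<theta> = exp (Jint (\<lambda>x. \<epsilon> * A x) (\<theta>, p)) *
    ((w 0 - u 0) + (z' - z) * Jint (\<lambda>x. \<epsilon> * B x * exp (- Jint (\<lambda>x. \<epsilon> * A x) x)) (\<theta>, p))"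
proof -
  have "w \<theta> - u \<theta> = exp (Jint (\<lambda>x. \<epsilon> * A x) (\<theta>, p)) *
    ((w 0 - u 0) + Jint (\<lambda>x. (\<epsilon> * B x * (z' - z)) * exp (- Jint (\<lambda>x. \<epsilon> * A x) x)) (\<theta>, p))"
  proof (rule linear_ode_solution[OF _ _ _ \<theta>])
    have c: "continuous_on UNIV (\<lambda>x. frechet_derivative G (at x) v)" for v
      using G unfolding One_nat_def Ck_on.simps by blast
    have cu: "continuous_on {-T<..<T} u" "continuous_on {-T<..<T} w"
      using DERIV_isCont[OF u] DERIV_isCont[OF w]
      by (auto intro!: continuous_at_imp_continuous_on simp: abs_less_iff)
    have "continuous_on {-T<..<T} (\<lambda>t. slope (\<lambda>x. frechet_derivative G (at x) v) t (u t, z) (w t, z'))" for v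
      by (intro slope_continuous c continuous_intros cu)
    note c' = this
    have "continuous_on {-T<..<T} (\<lambda>t. A (t, p))"
      by (rule continuous_on_eq[OF c'[of "(0,1,0)"]]) (use A in \<open>auto simp: abs_less_iff\<close>)
    moreover have "continuous_on {-T<..<T} (\<lambda>t. B (t, p))"
      by (rule continuous_on_eq[OF c'[of "(0,0,1)"]]) (use B in \<open>auto simp: abs_less_iff\<close>)
    ultimately show "continuous_on {-T<..<T} (\<lambda>t. \<epsilon> * A (t, p))" "continuous_on {-T<..<T} (\<lambda>t. \<epsilon> * B (t, p) * (z' - z))"
      by - (intro continuous_on_mult continuous_on_const; assumption)+
    fix t assume t: "\<bar>t\<bar> < T"
    show "((\<lambda>t. w t - u t) has_real_derivative \<epsilon> * A (t, p) * (w t - u t) + \<epsilon> * B (t, p) * (z' - z)) (at t)"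
    proof (rule DERIV_cong[OF DERIV_diff[OF w[OF t] u[OF t]]])
      show "\<epsilon> * G (t, w t, z') - \<epsilon> * G (t, u t, z) = \<epsilon> * A (t, p) * (w t - u t) + \<epsilon> * B (t, p) * (z' - z)"
        by (simp only: right_diff_distrib[symmetric] hadamard[OF G] A[OF t] B[OF t])
          (simp add: algebra_simps)
    qed
  qed
  moreover have "(\<lambda>x. (\<epsilon> * B x * (z' - z)) * exp (- Jint (\<lambda>x. \<epsilon> * A x) x)) =
      (\<lambda>x. (z' - z) * (\<epsilon> * B x * exp (- Jint (\<lambda>x. \<epsilon> * A x) x)))"
    by (simp add: mult_ac)
  ultimately show ?thesis by (simp only: Jint_cmult)
qed

section \<open>Flows of scalar equations\<close>

definition trunc_to :: "real \<Rightarrow> real \<Rightarrow> real" where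
  "trunc_to b x = max (- b) (min b x)"

lemma trunc_to_bound: "0 \<le> b \<Longrightarrow> \<bar>trunc_to b x\<bar> \<le> b"
  by (auto simp: trunc_to_def)

lemma trunc_to_eq [simp]: "\<bar>x\<bar> \<le> b \<Longrightarrow> trunc_to b x = x"
  by (auto simp: trunc_to_def)

lemma trunc_to_dist: "\<bar>trunc_to b x - trunc_to b y\<bar> \<le> \<bar>x - y\<bar>"
  by (auto simp: trunc_to_def min_def max_def)

lemma continuous_on_trunc_to [continuous_intros]:
  "continuous_on S f \<Longrightarrow> continuous_on S (\<lambda>x. trunc_to b (f x))"
  unfolding trunc_to_def by (intro continuous_intros)

text \<open>\<open>u\<close> is total and continuous everywhere, so that later compositions carry no
  domain conditions; the equation is asserted only for data in the box of size \<open>a\<close>. The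
  drift bound linear in \<epsilon> makes the mismatch of the two flows, divided by \<epsilon>, close
  to the averaged function.\<close>

definition flow ::
  "(real \<times> real \<times> real \<Rightarrow> real) \<Rightarrow> real \<Rightarrow> real \<Rightarrow> real \<Rightarrow> real \<Rightarrow> (real \<times> real \<times> real \<Rightarrow> real) \<Rightarrow> bool" where
  "flow G T a B \<epsilon> u \<longleftrightarrow> continuous_on UNIV u \<and>
     (\<forall>r z. \<bar>r\<bar> \<le> a \<longrightarrow> \<bar>z\<bar> \<le> a \<longrightarrow> u (0, r, z) = r \<and>
       (\<forall>\<theta>. \<bar>\<theta>\<bar> < T \<longrightarrow> \<bar>u (\<theta>, r, z) - r\<bar> \<le> B * \<bar>\<epsilon>\<bar> \<and>
         ((\<lambda>t. u (t, r, z)) has_real_derivative \<epsilon> * G (\<theta>, u (\<theta>, r, z), z)) (at \<theta>)))"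

text \<open>Truncating the right-hand side makes it bounded and Lipschitz in the unknown, so for small
  \<open>\<epsilon>\<close> the Picard operator contracts the bounded continuous functions of all three variables;
  for small \<open>\<epsilon>\<close> the truncation is moreover inactive.\<close>

lemma flow_exists:
  assumes G: "Ck_on 1 G UNIV" and T: "T > 0" and a: "a > 0"
  shows "\<exists>\<delta>>0. \<exists>B>0. \<forall>\<epsilon>. \<bar>\<epsilon>\<bar> < \<delta> \<longrightarrow> (\<exists>u. flow G T a B \<epsilon> u)"
proof -
  \<comment> \<open>Solutions start within \<open>a\<close> and, for small \<epsilon>, drift by at
    most 1, so a truncation at \<open>a + 1\<close> is not felt by them.\<close>
  define C where "C = {-T..T} \<times> {-(a+1)..a+1} \<times> {-(a+1)..a+1}"
  have C: "compact C" "C \<noteq> {}" unfolding C_def using T a by (auto intro!: compact_Times)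
  have cG: "continuous_on UNIV G" using G Ck_on_continuous by blast
  have cdG: "continuous_on UNIV (dr G)"
    using G unfolding One_nat_def Ck_on.simps by blast
  have "bounded (G ` C)" "bounded (dr G ` C)"
    using C by (auto intro!: compact_imp_bounded compact_continuous_image
        intro: continuous_on_subset[OF cG] continuous_on_subset[OF cdG])
  then obtain B0 L where B0: "B0 > 0" "\<And>x. x \<in> C \<Longrightarrow> \<bar>G x\<bar> \<le> B0" and L: "L > 0" "\<And>x. x \<in> C \<Longrightarrow> \<bar>dr G x\<bar> \<le> L"
    unfolding bounded_pos by (auto simp: image_iff)
  define Gc where "Gc = (\<lambda>x. G (trunc_to T (fst x), trunc_to (a+1) (fst (snd x)), trunc_to (a+1) (snd (snd x))))"
  have cGc: "continuous_on UNIV Gc" unfolding Gc_def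
    by (intro continuous_on_compose2[OF cG] continuous_intros) auto
  have mem: "(trunc_to T t, trunc_to (a+1) r, trunc_to (a+1) z) \<in> C" for t r z
    using trunc_to_bound[of T t] trunc_to_bound[of "a+1" r] trunc_to_bound[of "a+1" z] T a
    by (auto simp: C_def abs_le_iff)
  have Gc_bound: "\<bar>Gc x\<bar> \<le> B0" for x unfolding Gc_def by (intro B0 mem)
  have Gc_lip: "\<bar>Gc (t, r', z) - Gc (t, r, z)\<bar> \<le> L * \<bar>r' - r\<bar>" for t r r' z
  proof -
    let ?t = "trunc_to T t" and ?r = "trunc_to (a+1) r" and ?r' = "trunc_to (a+1) r'" and ?z = "trunc_to (a+1) z"
    have "Gc (t, r', z) - Gc (t, r, z) = slope (dr G) ?t (?r, ?z) (?r', ?z) * (?r' - ?r)"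
      using hadamard[OF G, of ?t "(?r', ?z)" "(?r, ?z)"] by (simp add: Gc_def)
    moreover have "\<bar>slope (dr G) ?t (?r, ?z) (?r', ?z) - 0\<bar> \<le> L"
    proof (rule slope_bound[OF cdG])
      fix \<tau> :: real assume \<tau>: "0 \<le> \<tau>" "\<tau> \<le> 1"
      have "convex {-(a+1)..a+1}" by simp
      then have "(1 - \<tau>) *\<^sub>R ?r + \<tau> *\<^sub>R ?r' \<in> {-(a+1)..a+1}"
        using mem[of t r z] mem[of t r' z] \<tau> unfolding C_def by (intro convexD_alt) auto
      then have "(?t, ?r + \<tau> * (?r' - ?r), ?z) \<in> C"
        using mem[of t r z] by (auto simp: C_def algebra_simps)
      then show "\<bar>dr G (?t, fst (?r, ?z) + \<tau> * (fst (?r', ?z) - fst (?r, ?z)), snd (?r, ?z) + \<tau> * (snd (?r', ?z) - snd (?r, ?z))) - 0\<bar> \<le> L"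
        using L(2) by simp
    qed
    ultimately have "\<bar>Gc (t, r', z) - Gc (t, r, z)\<bar> \<le> L * \<bar>?r' - ?r\<bar>"
      by (simp add: abs_mult mult_right_mono)
    also have "\<dots> \<le> L * \<bar>r' - r\<bar>" using trunc_to_dist L by (intro mult_left_mono) auto
    finally show ?thesis .
  qed
  \<comment> \<open>The summand \<open>L\<close> makes the Picard operator a contraction with factor
    1/2, the summand \<open>B0\<close> keeps the drift below 1.\<close>
  define \<delta> where "\<delta> = 1 / (2 * T * (L + B0))"
  have "\<delta> > 0" using T L B0 by (simp add: \<delta>_def)
  have "\<exists>u. flow G T a (T * B0) \<epsilon> u" if \<epsilon>: "\<bar>\<epsilon>\<bar> < \<delta>" for \<epsilon>
  proof -
    have "\<bar>\<epsilon>\<bar> * (2 * T * (L + B0)) < 1"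
      using \<epsilon> T L B0 pos_less_divide_eq[of "2 * T * (L + B0)" "\<bar>\<epsilon>\<bar>" 1] by (simp add: \<delta>_def)
    moreover have "\<bar>\<epsilon>\<bar> * T * L \<ge> 0" "\<bar>\<epsilon>\<bar> * T * B0 \<ge> 0" using T L B0 by auto
    ultimately have small: "\<bar>\<epsilon>\<bar> * T * L \<le> 1/2" "\<bar>\<epsilon>\<bar> * T * B0 \<le> 1" by (simp_all add: algebra_simps)
    define f where "f = (\<lambda>(u :: real \<times> real \<times> real \<Rightarrow> real) y. Gc (fst y, u y, snd (snd y)))"
    \<comment> \<open>Time and initial radius are truncated too, so that \<open>F u\<close> is
      bounded on the whole space and Banach's theorem applies to bounded continuous
      functions.\<close>
    define F where "F = (\<lambda>u x. trunc_to a (fst (snd x)) + \<epsilon> * Jint (f u) (trunc_to T (fst x), snd x))"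
    have cf: "continuous_on UNIV (f u)" if "continuous_on UNIV u" for u
      unfolding f_def by (intro continuous_on_compose2[OF cGc] continuous_intros that) auto
    have cf': "continuous_on {-(T+1)<..<T+1} (\<lambda>t. f u (t, p))" if "continuous_on UNIV u" for u p
      by (intro continuous_on_compose2[OF cf[OF that]] continuous_intros) auto
    have trT: "\<bar>trunc_to T t\<bar> < T + 1" "\<bar>trunc_to T t\<bar> \<le> T" for t using trunc_to_bound[of T t] T by auto
    have Jb: "\<bar>Jint (f u) (trunc_to T t, p)\<bar> \<le> T * B0" if "continuous_on UNIV u" for u t p
    proof -
      have "\<bar>Jint (f u) (trunc_to T t, p) - Jint (\<lambda>_. 0) (trunc_to T t, p)\<bar> \<le> \<bar>trunc_to T t\<bar> * B0"
        by (rule Jint_diff_bound[OF cf'[OF that] _ trT(1)]) (auto simp: f_def Gc_bound)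
      also have "\<dots> \<le> T * B0" using trT B0 by (intro mult_right_mono) auto
      finally show ?thesis by (simp add: Jint_def)
    qed
    have cF: "continuous_on UNIV (F u)" if "continuous_on UNIV u" for u
    proof -
      have "continuous_on ({-(T+1)<..<T+1} \<times> UNIV) (Jint (f u))"
        by (rule Jint_continuous) (rule continuous_on_subset[OF cf[OF that]], simp)
      moreover have "(\<lambda>x. (trunc_to T (fst x), snd x)) ` UNIV \<subseteq> {-(T+1)<..<T+1} \<times> (UNIV :: (real \<times> real) set)"
      proof (intro image_subsetI)
        fix x :: "real \<times> real \<times> real"
        show "(trunc_to T (fst x), snd x) \<in> {-(T+1)<..<T+1} \<times> UNIV"
          using trT(1)[of "fst x"] unfolding abs_less_iff by simp
      qed
      moreover have "continuous_on UNIV (\<lambda>x :: real \<times> real \<times> real. (trunc_to T (fst x), snd x))"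
        by (intro continuous_intros)
      ultimately have "continuous_on UNIV (\<lambda>x. Jint (f u) (trunc_to T (fst x), snd x))"
        using continuous_on_compose2 by blast
      then show ?thesis unfolding F_def by (intro continuous_intros)
    qed
    have bF: "norm (F u x) \<le> a + \<bar>\<epsilon>\<bar> * (T * B0)" if "continuous_on UNIV u" for u x
    proof -
      have "\<bar>\<epsilon> * Jint (f u) (trunc_to T (fst x), snd x)\<bar> \<le> \<bar>\<epsilon>\<bar> * (T * B0)"
        unfolding abs_mult by (intro mult_left_mono Jb that) auto
      then show ?thesis using trunc_to_bound[of a "fst (snd x)"] a unfolding F_def real_norm_def by linarith
    qed
    have app: "apply_bcontfun (Bcontfun (F u)) = F u" if "continuous_on UNIV u" for u
      by (rule Bcontfun_inverse, rule bcontfun_normI[OF cF[OF that] bF[OF that]])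
    have "\<exists>!u. Bcontfun (F (apply_bcontfun u)) = u"
    proof (rule banach_fix_type[of "1/2"])
      show "\<forall>u v. dist (Bcontfun (F (apply_bcontfun u))) (Bcontfun (F (apply_bcontfun v))) \<le> 1/2 * dist u v"
      proof (intro allI dist_bound)
        fix u v :: "(real \<times> real \<times> real) \<Rightarrow>\<^sub>C real" and x :: "real \<times> real \<times> real"
        let ?t = "trunc_to T (fst x)"
        have "\<bar>Jint (f u) (?t, snd x) - Jint (f v) (?t, snd x)\<bar> \<le> \<bar>?t\<bar> * (L * dist u v)"
        proof (rule Jint_diff_bound[OF cf' cf' trT(1)])
          fix t
          have "\<bar>f u (t, snd x) - f v (t, snd x)\<bar> \<le> L * \<bar>u (t, snd x) - v (t, snd x)\<bar>"
            unfolding f_def fst_conv snd_conv by (rule Gc_lip)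
          also have "\<dots> \<le> L * dist u v"
            using dist_bounded[of u "(t, snd x)" v] L by (intro mult_left_mono) (auto simp: dist_real_def)
          finally show "\<bar>f u (t, snd x) - f v (t, snd x)\<bar> \<le> L * dist u v" .
        qed auto
        also have "\<dots> \<le> T * (L * dist u v)" using trT L by (intro mult_right_mono) auto
        finally have "\<bar>\<epsilon>\<bar> * \<bar>Jint (f u) (?t, snd x) - Jint (f v) (?t, snd x)\<bar> \<le> \<bar>\<epsilon>\<bar> * (T * (L * dist u v))"
          by (intro mult_left_mono) auto
        also have "\<dots> = (\<bar>\<epsilon>\<bar> * T * L) * dist u v" by simp
        also have "\<dots> \<le> 1/2 * dist u v" using small by (intro mult_right_mono) auto
        finally show "dist (apply_bcontfun (Bcontfun (F u)) x) (apply_bcontfun (Bcontfun (F v)) x) \<le> 1/2 * dist u v"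
          unfolding app[OF continuous_on_apply_bcontfun] dist_real_def
          by (simp add: F_def abs_mult flip: right_diff_distrib)
      qed
    qed auto
    then obtain u0 where u0: "Bcontfun (F (apply_bcontfun u0)) = u0" by blast
    define u where "u = apply_bcontfun u0"
    have cu: "continuous_on UNIV u" by (simp add: u_def)
    have fixpt: "u x = F u x" for x using app[OF cu] u0 by (metis u_def)
    show ?thesis unfolding flow_def
    proof (intro exI[of _ u] conjI allI impI cu)
      fix r z assume rz: "\<bar>r\<bar> \<le> a" "\<bar>z\<bar> \<le> a"
      show "u (0, r, z) = r" using rz T by (subst fixpt) (simp add: F_def)
      fix \<theta> assume \<theta>: "\<bar>\<theta>\<bar> < T"
      have eq: "u (t, r, z) = r + \<epsilon> * Jint (f u) (t, r, z)" if "\<bar>t\<bar> < T" for t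
        using rz that by (subst fixpt) (simp add: F_def)
      have "\<bar>\<epsilon> * Jint (f u) (\<theta>, r, z)\<bar> \<le> \<bar>\<epsilon>\<bar> * (T * B0)"
        unfolding abs_mult using Jb[OF cu, of \<theta> "(r, z)"] \<theta> by (intro mult_left_mono) auto
      then show b: "\<bar>u (\<theta>, r, z) - r\<bar> \<le> T * B0 * \<bar>\<epsilon>\<bar>"
        using eq[OF \<theta>] by (simp add: mult_ac)
      have "((\<lambda>t. r + \<epsilon> * Jint (f u) (t, r, z)) has_real_derivative \<epsilon> * f u (\<theta>, r, z)) (at \<theta>)"
        using Jint_has_derivative[OF cf'[OF cu], of \<theta> "(r, z)"] \<theta> by (auto intro!: derivative_eq_intros)
      then have "((\<lambda>t. u (t, r, z)) has_real_derivative \<epsilon> * f u (\<theta>, r, z)) (at \<theta>)"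
        by (rule has_field_derivative_transform_within_open[where S = "{-T<..<T}"])
          (use eq \<theta> in \<open>auto simp: abs_less_iff\<close>)
      moreover have "\<bar>u (\<theta>, r, z)\<bar> \<le> a + 1" using b small(2) rz(1) by (simp add: mult_ac)
      ultimately show "((\<lambda>t. u (t, r, z)) has_real_derivative \<epsilon> * G (\<theta>, u (\<theta>, r, z), z)) (at \<theta>)"
        using \<theta> rz by (simp add: f_def Gc_def)
    qed
  qed
  moreover have "T * B0 > 0" using T B0 by simp
  ultimately show ?thesis using \<open>\<delta> > 0\<close> by blast
qed

section \<open>Persistence of simple zeros\<close>

text \<open>Existence is the intermediate value theorem. Continuity comes from compactness: by
  uniqueness the graph of \<open>R\<close> is a closed set, and its values lie in a compact
  interval.\<close>

lemma continuous_zero_selection: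
  fixes P :: "real \<times> 'a::euclidean_space \<Rightarrow> real" and c :: "'a \<Rightarrow> real"
  assumes K: "compact K" and c: "continuous_on K c" and \<kappa>: "\<kappa> > 0" and P: "continuous_on (UNIV \<times> K) P"
    and sgn: "\<And>y. y \<in> K \<Longrightarrow> P (c y - \<kappa>, y) * P (c y + \<kappa>, y) < 0"
    and uniq: "\<And>y r r'. y \<in> K \<Longrightarrow> \<bar>r - c y\<bar> \<le> \<kappa> \<Longrightarrow> \<bar>r' - c y\<bar> \<le> \<kappa> \<Longrightarrow> P (r, y) = 0 \<Longrightarrow> P (r', y) = 0 \<Longrightarrow> r = r'"
  obtains R where "continuous_on K R" "\<And>y. y \<in> K \<Longrightarrow> \<bar>R y - c y\<bar> < \<kappa> \<and> P (R y, y) = 0"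
proof -
  have ex: "\<exists>r. \<bar>r - c y\<bar> < \<kappa> \<and> P (r, y) = 0" if y: "y \<in> K" for y
  proof -
    have cont: "continuous_on {c y - \<kappa>..c y + \<kappa>} (\<lambda>r. P (r, y))"
      by (intro continuous_on_compose2[OF P] continuous_intros) (use y in auto)
    have "\<exists>r. c y - \<kappa> \<le> r \<and> r \<le> c y + \<kappa> \<and> P (r, y) = 0"
    proof (cases "P (c y - \<kappa>, y) < 0")
      case True
      then have "P (c y + \<kappa>, y) > 0" using sgn[OF y] by (simp add: mult_less_0_iff)
      then show ?thesis using IVT'[of "\<lambda>r. P (r, y)" "c y - \<kappa>" 0 "c y + \<kappa>"] True cont \<kappa> by auto
    next
      case False
      then have "P (c y - \<kappa>, y) > 0" "P (c y + \<kappa>, y) < 0" using sgn[OF y] by (auto simp: mult_less_0_iff)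
      then show ?thesis using IVT2'[of "\<lambda>r. P (r, y)" "c y + \<kappa>" 0 "c y - \<kappa>"] cont \<kappa> by auto
    qed
    then obtain r where r: "c y - \<kappa> \<le> r" "r \<le> c y + \<kappa>" "P (r, y) = 0" by blast
    moreover have "r \<noteq> c y - \<kappa>" "r \<noteq> c y + \<kappa>" using r(3) sgn[OF y] by auto
    ultimately have "\<bar>r - c y\<bar> < \<kappa>" by auto
    then show ?thesis using r(3) by blast
  qed
  then obtain R where R: "\<And>y. y \<in> K \<Longrightarrow> \<bar>R y - c y\<bar> < \<kappa> \<and> P (R y, y) = 0" by metis
  have "bounded (c ` K)" using K c by (intro compact_imp_bounded compact_continuous_image)
  then obtain M where M: "\<And>y. y \<in> K \<Longrightarrow> \<bar>c y\<bar> \<le> M" by (auto simp: bounded_iff)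
  define T where "T = {-(M + \<kappa>)..M + \<kappa>}"
  have RT: "R \<in> K \<rightarrow> T"
  proof
    fix y assume "y \<in> K"
    with R[of y] M[of y] show "R y \<in> T" unfolding T_def atLeastAtMost_iff by linarith
  qed
  \<comment> \<open>A continuous function whose zero set is the graph: the first summand forces
    \<open>P\<close> to vanish, the second a distance of at most \<kappa> from \<open>c\<close>.
    This closed condition suffices because \<open>uniq\<close> covers the closed interval.\<close>
  define f where "f = (\<lambda>x. \<bar>P (snd x, fst x)\<bar> + max 0 (\<bar>snd x - c (fst x)\<bar> - \<kappa>))"
  have "continuous_on (K \<times> T) f" unfolding f_def
    by (intro continuous_intros continuous_on_compose2[OF P] continuous_on_compose2[OF c]) auto
  then have "closed {x \<in> K \<times> T. f x = 0}"
    using K by (intro continuous_closed_preimage_constant) (auto simp: T_def intro: closed_Times compact_imp_closed)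
  moreover have "{x \<in> K \<times> T. f x = 0} = (\<lambda>y. (y, R y)) ` K"
  proof (intro set_eqI iffI)
    fix x assume "x \<in> {x \<in> K \<times> T. f x = 0}"
    then have x: "fst x \<in> K" "f x = 0" by auto
    then have "P (snd x, fst x) = 0" "\<bar>snd x - c (fst x)\<bar> \<le> \<kappa>" unfolding f_def by linarith+
    then have "snd x = R (fst x)" using uniq[OF x(1)] R[OF x(1)] by auto
    then show "x \<in> (\<lambda>y. (y, R y)) ` K" using x(1) by (intro image_eqI[of _ _ "fst x"]) (auto simp: prod_eq_iff)
  next
    fix x assume "x \<in> (\<lambda>y. (y, R y)) ` K"
    then show "x \<in> {x \<in> K \<times> T. f x = 0}" using R RT by (force simp: f_def)
  qed
  ultimately have "continuous_on K R"
    using K RT by (intro continuous_from_closed_graph[where T = T]) (auto simp: T_def)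
  then show ?thesis using that R by blast
qed

text \<open>With \<open>angular_field\<close> in both places this is the function \<open>psi\<close>
  (see \<open>psi_eq_avg\<close>): the half-turn from \<pi> to 2\<pi> is moved back to the one from
  -\<pi> to 0, so that both integrals start at \<theta> = 0.\<close>

definition avg :: "(real \<times> real \<times> real \<Rightarrow> real) \<Rightarrow> (real \<times> real \<times> real \<Rightarrow> real) \<Rightarrow> real \<times> real \<Rightarrow> real" where
  "avg gp gm p = Jint gp (pi, p) - Jint gm (- pi, p)"

lemma Jint_continuous_UNIV:
  fixes g :: "real \<times> real \<times> real \<Rightarrow> real"
  assumes "continuous_on UNIV g"
  shows "continuous_on UNIV (\<lambda>p. Jint g (\<theta>, p))"
proof -
  have "continuous_on ({-(\<bar>\<theta>\<bar>+1)<..<\<bar>\<theta>\<bar>+1} \<times> UNIV) (Jint g)"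
    by (rule Jint_continuous) (rule continuous_on_subset[OF assms], simp)
  then show ?thesis by (rule continuous_on_compose2) (auto intro: continuous_intros)
qed

lemma avg_continuous:
  assumes "continuous_on UNIV gp" "continuous_on UNIV gm"
  shows "continuous_on UNIV (avg gp gm)"
  unfolding avg_def[abs_def] by (intro continuous_intros Jint_continuous_UNIV assms)

lemma Jint_deriv_r:
  assumes G: "Ck_on 1 G UNIV"
  shows "((\<lambda>r. Jint G (\<theta>, r, z)) has_real_derivative Jint (dr G) (\<theta>, r, z)) (at r)"
proof -
  have D: "(G has_derivative frechet_derivative G (at x)) (at x)" for x
    using Ck_on_SucD[of 0 G UNIV] G by simp
  have c: "continuous_on UNIV (\<lambda>x. frechet_derivative G (at x) v)" for v
    using G unfolding One_nat_def Ck_on.simps by blast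
  have cG: "continuous_on UNIV G" using G Ck_on_continuous by blast
  have d: "((\<lambda>s. G (t, s, z)) has_real_derivative dr G (t, s, z)) (at s)" for t s
  proof -
    have "((\<lambda>s. (t, s, z)) has_derivative (\<lambda>h. h *\<^sub>R (0, 1, 0))) (at s)"
      by (auto intro!: derivative_eq_intros)
    from has_derivative_compose[OF this D]
    have "((\<lambda>s. G (t, s, z)) has_derivative (\<lambda>h. frechet_derivative G (at (t, s, z)) (h *\<^sub>R (0, 1, 0)))) (at s)" .
    moreover have "(\<lambda>h. frechet_derivative G (at (t, s, z)) (h *\<^sub>R (0, 1, 0))) = (*) (dr G (t, s, z))"
      using linear_cmul[OF has_derivative_linear[OF D], of "(t, s, z)" _ "(0, 1, 0)"]
      by (intro ext) (simp only: real_scaleR_def mult.commute)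
    ultimately show ?thesis by (simp only: has_field_derivative_def)
  qed
  have "((\<lambda>s. Jint (\<lambda>x. G (fst x, snd x, z)) (\<theta>, s)) has_real_derivative Jint (\<lambda>x. dr G (fst x, snd x, z)) (\<theta>, r)) (at r)"
    by (rule Jint_partial[where T = "\<bar>\<theta>\<bar> + 1" and Z = UNIV])
     (auto intro!: continuous_intros continuous_on_compose2[OF cG] continuous_on_compose2[OF c] d)
  then show ?thesis by (simp add: Jint_def)
qed

lemma avg_deriv_r:
  assumes "Ck_on 1 Gp UNIV" "Ck_on 1 Gm UNIV"
  shows "((\<lambda>r. avg Gp Gm (r, z)) has_real_derivative avg (dr Gp) (dr Gm) (r, z)) (at r)"
  unfolding avg_def by (intro DERIV_diff Jint_deriv_r assms)

lemma avg_diff_bound: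
  fixes p q :: "'p"
  assumes f: "continuous_on {-T<..<T} (\<lambda>t. f (t, p))" "continuous_on {-T<..<T} (\<lambda>t. f' (t, p))" "pi < T"
    and g: "continuous_on {-T<..<T} (\<lambda>t. g (t, p))" "continuous_on {-T<..<T} (\<lambda>t. g' (t, p))"
    and b: "\<And>t. \<bar>t\<bar> \<le> pi \<Longrightarrow> \<bar>f (t, p) - g (t, p)\<bar> \<le> M" "\<And>t. \<bar>t\<bar> \<le> pi \<Longrightarrow> \<bar>f' (t, p) - g' (t, p)\<bar> \<le> M"
  shows "\<bar>(Jint f (pi, p) - Jint f' (-pi, p)) - (Jint g (pi, p) - Jint g' (-pi, p))\<bar> \<le> 2 * pi * M"
proof -
  have p: "\<bar>pi\<bar> = pi" "\<bar>-pi\<bar> = pi" using pi_gt_zero by auto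
  have "\<bar>Jint f (pi, p) - Jint g (pi, p)\<bar> \<le> pi * M"
    using Jint_diff_bound[OF f(1) g(1), of pi M] b(1) f(3) p by auto
  moreover have "\<bar>Jint f' (-pi, p) - Jint g' (-pi, p)\<bar> \<le> pi * M"
    using Jint_diff_bound[OF f(2) g(2), of "-pi" M] b(2) f(3) p by auto
  ultimately show ?thesis by linarith
qed

text \<open>\<open>R\<close> replaces the radius of each simple zero \<open>p\<close> by the initial
  radius of a closed orbit over the same z, at a distance of at most \<eta>. The inequality of the
  two \<open>Jint\<close> is nondegeneracy along the perturbed solutions, as smooth dependence on z
  requires. Times up to 2\<pi> leave room beyond the matching times.\<close>

definition persistent ::
  "(real \<times> real \<times> real \<Rightarrow> real) \<Rightarrow> (real \<times> real \<times> real \<Rightarrow> real) \<Rightarrow> (real \<times> real) set \<Rightarrow> real \<Rightarrow> real \<Rightarrow> bool" where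
  "persistent Gp Gm K \<eta> \<epsilon> \<longleftrightarrow> (\<exists>up um R.
     continuous_on UNIV up \<and> continuous_on UNIV um \<and> continuous_on K R \<and>
     inj_on (\<lambda>p. (R p, snd p)) K \<and>
     (\<forall>p\<in>K. R p > 0 \<and> \<bar>R p - fst p\<bar> \<le> \<eta> \<and>
       up (0, R p, snd p) = R p \<and> um (0, R p, snd p) = R p \<and>
       up (pi, R p, snd p) = um (- pi, R p, snd p) \<and>
       Jint (\<lambda>x. dr Gp (fst x, up x, snd (snd x))) (pi, R p, snd p) \<noteq>
       Jint (\<lambda>x. dr Gm (fst x, um x, snd (snd x))) (- pi, R p, snd p) \<and>
       (\<forall>\<theta>. \<bar>\<theta>\<bar> < 2 * pi \<longrightarrow> up (\<theta>, R p, snd p) > 0 \<and> um (\<theta>, R p, snd p) > 0 \<and>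
         ((\<lambda>t. up (t, R p, snd p)) has_real_derivative \<epsilon> * Gp (\<theta>, up (\<theta>, R p, snd p), snd p)) (at \<theta>) \<and>
         ((\<lambda>t. um (t, R p, snd p)) has_real_derivative \<epsilon> * Gm (\<theta>, um (\<theta>, R p, snd p), snd p)) (at \<theta>))))"

text \<open>A solution that starts at \<open>r\<close> on \<open>\<theta> = 0\<close> is \<open>2\<pi>\<close>-periodic iff the flows of the two fields match
  at \<open>\<pi>\<close> and \<open>-\<pi>\<close>; the mismatch is \<open>\<epsilon>\<close> times a perturbation of \<open>avg\<close>.\<close>

lemma continuation:
  assumes Gp: "Ck_on 1 Gp UNIV" and Gm: "Ck_on 1 Gm UNIV"
    and K: "compact K"
    and zero: "\<And>p. p \<in> K \<Longrightarrow> fst p > 0 \<and> avg Gp Gm p = 0 \<and> avg (dr Gp) (dr Gm) p \<noteq> 0"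
    and \<eta>: "\<eta> > 0"
  shows "\<exists>\<delta>>0. \<forall>\<epsilon>. \<epsilon> \<noteq> 0 \<longrightarrow> \<bar>\<epsilon>\<bar> < \<delta> \<longrightarrow> persistent Gp Gm K \<eta> \<epsilon>"
proof (cases "K = {}")
  case True
  then show ?thesis by (intro exI[of _ 1]) (auto simp: persistent_def intro!: exI[of _ "\<lambda>_. 0"])
next
  case False
  let ?Qr = "avg (dr Gp) (dr Gm)"
  have cdp: "continuous_on UNIV (dr Gp)" and cdm: "continuous_on UNIV (dr Gm)"
    using Gp Gm unfolding One_nat_def Ck_on.simps by blast+
  have cQr: "continuous_on UNIV ?Qr" by (rule avg_continuous[OF cdp cdm])
  obtain A where A: "A > 0" "\<And>p. p \<in> K \<Longrightarrow> \<bar>fst p\<bar> \<le> A \<and> \<bar>snd p\<bar> \<le> A"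
  proof -
    obtain A where "A > 0" "\<And>p. p \<in> K \<Longrightarrow> norm p \<le> A"
      using compact_imp_bounded[OF K] unfolding bounded_pos by blast
    then show ?thesis using that norm_fst_le norm_snd_le order_trans unfolding real_norm_def[symmetric] by (metis prod.collapse)
  qed
  obtain m where m: "m > 0" "\<And>p. p \<in> K \<Longrightarrow> fst p \<ge> m"
  proof -
    have "continuous_on K fst" by (intro continuous_intros)
    then obtain p0 where "p0 \<in> K" "\<And>p. p \<in> K \<Longrightarrow> fst p0 \<le> fst p"
      using continuous_attains_inf[OF K False] by blast
    then show ?thesis using that[of "fst p0"] zero by blast
  qed
  \<comment> \<open>The factor 4 is a reserve: moving the radius by at most 2\<kappa> will change
    \<open>?Qr\<close> by at most 2\<pi> times \<open>c/4\<close>, which is below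
    \<open>2 * c\<close> as \<pi> < 4, so more than \<open>2 * c\<close> survives.\<close>
  obtain c where c: "c > 0" "\<And>p. p \<in> K \<Longrightarrow> \<bar>?Qr p\<bar> \<ge> 4 * c"
  proof -
    obtain p0 where p0: "p0 \<in> K" "\<And>p. p \<in> K \<Longrightarrow> \<bar>?Qr p0\<bar> \<le> \<bar>?Qr p\<bar>"
      using continuous_attains_inf[OF K False continuous_on_rabs[OF continuous_on_subset[OF cQr subset_UNIV]]]
      by blast
    then show ?thesis using that[of "\<bar>?Qr p0\<bar> / 4"] zero by auto
  qed
  \<comment> \<open>The margin 2 accommodates all radii within 2\<kappa> of \<open>K\<close>, since
    \<kappa> will be at most 1.\<close>
  define C where "C = {-2*pi..2*pi} \<times> {-(A+2)..A+2} \<times> {-(A+2)..A+2}"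
  have C: "compact C" unfolding C_def by (auto intro!: compact_Times)
  obtain L where L: "L > 0" "\<And>x. x \<in> C \<Longrightarrow> \<bar>dr Gp x\<bar> \<le> L" "\<And>x. x \<in> C \<Longrightarrow> \<bar>dr Gm x\<bar> \<le> L"
  proof -
    have "bounded (dr Gp ` C \<union> dr Gm ` C)" using C
      by (auto intro!: compact_imp_bounded compact_continuous_image continuous_on_subset[OF cdp] continuous_on_subset[OF cdm])
    then obtain L where "L > 0" "\<And>y. y \<in> dr Gp ` C \<union> dr Gm ` C \<Longrightarrow> norm y \<le> L"
      unfolding bounded_pos by blast
    then show ?thesis using that[of L] by auto
  qed
  obtain \<kappa>0 where \<kappa>0: "\<kappa>0 > 0"
    "\<And>x y. x \<in> C \<Longrightarrow> y \<in> C \<Longrightarrow> dist x y < \<kappa>0 \<Longrightarrow> \<bar>dr Gp x - dr Gp y\<bar> \<le> c/4 \<and> \<bar>dr Gm x - dr Gm y\<bar> \<le> c/4"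
  proof -
    have c4: "c/4 > 0" using c(1) by simp
    have uc: "uniformly_continuous_on C (dr Gp)" "uniformly_continuous_on C (dr Gm)"
      using C by (auto intro!: compact_uniformly_continuous continuous_on_subset[OF cdp] continuous_on_subset[OF cdm])
    obtain d1 d2 where "d1 > 0" "d2 > 0"
      "\<And>x y. x \<in> C \<Longrightarrow> y \<in> C \<Longrightarrow> dist x y < d1 \<Longrightarrow> dist (dr Gp x) (dr Gp y) < c/4"
      "\<And>x y. x \<in> C \<Longrightarrow> y \<in> C \<Longrightarrow> dist x y < d2 \<Longrightarrow> dist (dr Gm x) (dr Gm y) < c/4"
      using uc[unfolded uniformly_continuous_on_def, rule_format, OF c4] by blast
    then show ?thesis using that[of "min d1 d2"] by (auto simp: dist_real_def less_imp_le)
  qed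
  \<comment> \<open>In order: the required closeness, radii that stay positive even 2\<kappa> away,
    containment in \<open>C\<close>, and the range of uniform continuity.\<close>
  define \<kappa> where "\<kappa> = min (min \<eta> (m/4)) (min 1 (\<kappa>0/4))"
  have \<kappa>: "\<kappa> > 0" "\<kappa> \<le> \<eta>" "\<kappa> \<le> m/4" "\<kappa> \<le> 1" "2 * \<kappa> < \<kappa>0"
    using \<eta> m \<kappa>0 by (auto simp: \<kappa>_def min_def)
  have inC: "(t, r, snd p) \<in> C" if "\<bar>t\<bar> \<le> 2*pi" "p \<in> K" "\<bar>r - fst p\<bar> \<le> 2*\<kappa>" for t r p
    unfolding C_def mem_Sigma_iff atLeastAtMost_iff
    using A(2)[OF that(2)] that \<kappa>(4) by linarith
  have near: "\<bar>dr Gp (t, r, snd p) - dr Gp (t, p)\<bar> \<le> c/4" "\<bar>dr Gm (t, r, snd p) - dr Gm (t, p)\<bar> \<le> c/4"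
    if "\<bar>t\<bar> \<le> pi" "p \<in> K" "\<bar>r - fst p\<bar> \<le> 2*\<kappa>" for t r p
  proof -
    have t: "\<bar>t\<bar> \<le> 2*pi" using that(1) pi_gt_zero by linarith
    have "dist (t, r, snd p) (t, p) = \<bar>r - fst p\<bar>"
      by (cases p) (simp add: dist_Pair_Pair dist_real_def)
    then have "dist (t, r, snd p) (t, p) < \<kappa>0" using that(3) \<kappa>(5) by linarith
    moreover have "(t, p) \<in> C" using inC[OF t that(2), of "fst p"] \<kappa>(1) by simp
    ultimately show "\<bar>dr Gp (t, r, snd p) - dr Gp (t, p)\<bar> \<le> c/4" "\<bar>dr Gm (t, r, snd p) - dr Gm (t, p)\<bar> \<le> c/4"
      using \<kappa>0(2) inC[OF t that(2,3)] by blast+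
  qed
  have pic: "2 * pi * (c/4) < 2 * c" using pi_less_4 c(1) by simp
  have cline: "continuous_on S (\<lambda>t. g (t, q))" if "continuous_on UNIV g" for S :: "real set" and g :: "real \<times> real \<times> real \<Rightarrow> real" and q
    by (intro continuous_on_compose2[OF that] continuous_intros) auto
  have Qr_near: "\<bar>?Qr (r, snd p) - ?Qr p\<bar> < 2 * c" if "p \<in> K" "\<bar>r - fst p\<bar> \<le> 2*\<kappa>" for r p
  proof -
    have "\<bar>(Jint (\<lambda>x. dr Gp (fst x, r, snd p)) (pi, p) - Jint (\<lambda>x. dr Gm (fst x, r, snd p)) (-pi, p)) - ?Qr p\<bar> \<le> 2 * pi * (c/4)"
      unfolding avg_def
      by (rule avg_diff_bound[where T = 4]) (use near that pi_less_4 in \<open>auto intro!: cline cdp cdm continuous_on_compose2[OF cdp] continuous_on_compose2[OF cdm] continuous_intros\<close>)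
    also have "Jint (\<lambda>x. dr Gp (fst x, r, snd p)) (pi, p) - Jint (\<lambda>x. dr Gm (fst x, r, snd p)) (-pi, p) = ?Qr (r, snd p)"
      by (simp add: Jint_def avg_def)
    finally show ?thesis using pic by linarith
  qed
  \<comment> \<open>Multiplying by this sign makes the averaged function increasing near every zero,
    so that both signs of the derivative are treated at once.\<close>
  define sg where "sg = (\<lambda>p. sgn (?Qr p))"
  have sg_pos: "sg p * ?Qr (r, snd p) \<ge> 2 * c" if "p \<in> K" "\<bar>r - fst p\<bar> \<le> 2*\<kappa>" for r p
    using Qr_near[OF that] c(2)[OF that(1)] c(1) unfolding sg_def
    by (cases "?Qr p > 0"; cases "?Qr p < 0") auto
  have mono: "sg p * avg Gp Gm (r2, snd p) - sg p * avg Gp Gm (r1, snd p) \<ge> 2 * c * (r2 - r1)"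
    if p: "p \<in> K" and r: "r1 \<le> r2" "\<bar>r1 - fst p\<bar> \<le> 2*\<kappa>" "\<bar>r2 - fst p\<bar> \<le> 2*\<kappa>" for p r1 r2
  proof (cases "r1 = r2")
    case False
    then have "r1 < r2" using r by simp
    have "((\<lambda>r. sg p * avg Gp Gm (r, snd p)) has_real_derivative sg p * ?Qr (x, snd p)) (at x)" for x
      by (intro DERIV_cmult avg_deriv_r Gp Gm)
    from MVT2[OF \<open>r1 < r2\<close> this] obtain \<xi> where \<xi>: "r1 < \<xi>" "\<xi> < r2"
      "sg p * avg Gp Gm (r2, snd p) - sg p * avg Gp Gm (r1, snd p) = (r2 - r1) * (sg p * ?Qr (\<xi>, snd p))" by auto
    have "\<bar>\<xi> - fst p\<bar> \<le> 2*\<kappa>" using \<xi> r by linarith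
    then have "(r2 - r1) * (sg p * ?Qr (\<xi>, snd p)) \<ge> (r2 - r1) * (2 * c)"
      using sg_pos[OF p] r by (intro mult_left_mono) auto
    then show ?thesis using \<xi>(3) by (simp add: mult_ac)
  qed simp
  have A2: "A + 2 > 0" "2 * pi > 0" using A by simp_all
  obtain \<delta>p Bp where p: "\<delta>p > 0" "Bp > 0" "\<And>\<epsilon>. \<bar>\<epsilon>\<bar> < \<delta>p \<Longrightarrow> \<exists>u. flow Gp (2*pi) (A+2) Bp \<epsilon> u"
    using flow_exists[OF Gp A2(2,1)] by blast
  obtain \<delta>m Bm where mm: "\<delta>m > 0" "Bm > 0" "\<And>\<epsilon>. \<bar>\<epsilon>\<bar> < \<delta>m \<Longrightarrow> \<exists>u. flow Gm (2*pi) (A+2) Bm \<epsilon> u"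
    using flow_exists[OF Gm A2(2,1)] by blast
  define B where "B = max Bp Bm"
  have B: "B > 0" "Bp \<le> B" "Bm \<le> B" using p(2) by (auto simp: B_def)
  \<comment> \<open>Besides existence of the flows: \<open>\<kappa> / B\<close> keeps the drift
    below \<kappa>, and the last term makes the averaging error, at most 2\<pi> times
    \<open>L * B * \<bar>\<epsilon>\<bar>\<close>, smaller than \<open>2 * c * \<kappa>\<close>,
    which bounds the averaged function from below at distance \<kappa> from its zero.\<close>
  define \<delta> where "\<delta> = min (min \<delta>p \<delta>m) (min (\<kappa> / B) (c * \<kappa> / (pi * L * B)))"
  have "\<delta> > 0" using p(1) mm(1) \<kappa>(1) B(1) c(1) L(1) by (simp add: \<delta>_def)
  show ?thesis
  proof (intro exI[of _ \<delta>] conjI \<open>\<delta> > 0\<close> allI impI)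
    fix \<epsilon> :: real assume \<epsilon>0: "\<epsilon> \<noteq> 0" and "\<bar>\<epsilon>\<bar> < \<delta>"
    then have \<epsilon>: "\<bar>\<epsilon>\<bar> < \<delta>p" "\<bar>\<epsilon>\<bar> < \<delta>m" "\<bar>\<epsilon>\<bar> < \<kappa> / B" "\<bar>\<epsilon>\<bar> < c * \<kappa> / (pi * L * B)" by (auto simp: \<delta>_def)
    have B\<epsilon>: "B * \<bar>\<epsilon>\<bar> \<le> \<kappa>" using \<epsilon>(3) B(1) by (simp add: field_simps)
    have small: "2 * pi * (L * (B * \<bar>\<epsilon>\<bar>)) < 2 * c * \<kappa>"
      using \<epsilon>(4) B(1) L(1) pi_gt_zero pos_less_divide_eq[of "pi * L * B" "\<bar>\<epsilon>\<bar>" "c * \<kappa>"] by (simp add: mult_ac)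
    obtain up um where fl: "flow Gp (2*pi) (A+2) Bp \<epsilon> up" "flow Gm (2*pi) (A+2) Bm \<epsilon> um"
      using p(3)[OF \<epsilon>(1)] mm(3)[OF \<epsilon>(2)] by blast
    have cu: "continuous_on UNIV up" "continuous_on UNIV um" using fl by (auto simp: flow_def)
    have inA: "\<bar>r\<bar> \<le> A + 2" "\<bar>snd p\<bar> \<le> A + 2" if "p \<in> K" "\<bar>r - fst p\<bar> \<le> \<kappa>" for r p
      using A(2)[OF that(1)] that(2) \<kappa>(4) by linarith+
    have u0: "up (0, r, snd p) = r" "um (0, r, snd p) = r" if "p \<in> K" "\<bar>r - fst p\<bar> \<le> \<kappa>" for r p
      using fl inA[OF that] by (auto simp: flow_def)
    have ode: "((\<lambda>t. up (t, r, snd p)) has_real_derivative \<epsilon> * Gp (\<theta>, up (\<theta>, r, snd p), snd p)) (at \<theta>)"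
        "((\<lambda>t. um (t, r, snd p)) has_real_derivative \<epsilon> * Gm (\<theta>, um (\<theta>, r, snd p), snd p)) (at \<theta>)"
      if "p \<in> K" "\<bar>r - fst p\<bar> \<le> \<kappa>" "\<bar>\<theta>\<bar> < 2*pi" for r p \<theta>
      using fl inA[OF that(1,2)] that(3) by (auto simp: flow_def)
    have udist: "\<bar>up (\<theta>, r, snd p) - r\<bar> \<le> B * \<bar>\<epsilon>\<bar>" "\<bar>um (\<theta>, r, snd p) - r\<bar> \<le> B * \<bar>\<epsilon>\<bar>"
      if "p \<in> K" "\<bar>r - fst p\<bar> \<le> \<kappa>" "\<bar>\<theta>\<bar> < 2*pi" for r p \<theta>
    proof -
      have "\<bar>up (\<theta>, r, snd p) - r\<bar> \<le> Bp * \<bar>\<epsilon>\<bar>" "\<bar>um (\<theta>, r, snd p) - r\<bar> \<le> Bm * \<bar>\<epsilon>\<bar>"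
        using fl inA[OF that(1,2)] that(3) by (auto simp: flow_def)
      moreover have "Bp * \<bar>\<epsilon>\<bar> \<le> B * \<bar>\<epsilon>\<bar>" "Bm * \<bar>\<epsilon>\<bar> \<le> B * \<bar>\<epsilon>\<bar>" using B by (auto intro: mult_right_mono)
      ultimately show "\<bar>up (\<theta>, r, snd p) - r\<bar> \<le> B * \<bar>\<epsilon>\<bar>" "\<bar>um (\<theta>, r, snd p) - r\<bar> \<le> B * \<bar>\<epsilon>\<bar>" by linarith+
    qed
    have unear: "\<bar>up (\<theta>, r, snd p) - fst p\<bar> \<le> 2*\<kappa>" "\<bar>um (\<theta>, r, snd p) - fst p\<bar> \<le> 2*\<kappa>"
      if "p \<in> K" "\<bar>r - fst p\<bar> \<le> \<kappa>" "\<bar>\<theta>\<bar> < 2*pi" for r p \<theta>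
      using udist[OF that] that(2) B\<epsilon> by linarith+
    have pi2: "\<bar>t\<bar> < 2*pi" if "\<bar>t\<bar> \<le> pi" for t using that pi_gt_zero by linarith
    have pi4: "pi < 2*pi" using pi_gt_zero by linarith
    define P where "P = (\<lambda>(r, p :: real \<times> real). up (pi, r, snd p) - um (- pi, r, snd p))"
    have cP: "continuous_on (UNIV \<times> K) P" unfolding P_def case_prod_unfold
      by (intro continuous_intros continuous_on_compose2[OF cu(1)] continuous_on_compose2[OF cu(2)]) auto
    have P_eq: "P (r, p) = \<epsilon> * (Jint (\<lambda>x. Gp (fst x, up x, snd (snd x))) (pi, r, snd p)
        - Jint (\<lambda>x. Gm (fst x, um x, snd (snd x))) (- pi, r, snd p))"
      if "p \<in> K" "\<bar>r - fst p\<bar> \<le> \<kappa>" for r p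
    proof -
      have "Jint (\<lambda>x. \<epsilon> * Gp (fst x, up x, snd (snd x))) (pi, r, snd p) = up (pi, r, snd p) - up (0, r, snd p)"
        by (rule Jint_eq_antiderivative[of "2*pi"]) (use ode(1)[OF that] pi_gt_zero in auto)
      moreover have "Jint (\<lambda>x. \<epsilon> * Gm (fst x, um x, snd (snd x))) (- pi, r, snd p) = um (- pi, r, snd p) - um (0, r, snd p)"
        by (rule Jint_eq_antiderivative[of "2*pi"]) (use ode(2)[OF that] pi_gt_zero in auto)
      ultimately show ?thesis using u0[OF that] by (simp add: P_def Jint_cmult right_diff_distrib)
    qed
    have lip: "\<bar>G (t, a, snd p) - G (t, b, snd p)\<bar> \<le> L * \<bar>a - b\<bar>"
      if G: "Ck_on 1 G UNIV" "\<And>x. x \<in> C \<Longrightarrow> \<bar>dr G x\<bar> \<le> L" and p: "p \<in> K" and t: "\<bar>t\<bar> \<le> 2*pi"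
        and a: "\<bar>a - fst p\<bar> \<le> 2*\<kappa>" and b: "\<bar>b - fst p\<bar> \<le> 2*\<kappa>" for G t p a b
    proof -
      have cd: "continuous_on UNIV (dr G)" using G(1) unfolding One_nat_def Ck_on.simps by blast
      have "\<bar>slope (dr G) t (b, snd p) (a, snd p) - 0\<bar> \<le> L"
      proof (rule slope_bound[OF cd])
        fix \<tau> :: real assume \<tau>: "0 \<le> \<tau>" "\<tau> \<le> 1"
        have "convex (cball (fst p) (2*\<kappa>))" by simp
        then have "(1 - \<tau>) *\<^sub>R b + \<tau> *\<^sub>R a \<in> cball (fst p) (2*\<kappa>)"
          using a b \<tau> by (intro convexD_alt) (auto simp: dist_real_def abs_minus_commute)
        then have "\<bar>b + \<tau> * (a - b) - fst p\<bar> \<le> 2*\<kappa>" by (simp add: dist_real_def abs_minus_commute algebra_simps)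
        from G(2)[OF inC[OF t p this]]
        show "\<bar>dr G (t, fst (b, snd p) + \<tau> * (fst (a, snd p) - fst (b, snd p)), snd (b, snd p) + \<tau> * (snd (a, snd p) - snd (b, snd p))) - 0\<bar> \<le> L"
          by simp
      qed
      then have "\<bar>slope (dr G) t (b, snd p) (a, snd p)\<bar> * \<bar>a - b\<bar> \<le> L * \<bar>a - b\<bar>" by (intro mult_right_mono) auto
      then show ?thesis using hadamard[OF G(1), of t "(a, snd p)" "(b, snd p)"] by (simp add: abs_mult)
    qed
    have cG: "continuous_on UNIV Gp" "continuous_on UNIV Gm" using Gp Gm Ck_on_continuous by blast+
    have avgP: "\<bar>(Jint (\<lambda>x. Gp (fst x, up x, snd (snd x))) (pi, r, snd p)
        - Jint (\<lambda>x. Gm (fst x, um x, snd (snd x))) (- pi, r, snd p)) - avg Gp Gm (r, snd p)\<bar> < 2 * c * \<kappa>"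
      if "p \<in> K" "\<bar>r - fst p\<bar> \<le> \<kappa>" for r p
    proof -
      have r2: "\<bar>r - fst p\<bar> \<le> 2*\<kappa>" using that(2) \<kappa>(1) by linarith
      have "\<bar>(Jint (\<lambda>x. Gp (fst x, up x, snd (snd x))) (pi, r, snd p)
        - Jint (\<lambda>x. Gm (fst x, um x, snd (snd x))) (- pi, r, snd p)) - avg Gp Gm (r, snd p)\<bar> \<le> 2 * pi * (L * (B * \<bar>\<epsilon>\<bar>))"
        unfolding avg_def
      proof (rule avg_diff_bound[where T = "2*pi", OF _ _ pi4])
        show "continuous_on {- (2 * pi)<..<2 * pi} (\<lambda>t. (\<lambda>x. Gp (fst x, up x, snd (snd x))) (t, r, snd p))"
          "continuous_on {- (2 * pi)<..<2 * pi} (\<lambda>t. (\<lambda>x. Gm (fst x, um x, snd (snd x))) (t, r, snd p))"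
          by (auto intro!: continuous_on_compose2[OF cG(1)] continuous_on_compose2[OF cG(2)] continuous_intros cline cu)
        show "continuous_on {- (2 * pi)<..<2 * pi} (\<lambda>t. Gp (t, r, snd p))"
          "continuous_on {- (2 * pi)<..<2 * pi} (\<lambda>t. Gm (t, r, snd p))" by (intro cline cG)+
        fix t assume t: "\<bar>t\<bar> \<le> pi"
        have t2: "\<bar>t\<bar> < 2*pi" "\<bar>t\<bar> \<le> 2*pi" using pi2[OF t] by auto
        have "\<bar>Gp (t, up (t, r, snd p), snd p) - Gp (t, r, snd p)\<bar> \<le> L * \<bar>up (t, r, snd p) - r\<bar>"
          by (rule lip[OF Gp L(2) that(1) t2(2) unear(1)[OF that t2(1)] r2])
        also have "\<dots> \<le> L * (B * \<bar>\<epsilon>\<bar>)" using udist(1)[OF that t2(1)] L(1) by (intro mult_left_mono) auto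
        finally show "\<bar>(\<lambda>x. Gp (fst x, up x, snd (snd x))) (t, r, snd p) - Gp (t, r, snd p)\<bar> \<le> L * (B * \<bar>\<epsilon>\<bar>)" by simp
        have "\<bar>Gm (t, um (t, r, snd p), snd p) - Gm (t, r, snd p)\<bar> \<le> L * \<bar>um (t, r, snd p) - r\<bar>"
          by (rule lip[OF Gm L(3) that(1) t2(2) unear(2)[OF that t2(1)] r2])
        also have "\<dots> \<le> L * (B * \<bar>\<epsilon>\<bar>)" using udist(2)[OF that t2(1)] L(1) by (intro mult_left_mono) auto
        finally show "\<bar>(\<lambda>x. Gm (fst x, um x, snd (snd x))) (t, r, snd p) - Gm (t, r, snd p)\<bar> \<le> L * (B * \<bar>\<epsilon>\<bar>)" by simp
      qed
      then show ?thesis using small by linarith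
    qed
    \<comment> \<open>At the radii \<open>fst p - \<kappa>\<close> and
      \<open>fst p + \<kappa>\<close> the averaged function has opposite signs and exceeds the error
      of \<open>avgP\<close>. The factor \<epsilon> of \<open>P\<close> enters the product squared,
      so its sign does not matter.\<close>
    have sgnP: "P (fst p - \<kappa>, p) * P (fst p + \<kappa>, p) < 0" if p: "p \<in> K" for p
    proof -
      define a where "a = (\<lambda>r. Jint (\<lambda>x. Gp (fst x, up x, snd (snd x))) (pi, r, snd p)
        - Jint (\<lambda>x. Gm (fst x, um x, snd (snd x))) (- pi, r, snd p))"
      have q0: "avg Gp Gm (fst p, snd p) = 0" using zero[OF p] by simp
      have q: "sg p * avg Gp Gm (fst p + \<kappa>, snd p) \<ge> 2 * c * \<kappa>" "sg p * avg Gp Gm (fst p - \<kappa>, snd p) \<le> - (2 * c * \<kappa>)"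
        using mono[OF p, of "fst p" "fst p + \<kappa>"] mono[OF p, of "fst p - \<kappa>" "fst p"] \<kappa>(1) q0 by auto
      have b: "\<bar>a (fst p + \<kappa>) - avg Gp Gm (fst p + \<kappa>, snd p)\<bar> < 2 * c * \<kappa>" "\<bar>a (fst p - \<kappa>) - avg Gp Gm (fst p - \<kappa>, snd p)\<bar> < 2 * c * \<kappa>"
        unfolding a_def by (rule avgP[OF p]; use \<kappa>(1) in simp)+
      have "sg p = 1 \<or> sg p = -1" using zero[OF p] by (auto simp: sg_def sgn_if)
      then have "a (fst p - \<kappa>) * a (fst p + \<kappa>) < 0"
      proof
        assume "sg p = 1"
        with q b have "a (fst p + \<kappa>) > 0" "a (fst p - \<kappa>) < 0" by (simp_all, (linarith+)?)
        then show ?thesis by (simp add: mult_neg_pos)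
      next
        assume "sg p = -1"
        with q b have "a (fst p + \<kappa>) < 0" "a (fst p - \<kappa>) > 0" by (simp_all, (linarith+)?)
        then show ?thesis by (simp add: mult_pos_neg)
      qed
      moreover have "P (fst p - \<kappa>, p) * P (fst p + \<kappa>, p) = (\<epsilon> * \<epsilon>) * (a (fst p - \<kappa>) * a (fst p + \<kappa>))"
        using \<kappa>(1) by (simp add: P_eq[OF p] a_def mult_ac)
      moreover have "\<epsilon> * \<epsilon> > 0" using \<epsilon>0 not_real_square_gt_zero by blast
      ultimately show ?thesis by (simp only: mult_pos_neg)
    qed
    \<comment> \<open>Used twice: with Hadamard slopes between two solutions for uniqueness of the
      zero, and with derivatives along one solution for the nondegeneracy in
      \<open>persistent\<close>.\<close>
    have slopes: "Jint ap (pi, q) \<noteq> Jint am (- pi, q)"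
      if p: "p \<in> K" and ca: "continuous_on {-(2*pi)<..<2*pi} (\<lambda>t. ap (t, q))" "continuous_on {-(2*pi)<..<2*pi} (\<lambda>t. am (t, q))"
       and b: "\<And>t. \<bar>t\<bar> \<le> pi \<Longrightarrow> \<bar>ap (t, q) - dr Gp (t, p)\<bar> \<le> c/4" "\<And>t. \<bar>t\<bar> \<le> pi \<Longrightarrow> \<bar>am (t, q) - dr Gm (t, p)\<bar> \<le> c/4"
      for p ap am and q :: "real \<times> real"
    proof -
      have "\<bar>(Jint ap (pi, q) - Jint am (-pi, q)) - (Jint (\<lambda>x. dr Gp (fst x, p)) (pi, q) - Jint (\<lambda>x. dr Gm (fst x, p)) (-pi, q))\<bar> \<le> 2 * pi * (c/4)"
        by (rule avg_diff_bound[where T = "2*pi", OF ca pi4]) (use b in \<open>auto intro!: cline cdp cdm\<close>)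
      also have "Jint (\<lambda>x. dr Gp (fst x, p)) (pi, q) - Jint (\<lambda>x. dr Gm (fst x, p)) (-pi, q) = ?Qr p"
        by (simp add: avg_def Jint_def)
      finally have "\<bar>Jint ap (pi, q) - Jint am (-pi, q)\<bar> > 0" using pic c(2)[OF p] c(1) by linarith
      then show ?thesis by auto
    qed
    \<comment> \<open>Two zeros over the same z would give equal differences of solutions at \<pi>
      and at -\<pi>. Both are the initial difference times an exponential, so the exponents agree,
      and cancelling \<epsilon> contradicts \<open>slopes\<close>.\<close>
    have uniq: "r = r'" if p: "p \<in> K" and r: "\<bar>r - fst p\<bar> \<le> \<kappa>" "\<bar>r' - fst p\<bar> \<le> \<kappa>" and "P (r, p) = 0" "P (r', p) = 0" for p r r'
    proof (rule ccontr)
      assume ne: "r \<noteq> r'"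
      define A where "A = (\<lambda>G u (x :: real \<times> real \<times> real). slope (dr G) (fst x) (u (fst x, r, snd p), snd p) (u (fst x, r', snd p), snd p))"
      define Bz where "Bz = (\<lambda>G u (x :: real \<times> real \<times> real). slope (dz G) (fst x) (u (fst x, r, snd p), snd p) (u (fst x, r', snd p), snd p))"
      have D: "up (pi, r', snd p) - up (pi, r, snd p) = exp (Jint (\<lambda>x. \<epsilon> * A Gp up x) (pi, p)) * (r' - r)"
        using solution_difference[OF Gp ode(1)[OF p r(1)] ode(1)[OF p r(2)], where A = "A Gp up" and p = p and B = "Bz Gp up" and \<theta> = pi]
          u0[OF p r(1)] u0[OF p r(2)] pi_gt_zero by (simp add: A_def Bz_def)
      have "um (-pi, r', snd p) - um (-pi, r, snd p) = exp (Jint (\<lambda>x. \<epsilon> * A Gm um x) (-pi, p)) * (r' - r)"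
        using solution_difference[OF Gm ode(2)[OF p r(1)] ode(2)[OF p r(2)], where A = "A Gm um" and p = p and B = "Bz Gm um" and \<theta> = "-pi"]
          u0[OF p r(1)] u0[OF p r(2)] pi_gt_zero by (simp add: A_def Bz_def)
      then have "exp (Jint (\<lambda>x. \<epsilon> * A Gp up x) (pi, p)) = exp (Jint (\<lambda>x. \<epsilon> * A Gm um x) (-pi, p))"
        using D that(4,5) ne by (simp add: P_def)
      then have "Jint (A Gp up) (pi, p) = Jint (A Gm um) (-pi, p)"
        using \<epsilon>0 by (simp add: Jint_cmult)
      moreover have "Jint (A Gp up) (pi, p) \<noteq> Jint (A Gm um) (-pi, p)"
      proof (rule slopes[OF p])
        show "continuous_on {- (2 * pi)<..<2 * pi} (\<lambda>t. A Gp up (t, p))" "continuous_on {- (2 * pi)<..<2 * pi} (\<lambda>t. A Gm um (t, p))"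
          unfolding A_def fst_conv by (intro slope_continuous cdp cdm continuous_intros cline cu)+
        fix t assume t: "\<bar>t\<bar> \<le> pi"
        have seg: "\<bar>a + \<tau> * (b - a) - fst p\<bar> \<le> 2*\<kappa>"
          if "\<bar>a - fst p\<bar> \<le> 2*\<kappa>" "\<bar>b - fst p\<bar> \<le> 2*\<kappa>" "0 \<le> \<tau>" "\<tau> \<le> 1" for a b \<tau>
        proof -
          have "convex (cball (fst p) (2*\<kappa>))" by simp
          then have "(1 - \<tau>) *\<^sub>R a + \<tau> *\<^sub>R b \<in> cball (fst p) (2*\<kappa>)"
            using that by (intro convexD_alt) (auto simp: dist_real_def abs_minus_commute)
          then show ?thesis by (simp add: dist_real_def abs_minus_commute algebra_simps)
        qed
        show "\<bar>A Gp up (t, p) - dr Gp (t, p)\<bar> \<le> c/4" unfolding A_def fst_conv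
          by (rule slope_bound[OF cdp]) (use near(1)[OF t p seg[OF unear(1)[OF p r(1) pi2[OF t]] unear(1)[OF p r(2) pi2[OF t]]]] in simp)
        show "\<bar>A Gm um (t, p) - dr Gm (t, p)\<bar> \<le> c/4" unfolding A_def fst_conv
          by (rule slope_bound[OF cdm]) (use near(2)[OF t p seg[OF unear(2)[OF p r(1) pi2[OF t]] unear(2)[OF p r(2) pi2[OF t]]]] in simp)
      qed
      ultimately show False by simp
    qed
    obtain R where R: "continuous_on K R" "\<And>p. p \<in> K \<Longrightarrow> \<bar>R p - fst p\<bar> < \<kappa> \<and> P (R p, p) = 0"
      by (rule continuous_zero_selection[where c = fst and K = K and P = P and \<kappa> = \<kappa>, OF K _ \<kappa>(1) cP sgnP uniq]) (auto intro: continuous_intros)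
    have Rk: "\<bar>R p - fst p\<bar> \<le> \<kappa>" if "p \<in> K" for p using R(2)[OF that] by simp
    \<comment> \<open>Two points with the same image have the same z and radii within 2\<kappa> of
      each other, where the average is strictly monotone in r; it cannot vanish at both.\<close>
    have inj: "inj_on (\<lambda>p. (R p, snd p)) K"
    proof (rule inj_onI)
      have *: False if K2: "p \<in> K" "q \<in> K" and eq: "R p = R q" "snd p = snd q" and lt: "fst p < fst q" for p q
      proof -
        have "\<bar>fst q - fst p\<bar> \<le> 2*\<kappa>" using Rk[OF K2(1)] Rk[OF K2(2)] eq by linarith
        then have "2 * c * (fst q - fst p) \<le> sg p * avg Gp Gm (fst q, snd p) - sg p * avg Gp Gm (fst p, snd p)"
          using mono[OF K2(1), of "fst p" "fst q"] lt \<kappa>(1) by auto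
        also have "\<dots> = 0" using zero[OF K2(1)] zero[OF K2(2)] eq(2) by (cases p; cases q) simp
        finally show False using c(1) lt by (simp add: mult_le_0_iff)
      qed
      fix p q assume "p \<in> K" "q \<in> K" "(R p, snd p) = (R q, snd q)"
      then show "p = q" using *[of p q] *[of q p] by (cases "fst p" "fst q" rule: linorder_cases) (auto simp: prod_eq_iff)
    qed
    show "persistent Gp Gm K \<eta> \<epsilon>"
      unfolding persistent_def
    proof (rule exI[of _ up], rule exI[of _ um], rule exI[of _ R], intro conjI ballI allI impI cu R(1) inj)
      fix p assume p: "p \<in> K"
      note k = p Rk[OF p]
      show "R p > 0" using Rk[OF p] m(2)[OF p] m(1) \<kappa>(3) by linarith
      show "\<bar>R p - fst p\<bar> \<le> \<eta>" using Rk[OF p] \<kappa>(2) by linarith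
      show "up (0, R p, snd p) = R p" "um (0, R p, snd p) = R p" by (rule u0[OF k])+
      show "up (pi, R p, snd p) = um (- pi, R p, snd p)" using R(2)[OF p] by (simp add: P_def)
      show "Jint (\<lambda>x. dr Gp (fst x, up x, snd (snd x))) (pi, R p, snd p) \<noteq> Jint (\<lambda>x. dr Gm (fst x, um x, snd (snd x))) (- pi, R p, snd p)"
      proof (rule slopes[OF p])
        show "continuous_on {- (2 * pi)<..<2 * pi} (\<lambda>t. dr Gp (fst (t, R p, snd p), up (t, R p, snd p), snd (snd (t, R p, snd p))))"
          "continuous_on {- (2 * pi)<..<2 * pi} (\<lambda>t. dr Gm (fst (t, R p, snd p), um (t, R p, snd p), snd (snd (t, R p, snd p))))"
          by (auto intro!: continuous_on_compose2[OF cdp] continuous_on_compose2[OF cdm] continuous_intros cline cu)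
      qed (use near p unear[OF k pi2] in auto)
      fix \<theta> assume \<theta>: "\<bar>\<theta>\<bar> < 2*pi"
      show "up (\<theta>, R p, snd p) > 0" "um (\<theta>, R p, snd p) > 0" using unear[OF k \<theta>] m(2)[OF p] m(1) \<kappa>(3) by linarith+
      show "((\<lambda>t. up (t, R p, snd p)) has_real_derivative \<epsilon> * Gp (\<theta>, up (\<theta>, R p, snd p), snd p)) (at \<theta>)"
        "((\<lambda>t. um (t, R p, snd p)) has_real_derivative \<epsilon> * Gm (\<theta>, um (\<theta>, R p, snd p), snd p)) (at \<theta>)"
        by (rule ode[OF k \<theta>])+
    qed
  qed
qed

section \<open>Smooth dependence on the parameter\<close>

lemma Ck1: "(\<And>k. Ck_on k G UNIV) \<Longrightarrow> Ck_on 1 G UNIV"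
  by blast

text \<open>What matters is the continuity of \<open>e\<close> and \<open>H\<close> up to
  \<open>z' = z\<close>. Since slopes extend continuously to the diagonal, limits of difference
  quotients can be read off from the values at \<open>z\<close>.\<close>

lemma solution_family_difference:
  fixes u :: "real \<times> real \<Rightarrow> real"
  assumes G: "Ck_on 1 G UNIV" and u: "continuous_on ({-T<..<T} \<times> Z) u"
    and ode: "\<And>t z. \<bar>t\<bar> < T \<Longrightarrow> z \<in> Z \<Longrightarrow> ((\<lambda>t. u (t, z)) has_real_derivative \<epsilon> * G (t, u (t, z), z)) (at t)"
    and z: "z \<in> Z"
  obtains e H where
    "continuous_on ({-T<..<T} \<times> Z) e" "continuous_on ({-T<..<T} \<times> Z) H"
    "\<And>\<theta> z'. \<bar>\<theta>\<bar> < T \<Longrightarrow> z' \<in> Z \<Longrightarrow>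
      u (\<theta>, z') - u (\<theta>, z) = e (\<theta>, z') * ((u (0, z') - u (0, z)) + (z' - z) * H (\<theta>, z'))"
    "\<And>\<theta>. \<bar>\<theta>\<bar> < T \<Longrightarrow> e (\<theta>, z) = exp (Jint (\<lambda>x. \<epsilon> * dr G (fst x, u x, snd x)) (\<theta>, z))"
    "\<And>\<theta>. \<bar>\<theta>\<bar> < T \<Longrightarrow> H (\<theta>, z) = Jint (\<lambda>x. \<epsilon> * dz G (fst x, u x, snd x) *
        exp (- Jint (\<lambda>x. \<epsilon> * dr G (fst x, u x, snd x)) x)) (\<theta>, z)"
proof -
  let ?U = "{-T<..<T} \<times> Z"
  have cG: "continuous_on UNIV (\<lambda>x. frechet_derivative G (at x) v)" for v
    using G unfolding One_nat_def Ck_on.simps by blast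
  define A where "A = (\<lambda>x. slope (dr G) (fst x) (u (fst x, z), z) (u x, snd x))"
  define B where "B = (\<lambda>x. slope (dz G) (fst x) (u (fst x, z), z) (u x, snd x))"
  have cu: "continuous_on ?U (\<lambda>x. u (fst x, z))"
    by (intro continuous_on_compose2[OF u] continuous_intros) (use z in auto)
  have cA: "continuous_on ?U A" "continuous_on ?U B" unfolding A_def B_def
    by (intro slope_continuous cG continuous_intros u cu)+
  have c1: "continuous_on ?U (Jint (\<lambda>x. \<epsilon> * A x))"
    by (intro Jint_continuous continuous_intros cA)
  define e where "e = (\<lambda>x. exp (Jint (\<lambda>x. \<epsilon> * A x) x))"
  define H where "H = Jint (\<lambda>x. \<epsilon> * B x * exp (- Jint (\<lambda>x. \<epsilon> * A x) x))"
  have diag: "Jint (\<lambda>x. \<epsilon> * A x) (\<theta>, z) = Jint (\<lambda>x. \<epsilon> * dr G (fst x, u x, snd x)) (\<theta>, z)" for \<theta>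
    by (rule Jint_cong) (simp add: A_def)
  show ?thesis
  proof (rule that[of e H])
    show "continuous_on ?U e" unfolding e_def by (intro continuous_intros c1)
    show "continuous_on ?U H" unfolding H_def by (intro Jint_continuous continuous_intros cA c1)
    show "u (\<theta>, z') - u (\<theta>, z) = e (\<theta>, z') * ((u (0, z') - u (0, z)) + (z' - z) * H (\<theta>, z'))"
      if "\<bar>\<theta>\<bar> < T" "z' \<in> Z" for \<theta> z'
      unfolding e_def H_def
      by (rule solution_difference[OF G ode[OF _ z] ode[OF _ that(2)] _ _ that(1)])
        (auto simp: A_def B_def)
    show "e (\<theta>, z) = exp (Jint (\<lambda>x. \<epsilon> * dr G (fst x, u x, snd x)) (\<theta>, z))" for \<theta>
      by (simp add: e_def diag)
    show "H (\<theta>, z) = Jint (\<lambda>x. \<epsilon> * dz G (fst x, u x, snd x) *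
        exp (- Jint (\<lambda>x. \<epsilon> * dr G (fst x, u x, snd x)) x)) (\<theta>, z)" for \<theta>
      unfolding H_def by (rule Jint_cong) (simp add: diag, simp add: B_def)
  qed
qed

lemma tendsto_at_of_continuous_on:
  fixes f :: "real \<times> real \<Rightarrow> real"
  assumes "continuous_on (I \<times> Z) f" "open Z" "z \<in> Z" "\<theta> \<in> I"
  shows "((\<lambda>s. f (\<theta>, s)) \<longlongrightarrow> f (\<theta>, z)) (at z)"
proof -
  have "continuous_on Z (\<lambda>s. f (\<theta>, s))"
    by (intro continuous_on_compose2[OF assms(1)] continuous_intros) (use assms in auto)
  then show ?thesis using assms(2,3) by (simp add: continuous_on_eq_continuous_at isCont_def)
qed

text \<open>Subtracting two members of the family and solving the matching conditions at \<open>0\<close> and \<open>\<plusminus>\<pi>\<close>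
  expresses the derivative in the parameter through integrals of the family itself;
  this gives one more order of differentiability at each step.\<close>

lemma smooth_periodic_family:
  fixes up um :: "real \<times> real \<Rightarrow> real"
  assumes Gp: "\<And>k. Ck_on k Gp UNIV" and Gm: "\<And>k. Ck_on k Gm UNIV"
    and \<epsilon>: "\<epsilon> \<noteq> 0" and T: "pi < T" and Z: "open Z"
    and up: "continuous_on ({-T<..<T} \<times> Z) up" and um: "continuous_on ({-T<..<T} \<times> Z) um"
    and odep: "\<And>t z. \<bar>t\<bar> < T \<Longrightarrow> z \<in> Z \<Longrightarrow> ((\<lambda>t. up (t, z)) has_real_derivative \<epsilon> * Gp (t, up (t, z), z)) (at t)"
    and odem: "\<And>t z. \<bar>t\<bar> < T \<Longrightarrow> z \<in> Z \<Longrightarrow> ((\<lambda>t. um (t, z)) has_real_derivative \<epsilon> * Gm (t, um (t, z), z)) (at t)"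
    and match0: "\<And>z. z \<in> Z \<Longrightarrow> up (0, z) = um (0, z)"
    and matchpi: "\<And>z. z \<in> Z \<Longrightarrow> up (pi, z) = um (- pi, z)"
    and nondeg: "\<And>z. z \<in> Z \<Longrightarrow> Jint (\<lambda>x. dr Gp (fst x, up x, snd x)) (pi, z) \<noteq>
        Jint (\<lambda>x. dr Gm (fst x, um x, snd x)) (- pi, z)"
  shows "Ck_on k up ({-T<..<T} \<times> Z) \<and> Ck_on k um ({-T<..<T} \<times> Z)"
proof -
  let ?U = "{-T<..<T} \<times> Z"
  have oU: "open ?U" using Z by (auto intro: open_Times)
  have pT: "\<bar>pi\<bar> < T" "\<bar>- pi\<bar> < T" "pi \<in> {-T<..<T}" "- pi \<in> {-T<..<T}" using T pi_gt_zero unfolding greaterThanLessThan_iff by linarith+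
  \<comment> \<open>\<open>E\<close> is the derivative of the solution in its initial value. With
    \<open>R\<close> the derivative of the initial radius in z, \<open>E * (R + H)\<close> becomes
    the derivative of the solution in z.\<close>
  define lE where "lE = (\<lambda>G u. Jint (\<lambda>x. \<epsilon> * dr G (fst x, u x :: real, snd x :: real)))"
  define E where "E = (\<lambda>G u x. exp (lE G u x))"
  define H where "H = (\<lambda>G u. Jint (\<lambda>x. \<epsilon> * dz G (fst x, u x, snd x) * exp (- lE G u x)))"
  have lE: "Jint (\<lambda>x. \<epsilon> * dr G (fst x, u x, snd x)) = lE G u" for G u by (simp add: lE_def)
  have E: "exp (lE G u x) = E G u x" for G u x by (simp add: E_def)
  have H: "Jint (\<lambda>x. \<epsilon> * dz G (fst x, u x, snd x) * exp (- lE G u x)) = H G u" for G u by (simp add: H_def)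
  \<comment> \<open>Solves \<open>E * (R + H)\<close> at \<pi> for \<open>Gp\<close> equal to the
    same at -\<pi> for \<open>Gm\<close>, which is the derivative of \<open>matchpi\<close>. The
    denominator is nonzero because the two exponents differ by \<epsilon> times the difference in
    \<open>nondeg\<close>.\<close>
  define R where "R = (\<lambda>z. (E Gm um (-pi, z) * H Gm um (-pi, z) - E Gp up (pi, z) * H Gp up (pi, z)) /
      (E Gp up (pi, z) - E Gm um (-pi, z)))"
  have nd: "E Gp up (pi, z) - E Gm um (-pi, z) \<noteq> 0" if "z \<in> Z" for z
    using nondeg[OF that] \<epsilon> by (simp add: E_def lE_def Jint_cmult)
  have quot: "e * (D / (s - z) + h) = A / (s - z)" if "s \<noteq> z" "A = e * (D + (s - z) * h)" for e D s z h A :: real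
    using that by (simp add: field_simps)
  have deriv: "((\<lambda>s. up (\<theta>, s)) has_real_derivative E Gp up (\<theta>, z) * (R z + H Gp up (\<theta>, z))) (at z)"
      "((\<lambda>s. um (\<theta>, s)) has_real_derivative E Gm um (\<theta>, z) * (R z + H Gm um (\<theta>, z))) (at z)"
    if z: "z \<in> Z" and \<theta>: "\<theta> \<in> {-T<..<T}" for z \<theta>
  proof -
    obtain ep Hp where p': "continuous_on ?U ep" "continuous_on ?U Hp"
      "\<And>\<theta> z'. \<bar>\<theta>\<bar> < T \<Longrightarrow> z' \<in> Z \<Longrightarrow>
        up (\<theta>, z') - up (\<theta>, z) = ep (\<theta>, z') * ((up (0, z') - up (0, z)) + (z' - z) * Hp (\<theta>, z'))"
      "\<And>\<theta>. \<bar>\<theta>\<bar> < T \<Longrightarrow> ep (\<theta>, z) = exp (Jint (\<lambda>x. \<epsilon> * dr Gp (fst x, up x, snd x)) (\<theta>, z))"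
      "\<And>\<theta>. \<bar>\<theta>\<bar> < T \<Longrightarrow> Hp (\<theta>, z) = Jint (\<lambda>x. \<epsilon> * dz Gp (fst x, up x, snd x) *
        exp (- Jint (\<lambda>x. \<epsilon> * dr Gp (fst x, up x, snd x)) x)) (\<theta>, z)"
      by (rule solution_family_difference[OF Ck1[OF Gp] up odep z]; (assumption | rule that))
    note p = p'[unfolded lE E H]
    obtain em Hm where m': "continuous_on ?U em" "continuous_on ?U Hm"
      "\<And>\<theta> z'. \<bar>\<theta>\<bar> < T \<Longrightarrow> z' \<in> Z \<Longrightarrow>
        um (\<theta>, z') - um (\<theta>, z) = em (\<theta>, z') * ((um (0, z') - um (0, z)) + (z' - z) * Hm (\<theta>, z'))"
      "\<And>\<theta>. \<bar>\<theta>\<bar> < T \<Longrightarrow> em (\<theta>, z) = exp (Jint (\<lambda>x. \<epsilon> * dr Gm (fst x, um x, snd x)) (\<theta>, z))"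
      "\<And>\<theta>. \<bar>\<theta>\<bar> < T \<Longrightarrow> Hm (\<theta>, z) = Jint (\<lambda>x. \<epsilon> * dz Gm (fst x, um x, snd x) *
        exp (- Jint (\<lambda>x. \<epsilon> * dr Gm (fst x, um x, snd x)) x)) (\<theta>, z)"
      by (rule solution_family_difference[OF Ck1[OF Gm] um odem z]; (assumption | rule that))
    note m = m'[unfolded lE E H]
    note lim = tendsto_at_of_continuous_on[OF _ Z z]
    have limd: "((\<lambda>s. ep (pi, s) - em (-pi, s)) \<longlongrightarrow> E Gp up (pi, z) - E Gm um (-pi, z)) (at z)"
      using tendsto_diff[OF lim[OF p(1) pT(3)] lim[OF m(1) pT(4)]] p(4) m(4) pT by simp
    have evZ: "eventually (\<lambda>s. s \<in> Z \<and> s \<noteq> z) (at z)"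
      using Z z by (auto simp: eventually_at_topological)
    have evd: "eventually (\<lambda>s. ep (pi, s) - em (-pi, s) \<noteq> 0) (at z)"
      using tendsto_imp_eventually_ne[OF limd nd[OF z]] .
    \<comment> \<open>Differentiability of the initial radius is a consequence of matching: the
      conditions at 0 and at the ends determine its difference quotient exactly, already before the
      limit.\<close>
    have q0: "((\<lambda>s. (up (0, s) - up (0, z)) / (s - z)) \<longlongrightarrow> R z) (at z)"
    proof (rule Lim_transform_eventually)
      show "((\<lambda>s. (em (-pi, s) * Hm (-pi, s) - ep (pi, s) * Hp (pi, s)) / (ep (pi, s) - em (-pi, s))) \<longlongrightarrow> R z) (at z)"
        using tendsto_divide[OF tendsto_diff[OF
            tendsto_mult[OF lim[OF m(1) pT(4)] lim[OF m(2) pT(4)]]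
            tendsto_mult[OF lim[OF p(1) pT(3)] lim[OF p(2) pT(3)]]] limd nd[OF z]]
          p(4,5) m(4,5) pT by (simp add: R_def)
      show "\<forall>\<^sub>F s in at z. (em (-pi, s) * Hm (-pi, s) - ep (pi, s) * Hp (pi, s)) / (ep (pi, s) - em (-pi, s)) =
          (up (0, s) - up (0, z)) / (s - z)"
        using evZ evd
      proof eventually_elim
        case (elim s)
        define D where "D = up (0, s) - up (0, z)"
        have "D = um (0, s) - um (0, z)" using match0 elim z by (simp add: D_def)
        moreover have "up (pi, s) - up (pi, z) = um (-pi, s) - um (-pi, z)" using matchpi elim z by simp
        ultimately have "ep (pi, s) * (D + (s - z) * Hp (pi, s)) = em (-pi, s) * (D + (s - z) * Hm (-pi, s))"
          using p(3)[OF pT(1), of s] m(3)[OF pT(2), of s] elim by (simp add: D_def)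
        then have "D * (ep (pi, s) - em (-pi, s)) = (s - z) * (em (-pi, s) * Hm (-pi, s) - ep (pi, s) * Hp (pi, s))"
          by (simp add: algebra_simps)
        then show ?case using elim by (simp add: frac_eq_eq D_def mult_ac)
      qed
    qed
    have "((\<lambda>s. (up (\<theta>, s) - up (\<theta>, z)) / (s - z)) \<longlongrightarrow> E Gp up (\<theta>, z) * (R z + H Gp up (\<theta>, z))) (at z)"
    proof (rule Lim_transform_eventually)
      show "((\<lambda>s. ep (\<theta>, s) * ((up (0, s) - up (0, z)) / (s - z) + Hp (\<theta>, s))) \<longlongrightarrow> E Gp up (\<theta>, z) * (R z + H Gp up (\<theta>, z))) (at z)"
        using tendsto_mult[OF lim[OF p(1) \<theta>] tendsto_add[OF q0 lim[OF p(2) \<theta>]]] p(4,5)[of \<theta>] \<theta>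
        by (auto simp: abs_less_iff)
      show "\<forall>\<^sub>F s in at z. ep (\<theta>, s) * ((up (0, s) - up (0, z)) / (s - z) + Hp (\<theta>, s)) = (up (\<theta>, s) - up (\<theta>, z)) / (s - z)"
        using evZ by eventually_elim (use \<theta> in \<open>auto intro!: quot[OF _ p(3)]\<close>)
    qed
    then show "((\<lambda>s. up (\<theta>, s)) has_real_derivative E Gp up (\<theta>, z) * (R z + H Gp up (\<theta>, z))) (at z)"
      by (simp add: has_field_derivative_iff)
    have "((\<lambda>s. (um (\<theta>, s) - um (\<theta>, z)) / (s - z)) \<longlongrightarrow> E Gm um (\<theta>, z) * (R z + H Gm um (\<theta>, z))) (at z)"
    proof (rule Lim_transform_eventually)
      show "((\<lambda>s. em (\<theta>, s) * ((up (0, s) - up (0, z)) / (s - z) + Hm (\<theta>, s))) \<longlongrightarrow> E Gm um (\<theta>, z) * (R z + H Gm um (\<theta>, z))) (at z)"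
        using tendsto_mult[OF lim[OF m(1) \<theta>] tendsto_add[OF q0 lim[OF m(2) \<theta>]]] m(4,5)[of \<theta>] \<theta>
        by (auto simp: abs_less_iff)
      show "\<forall>\<^sub>F s in at z. em (\<theta>, s) * ((up (0, s) - up (0, z)) / (s - z) + Hm (\<theta>, s)) = (um (\<theta>, s) - um (\<theta>, z)) / (s - z)"
        using evZ by eventually_elim (use \<theta> z match0 in \<open>auto intro!: quot[OF _ m(3)]\<close>)
    qed
    then show "((\<lambda>s. um (\<theta>, s)) has_real_derivative E Gm um (\<theta>, z) * (R z + H Gm um (\<theta>, z))) (at z)"
      by (simp add: has_field_derivative_iff)
  qed
  show ?thesis
  proof (induction k)
    case 0
    then show ?case using up um by simp
  next
    case (Suc k)
    have comp: "Ck_on k (\<lambda>x. K (fst x, u x, snd x)) ?U" if "Ck_on k K UNIV" "Ck_on k u ?U"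
      for K :: "real \<times> real \<times> real \<Rightarrow> real" and u
      by (rule Ck_on_compose[OF oU open_UNIV that(1)])
        (intro Ck_on_Pair Ck_on_fst Ck_on_snd oU that(2), simp)
    have D: "Ck_on k (\<lambda>x. frechet_derivative G (at x) v) UNIV" if "\<And>k. Ck_on k G UNIV"
      for G :: "real \<times> real \<times> real \<Rightarrow> real" and v
      using that[of "Suc k"] unfolding Ck_on.simps by blast
    have cE: "Ck_on k (lE G u) ?U" "Ck_on k (E G u) ?U" "Ck_on k (H G u) ?U"
      if "\<And>k. Ck_on k G UNIV" "Ck_on k u ?U" for G u
    proof -
      show l: "Ck_on k (lE G u) ?U" unfolding lE_def
        by (intro Ck_on_Jint Z Ck_on_mult oU Ck_on_const comp D that)
      show "Ck_on k (E G u) ?U" unfolding E_def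
        by (rule Ck_on_compose[OF oU open_UNIV Ck_on_exp l]) simp
      have "Ck_on k (\<lambda>x. exp ((-1) * lE G u x)) ?U"
        by (rule Ck_on_compose[OF oU open_UNIV Ck_on_exp]) (intro Ck_on_mult Ck_on_const oU l, simp)
      then show "Ck_on k (H G u) ?U" unfolding H_def
        by (intro Ck_on_Jint Z Ck_on_mult oU Ck_on_const comp D that) simp
    qed
    have freeze: "Ck_on k (\<lambda>x. K (\<theta>, snd x)) ?U" if "Ck_on k K ?U" "\<theta> \<in> {-T<..<T}" for K :: "real \<times> real \<Rightarrow> real" and \<theta>
      by (rule Ck_on_compose[OF oU oU that(1)])
       (intro Ck_on_Pair Ck_on_const Ck_on_snd oU, use that(2) in auto)
    note P = cE[OF Gp conjunct1[OF Suc]] and M = cE[OF Gm conjunct2[OF Suc]]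
    have cR: "Ck_on k (\<lambda>x. R (snd x)) ?U" unfolding R_def
      by (intro Ck_on_divide Ck_on_minus Ck_on_mult oU freeze[OF P(2)] freeze[OF M(2)] freeze[OF P(3)] freeze[OF M(3)] pT)
        (use nd in auto)
    have "Ck_on (Suc k) up ?U"
    proof (rule Ck_on_partialsI[OF oU])
      fix x assume x: "x \<in> ?U"
      show "((\<lambda>t. up (t, snd x)) has_real_derivative \<epsilon> * Gp (fst x, up x, snd x)) (at (fst x))"
        using odep[of "fst x" "snd x"] x by (auto simp: abs_less_iff)
      show "((\<lambda>s. up (fst x, s)) has_real_derivative E Gp up x * (R (snd x) + H Gp up x)) (at (snd x))"
        using deriv(1)[of "snd x" "fst x"] x by auto
    qed (intro Ck_on_mult Ck_on_add Ck_on_const oU comp Gp conjunct1[OF Suc] P cR)+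
    moreover have "Ck_on (Suc k) um ?U"
    proof (rule Ck_on_partialsI[OF oU])
      fix x assume x: "x \<in> ?U"
      show "((\<lambda>t. um (t, snd x)) has_real_derivative \<epsilon> * Gm (fst x, um x, snd x)) (at (fst x))"
        using odem[of "fst x" "snd x"] x by (auto simp: abs_less_iff)
      show "((\<lambda>s. um (fst x, s)) has_real_derivative E Gm um x * (R (snd x) + H Gm um x)) (at (snd x))"
        using deriv(2)[of "snd x" "fst x"] x by auto
    qed (intro Ck_on_mult Ck_on_add Ck_on_const oU comp Gm conjunct2[OF Suc] M cR)+
    ultimately show ?case ..
  qed
qed

section \<open>The curve of simple zeros\<close>

text \<open>A graph over z, since r is the variable that can be solved for. Only continuity of
  \<open>R\<close> is recorded: the curve matters up to homeomorphism, and smoothness of the surface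
  comes from the differential equation instead.\<close>

definition locally_graph :: "(real \<times> real) set \<Rightarrow> bool" where
  "locally_graph N \<longleftrightarrow> (\<forall>p\<in>N. \<exists>W d R. open W \<and> p \<in> W \<and> d > 0 \<and>
     continuous_on (ball (snd p) d) R \<and> N \<inter> W = (\<lambda>z. (R z, z)) ` ball (snd p) d)"

text \<open>A continuous implicit function theorem: on a small box \<open>Q\<close> is strictly
  monotone in r and has opposite signs at the two r-ends, so
  \<open>continuous_zero_selection\<close> with constant centre applies.\<close>

lemma simple_zeros_locally_graph:
  assumes Q: "continuous_on UNIV Q" and Qr: "continuous_on UNIV Qr"
    and D: "\<And>r z. ((\<lambda>r. Q (r, z)) has_real_derivative Qr (r, z)) (at r)"
  shows "locally_graph {p. fst p > 0 \<and> Q p = 0 \<and> Qr p \<noteq> 0}" (is "locally_graph ?N")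
  unfolding locally_graph_def
proof
  fix p assume "p \<in> ?N"
  then have p: "fst p > 0" "Q p = 0" "Qr p \<noteq> 0" by auto
  define sg where "sg = sgn (Qr p)"
  have sg: "sg * sg = 1" "sg \<noteq> 0" using p(3) by (auto simp: sg_def sgn_if)
  have cont: "continuous_on UNIV (\<lambda>q. sg * Qr q)" by (intro continuous_intros Qr)
  have "sg * Qr p > 0" using p(3) by (auto simp: sg_def sgn_if)
  then have "open {q. sg * Qr q > 0 \<and> fst q > 0}" "p \<in> {q. sg * Qr q > 0 \<and> fst q > 0}"
    using p(1) by (auto intro!: open_Collect_conj open_Collect_less cont continuous_intros)
  then obtain A B where AB: "open A" "open B" "p \<in> A \<times> B" "A \<times> B \<subseteq> {q. sg * Qr q > 0 \<and> fst q > 0}"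
    by (rule open_prod_elim)
  have AB': "fst p \<in> A" "snd p \<in> B" using AB(3) by auto
  obtain \<kappa> where \<kappa>: "\<kappa> > 0" "cball (fst p) \<kappa> \<subseteq> A" using AB(1)[unfolded open_contains_cball] AB' by blast
  obtain \<mu>1 where \<mu>1: "\<mu>1 > 0" "cball (snd p) \<mu>1 \<subseteq> B" using AB(2)[unfolded open_contains_cball] AB' by blast
  have pos: "sg * Qr (r, z) > 0" "r > 0" if "\<bar>r - fst p\<bar> \<le> \<kappa>" "\<bar>z - snd p\<bar> \<le> \<mu>1" for r z
  proof -
    have "(r, z) \<in> A \<times> B" using that \<kappa>(2) \<mu>1(2) by (auto simp: dist_real_def abs_minus_commute subset_iff)
    then show "sg * Qr (r, z) > 0" "r > 0" using AB(4) by auto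
  qed
  have mono: "sg * Q (r1, z) < sg * Q (r2, z)"
    if "r1 < r2" "\<bar>r1 - fst p\<bar> \<le> \<kappa>" "\<bar>r2 - fst p\<bar> \<le> \<kappa>" "\<bar>z - snd p\<bar> \<le> \<mu>1" for r1 r2 z
  proof -
    have d: "((\<lambda>r. sg * Q (r, z)) has_real_derivative sg * Qr (x, z)) (at x)" for x
      by (intro DERIV_cmult D)
    show ?thesis
      by (rule DERIV_pos_imp_increasing[OF that(1)]) (use d pos(1) that in \<open>force\<close>)
  qed
  have Q0: "sg * Q (fst p - \<kappa>, snd p) < 0" "sg * Q (fst p + \<kappa>, snd p) > 0"
  proof -
    have "Q (fst p, snd p) = 0" using p(2) by simp
    moreover have "sg * Q (fst p - \<kappa>, snd p) < sg * Q (fst p, snd p)" by (rule mono) (use \<kappa>(1) \<mu>1(1) in auto)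
    moreover have "sg * Q (fst p, snd p) < sg * Q (fst p + \<kappa>, snd p)" by (rule mono) (use \<kappa>(1) \<mu>1(1) in auto)
    ultimately show "sg * Q (fst p - \<kappa>, snd p) < 0" "sg * Q (fst p + \<kappa>, snd p) > 0" by simp_all
  qed
  have cz: "continuous_on UNIV (\<lambda>z. sg * Q (r, z))" for r
    by (intro continuous_intros continuous_on_compose2[OF Q]) auto
  have oz: "open {z. sg * Q (fst p - \<kappa>, z) < 0 \<and> sg * Q (fst p + \<kappa>, z) > 0}"
    by (intro open_Collect_conj open_Collect_less cz continuous_intros)
  obtain \<mu>2 where \<mu>2: "\<mu>2 > 0" "cball (snd p) \<mu>2 \<subseteq> {z. sg * Q (fst p - \<kappa>, z) < 0 \<and> sg * Q (fst p + \<kappa>, z) > 0}"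
    using oz[unfolded open_contains_cball] Q0 by blast
  define \<mu> where "\<mu> = min \<mu>1 \<mu>2"
  have \<mu>: "\<mu> > 0" "\<mu> \<le> \<mu>1" "\<mu> \<le> \<mu>2" using \<mu>1 \<mu>2 by (auto simp: \<mu>_def)
  define Z where "Z = cball (snd p) \<mu>"
  have Z: "\<bar>z - snd p\<bar> \<le> \<mu>1" "sg * Q (fst p - \<kappa>, z) < 0" "sg * Q (fst p + \<kappa>, z) > 0" if "z \<in> Z" for z
    using that \<mu> \<mu>2(2) by (auto simp: Z_def dist_real_def abs_minus_commute subset_iff)
  have cQZ: "continuous_on (UNIV \<times> Z) Q" by (rule continuous_on_subset[OF Q]) simp
  have neg: "Q (fst p - \<kappa>, z) * Q (fst p + \<kappa>, z) < 0" if "z \<in> Z" for z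
  proof -
    have "(sg * Q (fst p - \<kappa>, z)) * (sg * Q (fst p + \<kappa>, z)) < 0" using Z(2,3)[OF that] mult_neg_pos by blast
    moreover have "(sg * Q (fst p - \<kappa>, z)) * (sg * Q (fst p + \<kappa>, z)) = (sg * sg) * (Q (fst p - \<kappa>, z) * Q (fst p + \<kappa>, z))"
      by simp
    ultimately show ?thesis using sg by simp
  qed
  have uniq: "r = r'" if "z \<in> Z" "\<bar>r - fst p\<bar> \<le> \<kappa>" "\<bar>r' - fst p\<bar> \<le> \<kappa>" "Q (r, z) = 0" "Q (r', z) = 0" for z r r'
    using mono[of r r' z] mono[of r' r z] that Z(1) by (cases r r' rule: linorder_cases) auto
  have cmp: "compact Z" by (simp add: Z_def)
  obtain R where R: "continuous_on Z R" "\<And>z. z \<in> Z \<Longrightarrow> \<bar>R z - fst p\<bar> < \<kappa> \<and> Q (R z, z) = 0"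
    by (rule continuous_zero_selection[where c = "\<lambda>_. fst p" and K = Z and P = Q and \<kappa> = \<kappa>,
          OF cmp continuous_on_const \<kappa>(1) cQZ];
        ((rule neg | rule uniq | rule that); assumption))
  let ?W = "ball (fst p) \<kappa> \<times> ball (snd p) \<mu>"
  have "?N \<inter> ?W = (\<lambda>z. (R z, z)) ` ball (snd p) \<mu>"
  proof (intro set_eqI iffI)
    fix q assume q: "q \<in> ?N \<inter> ?W"
    then have z: "snd q \<in> Z" and r: "\<bar>fst q - fst p\<bar> \<le> \<kappa>" by (auto simp: Z_def dist_real_def abs_minus_commute)
    have "fst q = R (snd q)" by (rule uniq[OF z r]) (use R(2)[OF z] q in auto)
    then show "q \<in> (\<lambda>z. (R z, z)) ` ball (snd p) \<mu>" using q by (intro image_eqI[of _ _ "snd q"]) (auto simp: prod_eq_iff)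
  next
    fix q assume "q \<in> (\<lambda>z. (R z, z)) ` ball (snd p) \<mu>"
    then obtain z where q: "q = (R z, z)" and z: "z \<in> ball (snd p) \<mu>" by auto
    have zZ: "z \<in> Z" using z by (auto simp: Z_def)
    have "\<bar>R z - fst p\<bar> < \<kappa>" using R(2)[OF zZ] by simp
    moreover have "R z > 0" "Qr (R z, z) \<noteq> 0"
      using pos[of "R z" z] R(2)[OF zZ] Z(1)[OF zZ] by auto
    ultimately show "q \<in> ?N \<inter> ?W" using R(2)[OF zZ] z by (auto simp: q dist_real_def abs_minus_commute)
  qed
  moreover have "continuous_on (ball (snd p) \<mu>) R" by (rule continuous_on_subset[OF R(1)]) (auto simp: Z_def)
  moreover have "open ?W" "p \<in> ?W" using \<kappa> \<mu> by (auto simp: mem_Times_iff open_Times)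
  ultimately show "\<exists>W d R. open W \<and> p \<in> W \<and> d > 0 \<and> continuous_on (ball (snd p) d) R \<and>
      ?N \<inter> W = (\<lambda>z. (R z, z)) ` ball (snd p) d" using \<mu>(1) by blast
qed

text \<open>Graphs over small balls form a neighbourhood basis of the curve: inside
  \<open>W\<close>, restricting the height to a smaller ball is an open condition.\<close>

lemma locally_graph_small:
  assumes N: "locally_graph N" and w: "openin (top_of_set N) w" "p \<in> w"
  obtains d R where "d > 0" "continuous_on (ball (snd p) d) R" "R (snd p) = fst p"
    "(\<lambda>z. (R z, z)) ` ball (snd p) d \<subseteq> w" "openin (top_of_set N) ((\<lambda>z. (R z, z)) ` ball (snd p) d)"
proof -
  have pN: "p \<in> N" using w openin_imp_subset by blast
  obtain W d R where W: "open W" "p \<in> W" "d > 0" "continuous_on (ball (snd p) d) R"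
    "N \<inter> W = (\<lambda>z. (R z, z)) ` ball (snd p) d"
    using N[unfolded locally_graph_def, rule_format, OF pN] by (elim exE conjE)
  let ?g = "\<lambda>z. (R z, z)"
  obtain w' where w': "open w'" "w = N \<inter> w'" using w(1) openin_open by blast
  have cg: "continuous_on (ball (snd p) d) ?g" by (intro continuous_intros W)
  have Rp: "R (snd p) = fst p"
  proof -
    have "p \<in> ?g ` ball (snd p) d" using W(2,5) pN by blast
    then show ?thesis by auto
  qed
  have "open (ball (snd p) d \<inter> ?g -` w')"
    by (rule continuous_open_preimage[OF cg _ w'(1)]) simp
  moreover have "snd p \<in> ball (snd p) d \<inter> ?g -` w'" using Rp W(3) w(2) w'(2) by auto
  ultimately obtain d' where d': "d' > 0" "ball (snd p) d' \<subseteq> ball (snd p) d \<inter> ?g -` w'"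
    using openE by blast
  have gN: "?g ` ball (snd p) d' \<subseteq> N" using W(5) d'(2) by blast
  have "?g ` ball (snd p) d' = N \<inter> (W \<inter> (UNIV \<times> ball (snd p) d'))"
  proof
    show "?g ` ball (snd p) d' \<subseteq> N \<inter> (W \<inter> (UNIV \<times> ball (snd p) d'))" using W(5) d'(2) by blast
    show "N \<inter> (W \<inter> (UNIV \<times> ball (snd p) d')) \<subseteq> ?g ` ball (snd p) d'"
    proof
      fix q assume q: "q \<in> N \<inter> (W \<inter> (UNIV \<times> ball (snd p) d'))"
      then have "q \<in> ?g ` ball (snd p) d" using W(5) by blast
      then show "q \<in> ?g ` ball (snd p) d'" using q by auto
    qed
  qed
  then have "openin (top_of_set N) (?g ` ball (snd p) d')"
    using W(1) by (metis openin_open_Int open_Int open_Times open_UNIV open_ball)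
  moreover have "?g ` ball (snd p) d' \<subseteq> w" using gN d'(2) w'(2) by blast
  moreover have "continuous_on (ball (snd p) d') R" by (rule continuous_on_subset[OF W(4)]) (use d'(2) in blast)
  ultimately show ?thesis using that d'(1) Rp by blast
qed

lemma locally_graph_path_connected:
  assumes "locally_graph N"
  shows "locally path_connected N"
  unfolding locally_def
proof (intro allI impI, elim conjE)
  fix w p assume w: "openin (top_of_set N) w" "p \<in> w"
  obtain d R where d: "d > 0" "continuous_on (ball (snd p) d) R" "R (snd p) = fst p"
    "(\<lambda>z. (R z, z)) ` ball (snd p) d \<subseteq> w" "openin (top_of_set N) ((\<lambda>z. (R z, z)) ` ball (snd p) d)"
    by (rule locally_graph_small[OF assms w])
  have "path_connected ((\<lambda>z. (R z, z)) ` ball (snd p) d)"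
    by (intro path_connected_continuous_image continuous_intros d convex_imp_path_connected convex_ball)
  moreover have "p \<in> (\<lambda>z. (R z, z)) ` ball (snd p) d" using d(1,3) by (intro image_eqI[of _ _ "snd p"]) (auto simp: prod_eq_iff)
  ultimately show "\<exists>u v. openin (top_of_set N) u \<and> path_connected v \<and> p \<in> u \<and> u \<subseteq> v \<and> v \<subseteq> w"
    using d(4,5) by blast
qed

text \<open>An arc with both ends over the same \<open>z\<close> would have a turning point in the \<open>z\<close>-direction.\<close>

lemma locally_graph_inj_snd:
  assumes N: "locally_graph N" and C: "C \<in> components N"
  shows "inj_on snd C"
proof (rule inj_onI, rule ccontr)
  fix p q assume pq: "p \<in> C" "q \<in> C" "snd p = snd q" "p \<noteq> q"
  have CN: "C \<subseteq> N" using C in_components_subset by blast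
  have lpc: "locally path_connected N" by (rule locally_graph_path_connected[OF N])
  have "path_connected C"
  proof -
    have "openin (top_of_set N) C"
      using lpc C by (simp add: openin_components_locally_connected locally_path_connected_imp_locally_connected)
    then have "locally path_connected C" using lpc locally_open_subset by blast
    then show ?thesis using in_components_connected[OF C]
      by (simp add: path_connected_component connected_iff_connected_component path_component_eq_connected_component)
  qed
  then obtain g where g: "arc g" "path_image g \<subseteq> C" "pathstart g = p" "pathfinish g = q"
    using path_connected_arcwise pq by metis
  have cg: "continuous_on {0..1} g" and ig: "inj_on g {0..1}" using g(1) by (auto simp: arc_def path_def)
  define f where "f = (\<lambda>t. snd (g t))"
  have cf: "continuous_on {0..1} f" unfolding f_def by (intro continuous_intros cg)
  have f01: "f 0 = f 1" using g pq by (simp add: f_def pathstart_def pathfinish_def)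
  have gN: "g t \<in> N" if "t \<in> {0..1}" for t using g(2) CN that unfolding path_image_def by blast
  \<comment> \<open>Near \<open>t\<close> the arc runs in a graph over the z-axis, so equal heights
    mean equal points and, the arc being injective, equal times.\<close>
  have li: "\<exists>d>0. inj_on f ({0..1} \<inter> ball t d)" if t: "t \<in> {0..1}" for t
  proof -
    obtain W d R where W: "open W" "g t \<in> W" "N \<inter> W = (\<lambda>z. (R z, z)) ` ball (snd (g t)) d"
      using N[unfolded locally_graph_def, rule_format, OF gN[OF t]] by (elim exE conjE)
    obtain e where e: "e > 0" "\<And>s. s \<in> {0..1} \<Longrightarrow> dist s t < e \<Longrightarrow> g s \<in> W"
    proof -
      have "openin (top_of_set {0..1}) ({0..1} \<inter> g -` W)" by (rule continuous_openin_preimage_gen[OF cg W(1)])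
      then show ?thesis using that t W(2) unfolding openin_euclidean_subtopology_iff by (metis IntI Int_iff vimage_eq)
    qed
    have "inj_on f ({0..1} \<inter> ball t e)"
    proof (rule inj_onI)
      fix a b assume ab: "a \<in> {0..1} \<inter> ball t e" "b \<in> {0..1} \<inter> ball t e" "f a = f b"
      then have "g a \<in> N \<inter> W" "g b \<in> N \<inter> W" using e(2)[of a] e(2)[of b] gN by (auto simp: dist_commute)
      then have "g a = g b" using ab(3) unfolding W(3) f_def by auto
      then show "a = b" using ig ab by (auto dest: inj_onD)
    qed
    then show ?thesis using e(1) by blast
  qed
  \<comment> \<open>At an interior extremum the intermediate value theorem gives equal values on
    both sides of \<open>t\<close>, against local injectivity. The sign \<sigma> covers maxima and
    minima.\<close>
  have no_ext: False if t: "0 < t" "t < 1" and s: "\<sigma> = 1 \<or> \<sigma> = -1" and ext: "\<And>u. u \<in> {0..1} \<Longrightarrow> \<sigma> * f u \<le> \<sigma> * f t" for t \<sigma> :: real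
  proof -
    obtain d where d: "d > 0" "inj_on f ({0..1} \<inter> ball t d)" using li[of t] t by auto
    define h where "h = min (d/2) (min (t/2) ((1-t)/2))"
    have h: "h > 0" "h < d" "0 \<le> t - h" "t + h \<le> 1" using d t by (auto simp: h_def min_def field_simps)
    have ballI: "u \<in> {0..1} \<inter> ball t d" if "t - h \<le> u" "u \<le> t + h" for u using that h by (auto simp: dist_real_def)
    define F where "F = (\<lambda>u. \<sigma> * f u)"
    have injF: "u = v" if "F u = F v" "t - h \<le> u" "u \<le> t + h" "t - h \<le> v" "v \<le> t + h" for u v
    proof -
      have "f u = f v" using that(1) s by (auto simp: F_def)
      then show ?thesis using inj_onD[OF d(2) _ ballI ballI] that by blast
    qed
    have cF: "continuous_on {t-h..t} F" "continuous_on {t..t+h} F" unfolding F_def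
      by (intro continuous_intros continuous_on_subset[OF cf]; use h t in auto)+
    have le: "F (t-h) \<le> F t" "F (t+h) \<le> F t" using ext h t by (auto simp: F_def)
    show False
    proof (cases "F (t-h) \<le> F (t+h)")
      case True
      obtain x where "t - h \<le> x" "x \<le> t" "F x = F (t+h)" using IVT'[of F "t-h" "F (t+h)" t] True le cF(1) h by auto
      then show False using injF[of x "t+h"] h by auto
    next
      case False
      obtain x where "t \<le> x" "x \<le> t + h" "F x = F (t-h)" using IVT2'[of F "t+h" "F (t-h)" t] False le cF(2) h by auto
      then show False using injF[of x "t-h"] h by auto
    qed
  qed
  obtain M where M: "M \<in> {0..1}" "\<And>u. u \<in> {0..1} \<Longrightarrow> f u \<le> f M"
    using continuous_attains_sup[OF compact_Icc _ cf] by (metis atLeastatMost_empty_iff zero_le_one)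
  obtain m where m: "m \<in> {0..1}" "\<And>u. u \<in> {0..1} \<Longrightarrow> f m \<le> f u"
    using continuous_attains_inf[OF compact_Icc _ cf] by (metis atLeastatMost_empty_iff zero_le_one)
  have "M = 0 \<or> M = 1" using no_ext[of M 1] M by force
  moreover have "m = 0 \<or> m = 1" using no_ext[of m "-1"] m by force
  \<comment> \<open>Both extrema sit at the end points, where the heights agree, so \<open>f\<close>
    is constant; but then 1/2 is an interior maximum.\<close>
  ultimately have c: "f u = f 0" if "u \<in> {0..1}" for u using M(2)[OF that] m(2)[OF that] f01 by auto
  have "f u \<le> f (1/2)" if "u \<in> {0..1}" for u
  proof -
    have "(1/2 :: real) \<in> {0..1}" by simp
    then show ?thesis using c[OF that] c[of "1/2"] by linarith
  qed
  then show False by (intro no_ext[of "1/2" 1]) simp_all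
qed

section \<open>Parametrization of the curve by an open set of reals\<close>

lemma countable_components_locally_connected:
  fixes S :: "'a::{real_normed_vector, second_countable_topology} set"
  assumes "locally connected S"
  shows "countable (components S)"
proof -
  have "openin (top_of_set S) C" if "C \<in> components S" for C
    using openin_components_locally_connected assms that by blast
  \<comment> \<open>The components are open, disjoint and nonempty, so a countable subfamily that
    covers the same points must contain all of them.\<close>
  from Lindelof_openin[of "components S" S, OF this]
  obtain F where F: "F \<subseteq> components S" "countable F" "\<Union>F = \<Union>(components S)" by blast
  have "components S \<subseteq> F"
  proof
    fix C assume C: "C \<in> components S"
    then obtain x where x: "x \<in> C" using in_components_nonempty by blast
    then obtain D where D: "D \<in> F" "x \<in> D" using F(3) C by blast
    then have "D = C" using components_nonoverlap[of D S C] C F(1) x by blast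
    then show "C \<in> F" using D by simp
  qed
  then show ?thesis using F(1,2) by (metis subset_antisym)
qed

definition squash :: "real \<Rightarrow> real" where
  "squash x = 1/2 + arctan x / pi"

lemma squash_range: "0 < squash x" "squash x < 1"
  using arctan_bounded[of x] pi_gt_zero by (auto simp: squash_def field_simps)

lemma squash_inj: "squash x = squash y \<longleftrightarrow> x = y"
  unfolding squash_def using tan_arctan by (metis add_left_cancel divide_cancel_right pi_neq_zero)

lemma continuous_on_squash: "continuous_on S f \<Longrightarrow> continuous_on S (\<lambda>x. squash (f x))"
  unfolding squash_def by (intro continuous_intros) auto

text \<open>On a component the height is injective, so the number of the component plus the height
  squashed into (0, 1) separates all points; the outer \<open>squash\<close> makes the image
  bounded. The last clause will allow z as a local coordinate in place of the parameter.\<close>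

lemma locally_graph_parametrization:
  assumes N: "locally_graph N"
  obtains V :: "real set" and e :: "real \<times> real \<Rightarrow> real" and \<gamma> where "open V" "V \<subseteq> {0<..<1}" "homeomorphism V N \<gamma> e"
    "\<And>v. v \<in> V \<Longrightarrow> \<exists>O'. open O' \<and> v \<in> O' \<and> O' \<subseteq> V \<and> inj_on (\<lambda>v. snd (\<gamma> v)) O'"
proof -
  have lc: "locally connected N"
    using locally_graph_path_connected[OF N] locally_path_connected_imp_locally_connected by blast
  define idx where "idx = to_nat_on (components N)"
  have idx: "C = D" if "C \<in> components N" "D \<in> components N" "idx C = idx D" for C D
    using inj_on_to_nat_on[OF countable_components_locally_connected[OF lc]] that
    by (auto simp: idx_def dest: inj_onD)
  define i where "i = (\<lambda>p. idx (connected_component_set N p))"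
  have comp: "connected_component_set N p \<in> components N" "p \<in> connected_component_set N p" if "p \<in> N" for p
    using that by (auto simp: components_def)
  have iC: "i p = idx C" if "C \<in> components N" "p \<in> C" for C p
    using that by (metis components_iff connected_component_eq i_def)
  define e where "e = (\<lambda>p. squash (real (i p) + squash (snd p)))"
  have eC: "continuous_on C e" if C: "C \<in> components N" for C
  proof -
    have "continuous_on C (\<lambda>p. squash (real (idx C) + squash (snd p)))"
      by (intro continuous_on_squash continuous_intros)
    then show ?thesis by (rule continuous_on_eq) (simp add: e_def iC[OF C])
  qed
  have ce: "continuous_on N e" by (rule continuous_on_components[OF lc eC])
  have inj: "inj_on e N"
  proof (rule inj_onI)
    fix p q assume pq: "p \<in> N" "q \<in> N" "e p = e q"
    then have eq: "real (i p) + squash (snd p) = real (i q) + squash (snd q)" by (simp add: e_def squash_inj)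
    then have "\<bar>real (i p) - real (i q)\<bar> < 1"
      using squash_range[of "snd p"] squash_range[of "snd q"] by linarith
    then have ii: "i p = i q" by linarith
    then have "connected_component_set N p = connected_component_set N q"
      using idx comp(1) pq(1,2) unfolding i_def by blast
    moreover have "snd p = snd q" using eq ii by (simp add: squash_inj)
    ultimately show "p = q"
      using locally_graph_inj_snd[OF N comp(1)[OF pq(1)]] comp(2)[OF pq(1)] comp(2)[OF pq(2)]
      by (auto dest: inj_onD)
  qed
  have small: "\<exists>d R. d > 0 \<and> p \<in> (\<lambda>z. (R z, z)) ` ball (snd p) d \<and> (\<lambda>z. (R z, z)) ` ball (snd p) d \<subseteq> U \<and>
      open (e ` (\<lambda>z. (R z, z)) ` ball (snd p) d)" if U: "openin (top_of_set N) U" "p \<in> U" for U p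
  proof -
    have pN: "p \<in> N" using U openin_imp_subset by blast
    let ?C = "connected_component_set N p"
    have "openin (top_of_set N) (U \<inter> ?C)"
      using U(1) openin_components_locally_connected[OF lc comp(1)[OF pN]] by (rule openin_Int)
    moreover have "p \<in> U \<inter> ?C" using U(2) comp(2)[OF pN] by blast
    ultimately obtain d R where d: "d > 0" "continuous_on (ball (snd p) d) R" "R (snd p) = fst p"
      "(\<lambda>z. (R z, z)) ` ball (snd p) d \<subseteq> U \<inter> ?C" "openin (top_of_set N) ((\<lambda>z. (R z, z)) ` ball (snd p) d)"
      by (rule locally_graph_small[OF N])
    have "e ` (\<lambda>z. (R z, z)) ` ball (snd p) d = (\<lambda>z. squash (real (idx ?C) + squash z)) ` ball (snd p) d"
      unfolding image_image
    proof (rule image_cong[OF refl])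
      fix z assume "z \<in> ball (snd p) d"
      then have "(R z, z) \<in> ?C" using d(4) by blast
      then show "e (R z, z) = squash (real (idx ?C) + squash z)" using iC[OF comp(1)[OF pN]] by (simp add: e_def)
    qed
    moreover have "open ((\<lambda>z. squash (real (idx ?C) + squash z)) ` ball (snd p) d)"
      by (rule invariance_of_domain) (auto intro!: continuous_on_squash continuous_intros inj_onI simp: squash_inj)
    moreover have "p \<in> (\<lambda>z. (R z, z)) ` ball (snd p) d"
      using d(1,3) by (intro image_eqI[of _ _ "snd p"]) (auto simp: prod_eq_iff)
    ultimately show ?thesis using d(1,4) by (intro exI[of _ d] exI[of _ R]) auto
  qed
  have op: "open (e ` U)" if U: "openin (top_of_set N) U" for U
  proof (subst open_subopen, rule ballI)
    fix v assume "v \<in> e ` U"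
    then obtain p where p: "p \<in> U" "v = e p" by blast
    obtain d R where "p \<in> (\<lambda>z. (R z, z)) ` ball (snd p) d" "(\<lambda>z. (R z, z)) ` ball (snd p) d \<subseteq> U"
      "open (e ` (\<lambda>z. (R z, z)) ` ball (snd p) d)" using small[OF U p(1)] by blast
    then show "\<exists>T. open T \<and> v \<in> T \<and> T \<subseteq> e ` U"
      by (intro exI[of _ "e ` (\<lambda>z. (R z, z)) ` ball (snd p) d"]) (use p(2) in blast)
  qed
  define V where "V = e ` N"
  obtain \<gamma> where h: "homeomorphism N V e \<gamma>"
  proof (rule homeomorphism_injective_open_map[OF ce _ inj])
    show "e ` N = V" by (simp add: V_def)
    show "openin (top_of_set V) (e ` U)" if "openin (top_of_set N) U" for U
      using op[OF that] openin_imp_subset[OF that] by (auto simp: V_def intro!: open_subset)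
  qed
  have loc: "\<exists>O'. open O' \<and> v \<in> O' \<and> O' \<subseteq> V \<and> inj_on (\<lambda>v. snd (\<gamma> v)) O'" if v: "v \<in> V" for v
  proof -
    have p: "\<gamma> v \<in> N" "e (\<gamma> v) = v" using h v by (auto simp: homeomorphism_def)
    obtain d R where d: "\<gamma> v \<in> (\<lambda>z. (R z, z)) ` ball (snd (\<gamma> v)) d" "(\<lambda>z. (R z, z)) ` ball (snd (\<gamma> v)) d \<subseteq> N"
      "open (e ` (\<lambda>z. (R z, z)) ` ball (snd (\<gamma> v)) d)"
      using small[OF openin_subtopology_self p(1)] by (elim exE conjE)
    have "inj_on (\<lambda>v. snd (\<gamma> v)) (e ` (\<lambda>z. (R z, z)) ` ball (snd (\<gamma> v)) d)"
    proof (rule inj_onI)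
      fix a b assume ab: "a \<in> e ` (\<lambda>z. (R z, z)) ` ball (snd (\<gamma> v)) d" "b \<in> e ` (\<lambda>z. (R z, z)) ` ball (snd (\<gamma> v)) d"
        "snd (\<gamma> a) = snd (\<gamma> b)"
      then obtain y z where yz: "a = e (R y, y)" "b = e (R z, z)" "(R y, y) \<in> N" "(R z, z) \<in> N" using d(2) by blast
      have "\<gamma> a = (R y, y)" "\<gamma> b = (R z, z)" using h yz by (auto simp: homeomorphism_def)
      then show "a = b" using ab(3) yz by simp
    qed
    moreover have "v \<in> e ` (\<lambda>z. (R z, z)) ` ball (snd (\<gamma> v)) d" using d(1) p(2) by (metis imageI)
    moreover have "e ` (\<lambda>z. (R z, z)) ` ball (snd (\<gamma> v)) d \<subseteq> V" using d(2) by (auto simp: V_def)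
    ultimately show ?thesis using d(3) by blast
  qed
  show ?thesis
  proof (rule that[of V \<gamma> e])
    show "\<exists>O'. open O' \<and> v \<in> O' \<and> O' \<subseteq> V \<and> inj_on (\<lambda>v. snd (\<gamma> v)) O'" if "v \<in> V" for v
      by (rule loc[OF that])
    show "open V" using op[OF openin_subtopology_self] by (simp add: V_def)
    show "V \<subseteq> {0<..<1}" using squash_range by (auto simp: V_def e_def)
    show "homeomorphism V N \<gamma> e" using h by (rule homeomorphism_symD)
  qed
qed

text \<open>The first \<open>m\<close> components are shrunk a little towards an inner point; all others are pushed
  into the gap that the shrinking leaves inside one fixed component.\<close>

lemma open_self_embeddings:
  fixes V :: "real set"
  assumes V: "open V" "V \<subseteq> {0<..<1}" "V \<noteq> {}"
  obtains s :: "nat \<Rightarrow> real \<Rightarrow> real" and K :: "nat \<Rightarrow> real set" where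
    "\<And>m. compact (K m)" "\<And>m. K m \<subseteq> V" "\<And>m. s m ` V \<subseteq> K m"
    "\<And>m. continuous_on V (s m)" "\<And>m. inj_on (s m) V" "\<And>v. v \<in> V \<Longrightarrow> (\<lambda>m. s m v) \<longlonglongrightarrow> v"
proof -
  have lc: "locally connected V" using V(1) open_imp_locally_connected by blast
  define idx where "idx = to_nat_on (components V)"
  have idx: "inj_on idx (components V)"
    unfolding idx_def by (rule inj_on_to_nat_on[OF countable_components_locally_connected[OF lc]])
  define ctr where "ctr = (\<lambda>C :: real set. SOME x. x \<in> C)"
  have C: "open C" "convex C" "C \<subseteq> V" "bounded C" "ctr C \<in> C" if "C \<in> components V" for C
  proof -
    show "open C" using that V(1) open_components by blast
    show "convex C" using in_components_connected[OF that] is_interval_connected_1 is_interval_convex_1 by blast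
    show "C \<subseteq> V" using in_components_subset[OF that] .
    then show "bounded C" using V(2) unfolding bounded_iff by (intro exI[of _ 1]) force
    show "ctr C \<in> C" using in_components_nonempty[OF that] unfolding ctr_def by (metis ex_in_conv someI_ex)
  qed
  define cp where "cp = connected_component_set V"
  have cp: "cp v \<in> components V" "v \<in> cp v" if "v \<in> V" for v
    using that by (auto simp: cp_def components_def)
  have cpC: "cp v = D" if "D \<in> components V" "v \<in> D" for v D
    using that unfolding cp_def by (metis components_iff connected_component_eq)
  obtain v0 where v0: "v0 \<in> V" using V(3) by blast
  define C0 where "C0 = cp v0"
  have C0: "C0 \<in> components V" using cp(1)[OF v0] by (simp add: C0_def)
  note C0p = C[OF C0]
  define c0 where "c0 = ctr C0"
  have c0: "c0 \<in> C0" using C0p(5) by (simp add: c0_def)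
  define \<alpha> where "\<alpha> = Inf C0"
  have bb: "bdd_below C0" using C0p(3) V(2) by (intro bdd_belowI[of _ 0]) force
  have a1: "\<alpha> < x" if "x \<in> C0" for x
  proof -
    obtain d where d: "d > 0" "ball x d \<subseteq> C0" using C0p(1) \<open>x \<in> C0\<close> openE by blast
    have "x - d/2 \<in> C0" using d by (auto simp: dist_real_def subset_iff)
    then have "\<alpha> \<le> x - d/2" unfolding \<alpha>_def using bb by (rule cInf_lower)
    then show ?thesis using d(1) by linarith
  qed
  have a2: "x \<in> C0" if x: "\<alpha> < x" "x \<le> c0" for x
  proof -
    obtain y where y: "y \<in> C0" "y < x" using cInf_lessD[of C0 x] x(1) c0 by (auto simp: \<alpha>_def)
    then have "closed_segment y c0 \<subseteq> C0" using C0p(2) c0 by (simp add: closed_segment_subset)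
    then show ?thesis using y x by (auto simp: closed_segment_eq_real_ivl)
  qed
  define w where "w = c0 - \<alpha>"
  have w: "w > 0" using a1[OF c0] by (simp add: w_def)
  \<comment> \<open>The 2 keeps the shrinking factor \<open>1 - \<eta> m\<close> at least 1/2, hence
    injective, already for \<open>m = 0\<close>.\<close>
  define \<eta> where "\<eta> = (\<lambda>m::nat. 1 / (real m + 2))"
  have \<eta>: "0 < \<eta> m" "\<eta> m \<le> 1/2" for m by (auto simp: \<eta>_def field_simps)
  \<comment> \<open>\<open>C0\<close> is always among the shrunk components because the gap lies
    inside it. Any other component is shrunk as soon as \<open>m\<close> reaches its number, which
    gives the pointwise convergence.\<close>
  define sel where "sel = (\<lambda>m D. idx D \<le> m \<or> D = C0)"
  define sq where "sq = (\<lambda>m D v. v + \<eta> m * (ctr D - v))"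
  \<comment> \<open>Shrinking \<open>C0\<close> towards \<open>c0\<close> frees the interval from
    its infimum \<alpha> up to \<open>\<alpha> + \<eta> m * w\<close> (see \<open>sq_gt\<close>). As
    \<open>V\<close> lies in (0, 1), \<open>pk\<close> packs it between a quarter and a half of that
    length.\<close>
  define pk where "pk = (\<lambda>m v. \<alpha> + \<eta> m * w * (1 + v) / 4)"
  define s where "s = (\<lambda>m v. if sel m (cp v) then sq m (cp v) v else pk m v)"
  \<comment> \<open>Compact since finitely many components are selected and their closures are
    bounded. Shrinking towards an inner point carries even the closure into the open
    component.\<close>
  define K where "K = (\<lambda>m. (\<Union>D\<in>{D \<in> components V. sel m D}. sq m D ` closure D) \<union>
     {\<alpha> + \<eta> m * w / 4..\<alpha> + \<eta> m * w / 2})"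
  have sq_in: "sq m D v \<in> D" if D: "D \<in> components V" "v \<in> closure D" for m D v
  proof -
    have "v - \<eta> m *\<^sub>R (v - ctr D) \<in> interior D"
      using C[OF D(1)] D(2) \<eta>(1)[of m] \<eta>(2)[of m]
      by (intro mem_interior_closure_convex_shrink) (auto simp: interior_open)
    then show ?thesis using C(1)[OF D(1)] by (simp add: sq_def interior_open algebra_simps)
  qed
  have sq_inj: "u = v" if "sq m D u = sq m D v" for m D u v
  proof -
    have "(1 - \<eta> m) * (u - v) = 0" using that by (simp add: sq_def algebra_simps)
    then show ?thesis using \<eta>(2)[of m] by auto
  qed
  have pk_bd: "\<alpha> + \<eta> m * w / 4 < pk m v" "pk m v < \<alpha> + \<eta> m * w / 2" if "v \<in> V" for m v
  proof -
    have v: "0 < v" "v < 1" using V(2) that by auto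
    have "\<eta> m * w > 0" using \<eta>(1)[of m] w by simp
    then have "\<eta> m * w * 1 < \<eta> m * w * (1 + v)" "\<eta> m * w * (1 + v) < \<eta> m * w * 2"
      using v by (intro mult_strict_left_mono; simp)+
    then show "\<alpha> + \<eta> m * w / 4 < pk m v" "pk m v < \<alpha> + \<eta> m * w / 2" unfolding pk_def by linarith+
  qed
  have gap: "{\<alpha> + \<eta> m * w / 4..\<alpha> + \<eta> m * w / 2} \<subseteq> C0" for m
  proof
    fix x assume x: "x \<in> {\<alpha> + \<eta> m * w / 4..\<alpha> + \<eta> m * w / 2}"
    have "\<eta> m * w > 0" "\<eta> m * w \<le> 1/2 * w" using \<eta>[of m] w by (auto intro: mult_right_mono)
    then show "x \<in> C0" using x by (intro a2) (auto simp: w_def)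
  qed
  have sq_gt: "sq m C0 v > \<alpha> + \<eta> m * w" if "v \<in> C0" for m v
  proof -
    have "(1 - \<eta> m) * \<alpha> < (1 - \<eta> m) * v" using a1[OF that] \<eta>(2)[of m] by (intro mult_strict_left_mono) auto
    then show ?thesis by (simp add: sq_def w_def c0_def algebra_simps)
  qed
  show ?thesis
  proof (rule that[of K s])
    fix m
    have "finite {D \<in> components V. sel m D}"
    proof -
      have "finite {D \<in> components V. idx D \<le> m}"
        by (rule inj_on_finite[of idx _ "{..m}"]) (auto intro: inj_on_subset[OF idx])
      moreover have "{D \<in> components V. sel m D} \<subseteq> insert C0 {D \<in> components V. idx D \<le> m}" by (auto simp: sel_def)
      ultimately show ?thesis using finite_subset by blast
    qed
    moreover have "compact (sq m D ` closure D)" if "D \<in> components V" for D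
      using C(4)[OF that] unfolding sq_def
      by (intro compact_continuous_image continuous_intros) (simp add: compact_closure)
    ultimately show "compact (K m)" unfolding K_def by (intro compact_Un compact_UN) auto
    show "K m \<subseteq> V" unfolding K_def using sq_in[of _ _ m] C(3) gap[of m] C0p(3) by blast
    show "s m ` V \<subseteq> K m"
    proof
      fix y assume "y \<in> s m ` V"
      then obtain v where v: "v \<in> V" "y = s m v" by blast
      show "y \<in> K m"
      proof (cases "sel m (cp v)")
        case True
        have "v \<in> closure (cp v)" using cp(2)[OF v(1)] closure_subset by blast
        then show ?thesis using True cp(1)[OF v(1)] v(2) unfolding K_def s_def by auto
      next
        case False
        then show ?thesis using pk_bd[OF v(1), of m] v(2) unfolding K_def s_def by auto
      qed
    qed
    show "continuous_on V (s m)"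
    proof (rule continuous_on_components[OF lc])
      fix D assume D: "D \<in> components V"
      have "continuous_on D (\<lambda>v. if sel m D then sq m D v else pk m v)"
        by (cases "sel m D") (auto simp: sq_def pk_def intro!: continuous_intros)
      then show "continuous_on D (s m)" by (rule continuous_on_eq) (simp add: s_def cpC[OF D])
    qed
    show "inj_on (s m) V"
    proof (rule inj_onI)
      have mix: False if uv: "u \<in> V" "v \<in> V" "sel m (cp u)" "\<not> sel m (cp v)" "s m u = s m v" for u v
      proof -
        have eq: "sq m (cp u) u = pk m v" using uv by (simp add: s_def)
        have "pk m v \<in> C0" using gap[of m] pk_bd[OF uv(2), of m] by auto
        moreover have "sq m (cp u) u \<in> cp u" using sq_in[OF cp(1)[OF uv(1)]] cp(2)[OF uv(1)] closure_subset by blast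
        ultimately have "cp u = C0" using eq components_nonoverlap[OF cp(1)[OF uv(1)] C0] by auto
        then have "pk m v > \<alpha> + \<eta> m * w" using sq_gt[of u m] cp(2)[OF uv(1)] eq by simp
        moreover have "\<eta> m * w > 0" using \<eta>(1)[of m] w by simp
        ultimately show False using pk_bd(2)[OF uv(2), of m] by linarith
      qed
      fix u v assume uv: "u \<in> V" "v \<in> V" "s m u = s m v"
      consider "sel m (cp u)" "sel m (cp v)" | "\<not> sel m (cp u)" "\<not> sel m (cp v)"
        using mix[of u v] mix[of v u] uv by metis
      then show "u = v"
      proof cases
        case 1
        then have eq: "sq m (cp u) u = sq m (cp v) v" using uv(3) by (simp add: s_def)
        have "sq m (cp u) u \<in> cp u" "sq m (cp v) v \<in> cp v"
          using sq_in[OF cp(1)[OF uv(1)]] cp(2)[OF uv(1)] sq_in[OF cp(1)[OF uv(2)]] cp(2)[OF uv(2)] closure_subset by blast+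
        then have "cp u = cp v" using eq components_nonoverlap[OF cp(1)[OF uv(1)] cp(1)[OF uv(2)]] by auto
        then show ?thesis using eq sq_inj by metis
      next
        case 2
        then have "\<eta> m * w * (1 + u) = \<eta> m * w * (1 + v)" using uv(3) by (simp add: s_def pk_def)
        then show ?thesis using \<eta>(1)[of m] w by simp
      qed
    qed
  next
    fix v assume v: "v \<in> V"
    have "(\<lambda>m. v + \<eta> m * (ctr (cp v) - v)) \<longlonglongrightarrow> v + 0 * (ctr (cp v) - v)"
    proof (intro tendsto_intros)
      have "(\<lambda>m. 1 / real (m + 2)) \<longlonglongrightarrow> 0"
        using LIMSEQ_ignore_initial_segment[OF lim_1_over_n, of 2] by simp
      then show "\<eta> \<longlonglongrightarrow> 0" by (simp add: \<eta>_def add.commute)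
    qed
    moreover have "\<forall>\<^sub>F m in sequentially. v + \<eta> m * (ctr (cp v) - v) = s m v"
      using eventually_ge_at_top[of "idx (cp v)"] by eventually_elim (simp add: s_def sel_def sq_def)
    ultimately show "(\<lambda>m. s m v) \<longlonglongrightarrow> v" using Lim_transform_eventually by fastforce
  qed
qed

section \<open>Surfaces swept out by periodic solutions\<close>

text \<open>A continuous map from a compact space onto a Hausdorff space is closed, hence a quotient
  map.\<close>

lemma continuous_on_compact_quotient:
  fixes q :: "'a::t2_space \<Rightarrow> 'b::t2_space" and f :: "'b \<Rightarrow> 'c::t2_space"
  assumes "compact D" "continuous_on D q" "continuous_on D (\<lambda>x. f (q x))"
  shows "continuous_on (q ` D) f"
  unfolding continuous_on_closed_invariant
proof (intro allI impI)
  fix B :: "'c set" assume B: "closed B"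
  have "closedin (top_of_set D) (D \<inter> (\<lambda>x. f (q x)) -` B)"
    by (rule continuous_closedin_preimage[OF assms(3) B])
  then have "compact (D \<inter> (\<lambda>x. f (q x)) -` B)" using assms(1) closedin_compact_eq by blast
  then have "compact (q ` (D \<inter> (\<lambda>x. f (q x)) -` B))"
    using assms(2) by (intro compact_continuous_image) (auto intro: continuous_on_subset)
  then show "\<exists>A. closed A \<and> A \<inter> q ` D = f -` B \<inter> q ` D"
    by (intro exI[of _ "q ` (D \<inter> (\<lambda>x. f (q x)) -` B)"]) (auto dest: compact_imp_closed)
qed

text \<open>The branch of the argument centred at \<open>a\<close>: multiplying by
  \<open>cis (- a)\<close> turns the omitted point to -1, where \<open>Arg\<close> jumps.\<close>

lemma arc_homeomorphism:
  "homeomorphism {a - pi<..<a + pi} (sphere 0 1 - {- cis a}) cis (\<lambda>c. a + Arg (c * cis (- a)))"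
proof -
  have not_neg: "c * cis (- a) \<notin> \<real>\<^sub>\<le>\<^sub>0" if c: "c \<in> sphere 0 1 - {- cis a}" for c
  proof
    assume n: "c * cis (- a) \<in> \<real>\<^sub>\<le>\<^sub>0"
    have "norm (c * cis (- a)) = 1" using c by (simp add: norm_mult)
    moreover have "norm (c * cis (- a)) = - Re (c * cis (- a))"
      using n by (metis complex_nonpos_Reals_iff abs_of_nonpos complex_is_Real_iff in_Reals_norm)
    ultimately have "c * cis (- a) = - 1" using n by (auto simp: complex_eq_iff complex_nonpos_Reals_iff)
    then have "c * cis (- a) * cis a = - cis a" by simp
    then have "c = - cis a" by (simp add: mult.assoc cis_mult)
    then show False using c by simp
  qed
  have inv: "a + Arg (cis \<theta> * cis (- a)) = \<theta>" if "\<theta> \<in> {a - pi<..<a + pi}" for \<theta>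
    using that by (simp add: cis_mult Arg_cis)
  have inv': "cis (a + Arg (c * cis (- a))) = c" if "c \<in> sphere 0 1" for c
  proof -
    have n: "norm (c * cis (- a)) = 1" using that by (simp add: norm_mult)
    then have "c * cis (- a) \<noteq> 0" by auto
    then have "cis (Arg (c * cis (- a))) = c * cis (- a)" using cis_Arg n by (simp add: sgn_div_norm)
    then show ?thesis by (simp flip: cis_mult) (simp add: mult.left_commute cis_mult)
  qed
  show ?thesis
    unfolding homeomorphism_def
  proof (intro conjI ballI)
    show im: "cis ` {a - pi<..<a + pi} = sphere 0 1 - {- cis a}"
    proof (intro set_eqI iffI)
      fix c assume "c \<in> cis ` {a - pi<..<a + pi}"
      then obtain \<theta> where \<theta>: "\<theta> \<in> {a - pi<..<a + pi}" "c = cis \<theta>" by blast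
      have "c \<noteq> - cis a"
      proof
        assume "c = - cis a"
        then have "cis \<theta> * cis (- a) = - 1" using \<theta> by (simp add: cis_mult)
        then have "Arg (cis \<theta> * cis (- a)) = pi" using Arg_cis[of pi] pi_gt_zero by simp
        then show False using inv[OF \<theta>(1)] \<theta>(1) by simp
      qed
      then show "c \<in> sphere 0 1 - {- cis a}" using \<theta> by simp
    next
      fix c assume c: "c \<in> sphere 0 1 - {- cis a}"
      have "Arg (c * cis (- a)) \<noteq> pi" using not_neg[OF c] Arg_eq_pi complex_nonpos_Reals_iff by force
      then have "a + Arg (c * cis (- a)) \<in> {a - pi<..<a + pi}"
        using Arg_bounded[of "c * cis (- a)"] by auto
      then show "c \<in> cis ` {a - pi<..<a + pi}" using inv'[of c] c by (metis DiffD1 imageI)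
    qed
    show "(\<lambda>c. a + Arg (c * cis (- a))) ` (sphere 0 1 - {- cis a}) = {a - pi<..<a + pi}"
      unfolding im[symmetric] image_image using inv by simp
    show "continuous_on {a - pi<..<a + pi} cis" by (intro continuous_intros)
    show "continuous_on (sphere 0 1 - {- cis a}) (\<lambda>c. a + Arg (c * cis (- a)))"
      by (intro continuous_intros continuous_on_compose2[OF continuous_on_Arg]) (use not_neg in auto)
  qed (use inv inv' in auto)
qed

text \<open>The condition of \<open>crossing_solution\<close> at a single time, so that it can be
  checked on one turn and transported by time shifts.\<close>

definition crossing_at ::
  "(point3 \<Rightarrow> point3) \<Rightarrow> (point3 \<Rightarrow> point3) \<Rightarrow> (real \<Rightarrow> point3) \<Rightarrow> real \<Rightarrow> bool" where
  "crossing_at Fp Fm X t \<longleftrightarrow>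
      (ycoord (X t) > 0 \<longrightarrow> (X has_vector_derivative Fp (X t)) (at t)) \<and>
      (ycoord (X t) < 0 \<longrightarrow> (X has_vector_derivative Fm (X t)) (at t)) \<and>
      (ycoord (X t) = 0 \<longrightarrow>
         (ycoord (Fm (X t)) > 0 \<and> ycoord (Fp (X t)) > 0 \<and>
          (X has_vector_derivative Fm (X t)) (at_left t) \<and>
          (X has_vector_derivative Fp (X t)) (at_right t)) \<or>
         (ycoord (Fm (X t)) < 0 \<and> ycoord (Fp (X t)) < 0 \<and>
          (X has_vector_derivative Fp (X t)) (at_left t) \<and>
          (X has_vector_derivative Fm (X t)) (at_right t)))"

lemma has_vector_derivative_shift_within:
  fixes X :: "real \<Rightarrow> 'a::real_normed_vector"
  assumes "(X has_vector_derivative D) (at (t + a) within (\<lambda>s. s + a) ` S)"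
  shows "((\<lambda>s. X (s + a)) has_vector_derivative D) (at t within S)"
proof -
  have "((\<lambda>s. s + a) has_vector_derivative 1) (at t within S)"
    by (auto intro!: derivative_eq_intros simp flip: has_real_derivative_iff_has_vector_derivative)
  from vector_diff_chain_within[OF this assms] show ?thesis by (simp add: o_def)
qed

lemma crossing_at_shift:
  assumes "crossing_at Fp Fm X (t + a)"
  shows "crossing_at Fp Fm (\<lambda>s. X (s + a)) t"
proof -
  have im: "(\<lambda>s. s + a) ` UNIV = UNIV" "(\<lambda>s. s + a) ` {..<t} = {..<t + a}" "(\<lambda>s. s + a) ` {t<..} = {t + a<..}"
    by (auto intro!: image_eqI[of _ _ "x - a" for x])
  note s = has_vector_derivative_shift_within[of X _ t a UNIV] has_vector_derivative_shift_within[of X _ t a "{..<t}"]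
    has_vector_derivative_shift_within[of X _ t a "{t<..}"]
  note s = s[unfolded im]
  show ?thesis using assms unfolding crossing_at_def using s by blast
qed

lemma smooth_immersion:
  fixes w :: "real \<times> real \<Rightarrow> real" and J :: "real \<Rightarrow> real"
  assumes U: "open U" and w: "\<And>k. Ck_on k w U" and J: "\<And>k. Ck_on k J UNIV" and pos: "\<And>x. x \<in> U \<Longrightarrow> w x > 0"
  defines "g \<equiv> \<lambda>x. (w x * cos (fst x), w x * sin (fst x), snd x + J (fst x))"
  shows "smooth_on g U \<and> (\<forall>u\<in>U. inj (frechet_derivative g (at u)))"
proof
  have f: "Ck_on k (\<lambda>x. F (fst x)) U" if "Ck_on k F UNIV" for F :: "real \<Rightarrow> real" and k
    by (rule Ck_on_compose[OF U open_UNIV that Ck_on_fst[OF U]]) simp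
  show "smooth_on g U" unfolding smooth_on_def g_def
    by (intro allI Ck_on_Pair Ck_on_add Ck_on_mult U w f J Ck_on_snd conjunct1[OF Ck_on_sin_cos] conjunct2[OF Ck_on_sin_cos])
  show "\<forall>u\<in>U. inj (frechet_derivative g (at u))"
  proof
    fix u assume u: "u \<in> U"
    obtain Dw where Dw: "(w has_derivative Dw) (at u)" using Ck_on_SucD[OF w u] by blast
    obtain DJ where DJ: "(J has_derivative DJ) (at (fst u))" using Ck_on_SucD[OF J, of "fst u"] by blast
    define D where "D = (\<lambda>h. (Dw h * cos (fst u) - w u * (sin (fst u) * fst h),
        Dw h * sin (fst u) + w u * (cos (fst u) * fst h), snd h + DJ (fst h)))"
    have DJ': "((\<lambda>x. J (fst x)) has_derivative (\<lambda>h. DJ (fst h))) (at u)"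
      by (rule has_derivative_compose[where g = J and f = fst, OF _ DJ]) (auto intro!: derivative_eq_intros)
    have "(g has_derivative D) (at u)" unfolding g_def D_def
      by (auto intro!: derivative_eq_intros Dw DJ' simp: algebra_simps)
    then have fd: "frechet_derivative g (at u) = D" and lin: "linear D"
      using frechet_derivative_at has_derivative_linear by (metis, blast)
    \<comment> \<open>Projects the horizontal part of the derivative onto the tangent of the circle.
      What remains is the radius times the angular increment, so a vector in the kernel has no
      angular component, and then the third coordinate removes the other one.\<close>
    have rot: "b * a * (s\<^sup>2 + c\<^sup>2) = c * (d * s + b * (c * a)) - s * (d * c - b * (s * a))" for a b c d s :: real
      by (simp add: algebra_simps power2_eq_square)
    have "h = 0" if "D h = 0" for h
    proof -
      let ?s = "sin (fst u)" and ?c = "cos (fst u)"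
      have e: "Dw h * ?c - w u * (?s * fst h) = 0" "Dw h * ?s + w u * (?c * fst h) = 0" "snd h + DJ (fst h) = 0"
        using that by (auto simp: D_def zero_prod_def)
      have "w u * fst h = w u * fst h * (?s\<^sup>2 + ?c\<^sup>2)" by simp
      also have "\<dots> = ?c * (Dw h * ?s + w u * (?c * fst h)) - ?s * (Dw h * ?c - w u * (?s * fst h))"
        by (rule rot)
      also have "\<dots> = 0" unfolding e by simp
      finally have "fst h = 0" using pos[OF u] by simp
      moreover have "DJ 0 = 0" using has_derivative_linear[OF DJ] by (rule linear_0)
      ultimately show "h = 0" using e(3) by (simp add: prod_eq_iff)
    qed
    then show "inj (frechet_derivative g (at u))" unfolding fd using lin linear_injective_0 by blast
  qed
qed

text \<open>For equal parameters the difference formula reduces to a nonzero exponential times the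
  initial difference.\<close>

lemma solution_uniqueness:
  fixes G :: "real \<times> real \<times> real \<Rightarrow> real"
  assumes G: "Ck_on 1 G UNIV"
    and u: "\<And>t. \<bar>t\<bar> < T \<Longrightarrow> (u has_real_derivative \<epsilon> * G (t, u t, z)) (at t)"
    and w: "\<And>t. \<bar>t\<bar> < T \<Longrightarrow> (w has_real_derivative \<epsilon> * G (t, w t, z)) (at t)"
    and \<theta>: "\<bar>\<theta>\<bar> < T" and eq: "u \<theta> = w \<theta>"
  shows "u 0 = w 0"
proof -
  let ?A = "\<lambda>x :: real \<times> unit. slope (dr G) (fst x) (u (fst x), z) (w (fst x), z)"
  let ?B = "\<lambda>x :: real \<times> unit. slope (dz G) (fst x) (u (fst x), z) (w (fst x), z)"
  have "w \<theta> - u \<theta> = exp (Jint (\<lambda>x. \<epsilon> * ?A x) (\<theta>, ())) * ((w 0 - u 0) +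
      (z - z) * Jint (\<lambda>x. \<epsilon> * ?B x * exp (- Jint (\<lambda>x. \<epsilon> * ?A x) x)) (\<theta>, ()))"
    by (rule solution_difference[OF G u w _ _ \<theta>]) simp_all
  then show ?thesis using eq by simp
qed

section \<open>The radius as a function of the angle\<close>

definition angular_field ::
  "nat \<Rightarrow> (nat \<Rightarrow> nat \<Rightarrow> nat \<Rightarrow> real) \<Rightarrow> (real \<Rightarrow> real) \<Rightarrow> real \<times> real \<times> real \<Rightarrow> real" where
  "angular_field n a J = (\<lambda>(\<theta>, r, z). r * Psi n a (r * cos \<theta>, r * sin \<theta>, z + J \<theta>))"

lemma angular_field_smooth:
  assumes J: "\<And>k. Ck_on k J UNIV"
  shows "Ck_on k (angular_field n a J) UNIV"
proof -
  let ?c = "Ck_on k :: (real \<times> real \<times> real \<Rightarrow> real) \<Rightarrow> _"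
  have f: "?c (\<lambda>x. F (fst x)) UNIV" if "Ck_on k F UNIV" for F :: "real \<Rightarrow> real"
    by (rule Ck_on_compose[OF open_UNIV open_UNIV that Ck_on_fst]) simp_all
  have r: "?c (\<lambda>x. fst (snd x)) UNIV" "?c (\<lambda>x. snd (snd x)) UNIV"
    by (rule Ck_on_linear; auto intro: bounded_linear_compose[OF bounded_linear_fst bounded_linear_snd]
        bounded_linear_compose[OF bounded_linear_snd bounded_linear_snd])+
  have "?c (\<lambda>x. fst (snd x) * (\<Sum>q\<in>{(i, j, k). i + j + k \<le> n - 1}.
     a (fst q) (fst (snd q)) (snd (snd q)) * (fst (snd x) * cos (fst x)) ^ fst q * (fst (snd x) * sin (fst x)) ^ fst (snd q) *
       (snd (snd x) + J (fst x)) ^ snd (snd q))) UNIV"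
    by (intro Ck_on_mult Ck_on_sum Ck_on_power Ck_on_add Ck_on_const open_UNIV r f J
        conjunct1[OF Ck_on_sin_cos] conjunct2[OF Ck_on_sin_cos])
  then show ?thesis by (simp add: angular_field_def Psi_def case_prod_unfold)
qed

text \<open>By \<open>J_der\<close> and \<open>h_radial\<close> the quantity
  \<open>z - J \<theta>\<close> is constant along solutions at every radius; this constant is the
  argument \<open>z\<close> of \<open>angular_field\<close>.\<close>

locale rotating =
  fixes h :: "real \<times> real \<Rightarrow> real" and J :: "real \<Rightarrow> real"
  assumes J0: "J 0 = 0" and J_per: "J (\<theta> + 2 * pi) = J \<theta>"
    and J_der: "(J has_real_derivative h (cos \<theta>, sin \<theta>)) (at \<theta>)"
    and J_smooth: "Ck_on k J UNIV"
    and h_radial: "r > 0 \<Longrightarrow> h (r * cos \<theta>, r * sin \<theta>) = h (cos \<theta>, sin \<theta>)"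
begin

text \<open>A radial perturbation leaves the angular speed equal to one, so the angle serves as
  time.\<close>

lemma path_derivative:
  assumes u: "(u has_real_derivative \<epsilon> * angular_field n a J (\<theta>, u \<theta>, z)) (at \<theta>)" and pos: "u \<theta> > 0"
  shows "((\<lambda>t. (u t * cos t, u t * sin t, z + J t)) has_vector_derivative
    perturbed_field h n a \<epsilon> (u \<theta> * cos \<theta>, u \<theta> * sin \<theta>, z + J \<theta>)) (at \<theta>)"
proof -
  define P where "P = Psi n a (u \<theta> * cos \<theta>, u \<theta> * sin \<theta>, z + J \<theta>)"
  have u': "(u has_real_derivative \<epsilon> * (u \<theta> * P)) (at \<theta>)" using u by (simp add: angular_field_def P_def)
  have d: "((\<lambda>t. u t * cos t) has_real_derivative \<epsilon> * (u \<theta> * P) * cos \<theta> - u \<theta> * sin \<theta>) (at \<theta>)"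
    "((\<lambda>t. u t * sin t) has_real_derivative \<epsilon> * (u \<theta> * P) * sin \<theta> + u \<theta> * cos \<theta>) (at \<theta>)"
    "((\<lambda>t. z + J t) has_real_derivative h (cos \<theta>, sin \<theta>)) (at \<theta>)"
    by (auto intro!: derivative_eq_intros u' J_der)
  have "((\<lambda>t. (u t * cos t, u t * sin t, z + J t)) has_vector_derivative
      (\<epsilon> * (u \<theta> * P) * cos \<theta> - u \<theta> * sin \<theta>, \<epsilon> * (u \<theta> * P) * sin \<theta> + u \<theta> * cos \<theta>, h (cos \<theta>, sin \<theta>))) (at \<theta>)"
    using d unfolding has_real_derivative_iff_has_vector_derivative
    by (intro has_vector_derivative_Pair)
  moreover have "(\<epsilon> * (u \<theta> * P) * cos \<theta> - u \<theta> * sin \<theta>, \<epsilon> * (u \<theta> * P) * sin \<theta> + u \<theta> * cos \<theta>, h (cos \<theta>, sin \<theta>)) =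
      perturbed_field h n a \<epsilon> (u \<theta> * cos \<theta>, u \<theta> * sin \<theta>, z + J \<theta>)"
    using h_radial[OF pos, of \<theta>]
    by (simp add: perturbed_field_def base_field_def radial_field_def P_def algebra_simps)
  ultimately show ?thesis by simp
qed

lemma ycoord_perturbed_field: "ycoord (perturbed_field h n a \<epsilon> (x, y, z)) = x + \<epsilon> * (y * Psi n a (x, y, z))"
  by (simp add: perturbed_field_def base_field_def radial_field_def)

end

text \<open>Compactness of \<open>K\<close> makes the injective continuous map \<open>Xi\<close>
  below a homeomorphism onto its image; the surface is taken over the open set \<open>V\<close>
  inside. \<open>smooth_loc\<close> goes through a local inverse of \<open>Z\<close> because smooth
  dependence is available in the coordinate z.\<close>

locale periodic_family = rotating h J for h J +
  fixes n :: nat and ap am :: "nat \<Rightarrow> nat \<Rightarrow> nat \<Rightarrow> real" and \<epsilon> :: real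
    and K V :: "real set" and Z R :: "real \<Rightarrow> real" and vp vm :: "real \<times> real \<Rightarrow> real"
  assumes K: "compact K" and V: "open V" "V \<subseteq> K"
    and contZ: "continuous_on K Z"
    and inj_RZ: "inj_on (\<lambda>v. (R v, Z v)) K"
    and cont_vp: "continuous_on ({-2*pi<..<2*pi} \<times> K) vp"
    and cont_vm: "continuous_on ({-2*pi<..<2*pi} \<times> K) vm"
    and pos: "\<And>\<theta> v. \<bar>\<theta>\<bar> < 2*pi \<Longrightarrow> v \<in> K \<Longrightarrow> vp (\<theta>, v) > 0"
      "\<And>\<theta> v. \<bar>\<theta>\<bar> < 2*pi \<Longrightarrow> v \<in> K \<Longrightarrow> vm (\<theta>, v) > 0"
    and ode_p: "\<And>\<theta> v. \<bar>\<theta>\<bar> < 2*pi \<Longrightarrow> v \<in> K \<Longrightarrow>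
      ((\<lambda>t. vp (t, v)) has_real_derivative \<epsilon> * angular_field n ap J (\<theta>, vp (\<theta>, v), Z v)) (at \<theta>)"
    and ode_m: "\<And>\<theta> v. \<bar>\<theta>\<bar> < 2*pi \<Longrightarrow> v \<in> K \<Longrightarrow>
      ((\<lambda>t. vm (t, v)) has_real_derivative \<epsilon> * angular_field n am J (\<theta>, vm (\<theta>, v), Z v)) (at \<theta>)"
    and init: "\<And>v. v \<in> K \<Longrightarrow> vp (0, v) = R v" "\<And>v. v \<in> K \<Longrightarrow> vm (0, v) = R v"
    and match: "\<And>v. v \<in> K \<Longrightarrow> vp (pi, v) = vm (-pi, v)"
    and smooth_loc: "\<And>v. v \<in> V \<Longrightarrow> \<exists>B \<zeta>. open B \<and> v \<in> B \<and> B \<subseteq> V \<and> open (Z ` B) \<and> homeomorphism B (Z ` B) Z \<zeta> \<and>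
      (\<forall>k. Ck_on k (\<lambda>x. vp (fst x, \<zeta> (snd x))) ({-2*pi<..<2*pi} \<times> Z ` B)) \<and>
      (\<forall>k. Ck_on k (\<lambda>x. vm (fst x, \<zeta> (snd x))) ({-2*pi<..<2*pi} \<times> Z ` B))"
begin

definition path where
  "path u v \<theta> = (u (\<theta>, v) * cos \<theta>, u (\<theta>, v) * sin \<theta>, Z v + J \<theta>)" for u :: "real \<times> real \<Rightarrow> real"

definition orbit where
  "orbit v \<theta> = (if 0 \<le> \<theta> then path vp v \<theta> else path vm v \<theta>)"

text \<open>\<open>Arg\<close> has values in (-\<pi>, \<pi>], so the lower half-turn is described by
  \<open>vm\<close> at negative angles. At the cut -1 the two descriptions agree by
  \<open>match\<close>.\<close>

definition Xi :: "complex \<times> real \<Rightarrow> point3" where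
  "Xi x = orbit (snd x) (Arg (fst x))"

abbreviation "Fp \<equiv> perturbed_field h n ap \<epsilon>"
abbreviation "Fm \<equiv> perturbed_field h n am \<epsilon>"

lemma path_vp: "\<bar>\<theta>\<bar> < 2*pi \<Longrightarrow> v \<in> K \<Longrightarrow> (path vp v has_vector_derivative Fp (path vp v \<theta>)) (at \<theta>)"
  unfolding path_def[abs_def] by (rule path_derivative[OF ode_p pos(1)])

lemma path_vm: "\<bar>\<theta>\<bar> < 2*pi \<Longrightarrow> v \<in> K \<Longrightarrow> (path vm v has_vector_derivative Fm (path vm v \<theta>)) (at \<theta>)"
  unfolding path_def[abs_def] by (rule path_derivative[OF ode_m pos(2)])

lemma J_pi: "J (- pi) = J pi"
  using J_per[of "- pi"] by simp

lemma path_pi: "v \<in> K \<Longrightarrow> path vp v pi = path vm v (- pi)"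
  by (simp add: path_def match J_pi)

lemma path_0: "v \<in> K \<Longrightarrow> path vp v 0 = path vm v 0"
  by (simp add: path_def init)

lemma Xi_cis:
  assumes "v \<in> K"
  shows "0 \<le> \<theta> \<Longrightarrow> \<theta> \<le> pi \<Longrightarrow> Xi (cis \<theta>, v) = path vp v \<theta>"
    and "- pi \<le> \<theta> \<Longrightarrow> \<theta> \<le> 0 \<Longrightarrow> Xi (cis \<theta>, v) = path vm v \<theta>"
proof -
  show "Xi (cis \<theta>, v) = path vp v \<theta>" if "0 \<le> \<theta>" "\<theta> \<le> pi"
  proof -
    have "- pi < \<theta>" using that pi_gt_zero by linarith
    then show ?thesis using that Arg_cis[of \<theta>] by (simp add: Xi_def orbit_def)
  qed
  show "Xi (cis \<theta>, v) = path vm v \<theta>" if "- pi \<le> \<theta>" "\<theta> \<le> 0"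
  proof (cases "\<theta> = - pi")
    case True
    have "Arg (-1) = pi" using Arg_cis[of pi] pi_gt_zero by simp
    moreover have "cis (- pi) = -1" by (simp add: complex_eq_iff)
    ultimately show ?thesis using True path_pi[OF assms] by (simp add: Xi_def orbit_def)
  next
    case False
    then have "Arg (cis \<theta>) = \<theta>" using that pi_gt_zero by (intro Arg_cis) auto
    then show ?thesis using that path_0[OF assms] by (auto simp: Xi_def orbit_def)
  qed
qed

lemma Xi_cis_late: "v \<in> K \<Longrightarrow> pi \<le> \<theta> \<Longrightarrow> \<theta> \<le> 2*pi \<Longrightarrow> Xi (cis \<theta>, v) = path vm v (\<theta> - 2*pi)"
proof -
  assume *: "v \<in> K" "pi \<le> \<theta>" "\<theta> \<le> 2*pi"
  have "cis \<theta> = cis (\<theta> - 2*pi)" by (simp add: cis.ctr cos_diff sin_diff)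
  then show ?thesis using Xi_cis(2)[of v "\<theta> - 2*pi"] * by simp
qed

lemma sphere_cis:
  assumes "c \<in> sphere 0 1"
  obtains \<theta> where "- pi < \<theta>" "\<theta> \<le> pi" "c = cis \<theta>"
proof -
  have "c \<noteq> 0" using assms by auto
  then have "cis (Arg c) = c" using cis_Arg[of c] assms by (simp add: sgn_div_norm)
  then show ?thesis using that[of "Arg c"] Arg_bounded[of c] by auto
qed

text \<open>\<open>Arg\<close> jumps at -1, so continuity is proved over the interval
  [-\<pi>, \<pi>], where the two halves agree at 0, and is passed on to the circle by the quotient
  map \<open>cis\<close>.\<close>

lemma Xi_continuous: "continuous_on (sphere 0 1 \<times> K) Xi"
proof -
  define D where "D = {-pi..pi} \<times> K"
  have *: "(\<lambda>x. (cis (fst x), snd x)) ` D = sphere 0 1 \<times> K"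
  proof (intro set_eqI iffI)
    fix x assume "x \<in> (sphere 0 1 :: complex set) \<times> K"
    then obtain c v where x: "x = (c, v)" "c \<in> sphere 0 1" "v \<in> K" by auto
    obtain \<theta> where "- pi < \<theta>" "\<theta> \<le> pi" "c = cis \<theta>" using sphere_cis[OF x(2)] .
    then show "x \<in> (\<lambda>x. (cis (fst x), snd x)) ` D" using x by (intro image_eqI[of _ _ "(\<theta>, v)"]) (auto simp: D_def)
  qed (auto simp: D_def)
  have cJ: "continuous_on S (\<lambda>x. J (f x))" if "continuous_on S f" for S :: "(real \<times> real) set" and f
    by (rule continuous_on_compose2[OF Ck_on_continuous[OF J_smooth] that]) simp
  have cZ: "continuous_on D (\<lambda>x. Z (snd x))"
    by (intro continuous_on_compose2[OF contZ] continuous_intros) (auto simp: D_def)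
  have D1: "D \<subseteq> {-2*pi<..<2*pi} \<times> K"
  proof
    fix x assume "x \<in> D"
    then have "- pi \<le> fst x" "fst x \<le> pi" "snd x \<in> K" by (auto simp: D_def)
    then show "x \<in> {-2*pi<..<2*pi} \<times> K" using pi_gt_zero
      by (auto simp: mem_Times_iff simp del: pi_gt_zero)
  qed
  have cp: "continuous_on D (\<lambda>x. path u (snd x) (fst x))" if "continuous_on ({-2*pi<..<2*pi} \<times> K) u" for u
    unfolding path_def by (intro continuous_intros cJ cZ continuous_on_subset[OF that D1]) (simp add: continuous_on_subset[OF that D1])+
  have "continuous_on (D \<inter> {x. 0 \<le> fst x} \<union> D \<inter> {x. fst x \<le> 0}) (\<lambda>x. Xi (cis (fst x), snd x))"
  proof (rule continuous_on_closed_Un)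
    have "compact D" by (auto simp: D_def intro: compact_Times K)
    then show "closed (D \<inter> {x. 0 \<le> fst x})" "closed (D \<inter> {x. fst x \<le> 0})"
      by (intro closed_Int compact_imp_closed closed_Collect_le continuous_intros; assumption)+
    show "continuous_on (D \<inter> {x. 0 \<le> fst x}) (\<lambda>x. Xi (cis (fst x), snd x))"
      by (rule continuous_on_eq[OF continuous_on_subset[OF cp[OF cont_vp]]]) (auto simp: D_def Xi_cis)
    show "continuous_on (D \<inter> {x. fst x \<le> 0}) (\<lambda>x. Xi (cis (fst x), snd x))"
      by (rule continuous_on_eq[OF continuous_on_subset[OF cp[OF cont_vm]]]) (auto simp: D_def Xi_cis)
  qed
  moreover have "D \<inter> {x. 0 \<le> fst x} \<union> D \<inter> {x. fst x \<le> 0} = D" by auto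
  ultimately have "continuous_on D (\<lambda>x. Xi (cis (fst x), snd x))" by simp
  moreover have "compact D" by (auto simp: D_def intro: compact_Times K)
  moreover have "continuous_on D (\<lambda>x. (cis (fst x), snd x))" by (intro continuous_intros)
  ultimately show ?thesis unfolding *[symmetric] using continuous_on_compact_quotient by blast
qed

text \<open>The horizontal part determines angle and radius, the third coordinate then determines
  \<open>Z\<close>. Uniqueness traces the solution back to the angle 0, where \<open>inj_RZ\<close>
  applies.\<close>

lemma Xi_inj: "inj_on Xi (sphere 0 1 \<times> K)"
proof (rule inj_onI, clarsimp)
  fix c c' :: complex and v v' assume c: "norm c = 1" "norm c' = 1" and v: "v \<in> K" "v' \<in> K" and eq: "Xi (c, v) = Xi (c', v')"
  obtain \<theta> where \<theta>: "- pi < \<theta>" "\<theta> \<le> pi" "c = cis \<theta>" using sphere_cis[of c] c by auto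
  obtain \<theta>' where \<theta>': "- pi < \<theta>'" "\<theta>' \<le> pi" "c' = cis \<theta>'" using sphere_cis[of c'] c by auto
  define u where "u = (if 0 \<le> \<theta> then vp (\<theta>, v) else vm (\<theta>, v))"
  define u' where "u' = (if 0 \<le> \<theta>' then vp (\<theta>', v') else vm (\<theta>', v'))"
  have X: "Xi (c, v) = (u * cos \<theta>, u * sin \<theta>, Z v + J \<theta>)" "Xi (c', v') = (u' * cos \<theta>', u' * sin \<theta>', Z v' + J \<theta>')"
    using Xi_cis[OF v(1), of \<theta>] Xi_cis[OF v(2), of \<theta>'] \<theta> \<theta>' by (auto simp: u_def u'_def path_def)
  have b: "\<bar>\<theta>\<bar> < 2*pi" "\<bar>\<theta>'\<bar> < 2*pi" using \<theta> \<theta>' pi_gt_zero by linarith+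
  have p: "u > 0" "u' > 0" using pos b v by (auto simp: u_def u'_def)
  have e: "of_real u * cis \<theta> = of_real u' * cis \<theta>'" using eq X by (simp add: complex_eq_iff)
  then have "norm (of_real u * cis \<theta>) = norm (of_real u' * cis \<theta>')" by simp
  then have uu: "u = u'" using p by (simp add: norm_mult)
  then have cc: "c = c'" using e p \<theta>(3) \<theta>'(3) by simp
  have "cis \<theta> = cis \<theta>'" by (rule cc[unfolded \<theta>(3) \<theta>'(3)])
  moreover have "Arg (cis \<theta>) = \<theta>" "Arg (cis \<theta>') = \<theta>'" using \<theta>(1,2) \<theta>'(1,2) by (auto intro!: Arg_cis)
  ultimately have tt: "\<theta> = \<theta>'" by metis
  have zz: "Z v = Z v'" using eq X tt by simp
  have "R v = R v'"
  proof (cases "0 \<le> \<theta>")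
    case True
    have "vp (0, v) = vp (0, v')"
      by (rule solution_uniqueness[OF angular_field_smooth[OF J_smooth, of 1] ode_p[OF _ v(1)] ode_p[OF _ v(2), folded zz] b(1)])
        (use True uu tt in \<open>auto simp: u_def u'_def\<close>)
    then show ?thesis using init v by simp
  next
    case False
    have "vm (0, v) = vm (0, v')"
      by (rule solution_uniqueness[OF angular_field_smooth[OF J_smooth, of 1] ode_m[OF _ v(1)] ode_m[OF _ v(2), folded zz] b(1)])
        (use False uu tt in \<open>auto simp: u_def u'_def\<close>)
    then show ?thesis using init v by simp
  qed
  then show "c = c' \<and> v = v'" using cc zz inj_RZ v by (auto dest: inj_onD)
qed

definition M where "M = Xi ` (sphere 0 1 \<times> V)"

lemma Xi_homeomorphism: obtains Xi' where "homeomorphism (sphere 0 1 \<times> V) M Xi Xi'"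
proof -
  have "compact ((sphere 0 1 :: complex set) \<times> K)" by (intro compact_Times K compact_sphere)
  then obtain Xi' where "homeomorphism (sphere 0 1 \<times> K) (Xi ` (sphere 0 1 \<times> K)) Xi Xi'"
    using homeomorphism_compact[OF _ Xi_continuous refl Xi_inj] by blast
  then have "homeomorphism (sphere 0 1 \<times> V) M Xi Xi'"
    by (rule homeomorphism_of_subsets) (use V(2) in \<open>auto simp: M_def\<close>)
  then show ?thesis by (rule that)
qed

lemma Xi_1: "v \<in> K \<Longrightarrow> Xi (1, v) = (R v, 0, Z v)"
  using Xi_cis(1)[of v 0] by (simp add: path_def init J0)

lemma crossing_orbit:
  assumes v: "v \<in> K"
  shows "crossing_at Fp Fm (\<lambda>t. Xi (cis t, v)) t"
proof -
  let ?Y = "\<lambda>t. Xi (cis t, v)"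
  have main: "crossing_at Fp Fm ?Y \<theta>" if \<theta>: "- pi < \<theta>" "\<theta> \<le> pi" for \<theta>
  proof -
    have b: "\<bar>\<theta>\<bar> < 2*pi" using \<theta> pi_gt_zero by linarith
    consider "0 < \<theta>" "\<theta> < pi" | "\<theta> < 0" | "\<theta> = 0" | "\<theta> = pi" using \<theta> by linarith
    then show ?thesis
    proof cases
      case 1
      have "ycoord (?Y \<theta>) > 0" using 1 pos(1)[OF b v] Xi_cis(1)[OF v, of \<theta>] by (simp add: path_def sin_gt_zero)
      moreover have "(?Y has_vector_derivative Fp (?Y \<theta>)) (at \<theta>)"
      proof (rule has_vector_derivative_transform_within_open[where f = "path vp v" and S = "{0<..<pi}"])
        show "(path vp v has_vector_derivative Fp (?Y \<theta>)) (at \<theta>)"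
          using path_vp[OF b v] Xi_cis(1)[OF v, of \<theta>] 1 by simp
        show "path vp v s = ?Y s" if "s \<in> {0<..<pi}" for s using Xi_cis(1)[OF v, of s] that by simp
      qed (use 1 in auto)
      ultimately show ?thesis by (simp add: crossing_at_def)
    next
      case 2
      have "sin \<theta> < 0" using sin_gt_zero[of "- \<theta>"] 2 \<theta> by simp
      then have "ycoord (?Y \<theta>) < 0" using 2 \<theta> pos(2)[OF b v] Xi_cis(2)[OF v, of \<theta>]
        by (simp add: path_def mult_pos_neg)
      moreover have "(?Y has_vector_derivative Fm (?Y \<theta>)) (at \<theta>)"
      proof (rule has_vector_derivative_transform_within_open[where f = "path vm v" and S = "{-pi<..<0}"])
        show "(path vm v has_vector_derivative Fm (?Y \<theta>)) (at \<theta>)"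
          using path_vm[OF b v] Xi_cis(2)[OF v, of \<theta>] 2 \<theta> by simp
        show "path vm v s = ?Y s" if "s \<in> {-pi<..<0}" for s using Xi_cis(2)[OF v, of s] that by simp
      qed (use 2 \<theta> in auto)
      ultimately show ?thesis by (simp add: crossing_at_def)
    next
      case 3
      \<comment> \<open>On y = 0 both normal components equal x. Here x is positive and the orbit
        passes from the minus side to the plus side; at \<pi> both are reversed.\<close>
      have Y: "?Y 0 = (R v, 0, Z v)" using Xi_1[OF v] by simp
      have P: "path vp v 0 = ?Y 0" "path vm v 0 = ?Y 0" using Xi_cis[OF v, of 0] by auto
      have "R v > 0" using pos(1)[of 0 v] v init by simp
      moreover have "(?Y has_vector_derivative Fp (?Y 0)) (at 0 within {0..})"
      proof (rule has_vector_derivative_transform_within[where f = "path vp v" and d = pi])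
        show "(path vp v has_vector_derivative Fp (?Y 0)) (at 0 within {0..})"
          using path_vp[of 0 v] v P(1) by - (rule has_vector_derivative_at_within, simp)
        show "path vp v s = ?Y s" if "s \<in> {0..}" "dist s 0 < pi" for s
          using Xi_cis(1)[OF v, of s] that by (simp add: dist_real_def)
      qed auto
      then have "(?Y has_vector_derivative Fp (?Y 0)) (at_right 0)"
        by (rule has_vector_derivative_within_subset) auto
      moreover have "(?Y has_vector_derivative Fm (?Y 0)) (at 0 within {..0})"
      proof (rule has_vector_derivative_transform_within[where f = "path vm v" and d = pi])
        show "(path vm v has_vector_derivative Fm (?Y 0)) (at 0 within {..0})"
          using path_vm[of 0 v] v P(2) by - (rule has_vector_derivative_at_within, simp)
        show "path vm v s = ?Y s" if "s \<in> {..0}" "dist s 0 < pi" for s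
          using Xi_cis(2)[OF v, of s] that by (simp add: dist_real_def)
      qed auto
      then have "(?Y has_vector_derivative Fm (?Y 0)) (at_left 0)"
        by (rule has_vector_derivative_within_subset) auto
      ultimately show ?thesis using 3 Y by (simp add: crossing_at_def ycoord_perturbed_field)
    next
      case 4
      have bp: "\<bar>pi\<bar> < 2*pi" "\<bar>-pi\<bar> < 2*pi" using pi_gt_zero by linarith+
      have Y: "?Y pi = (- vp (pi, v), 0, Z v + J pi)" using Xi_cis(1)[OF v, of pi] by (simp add: path_def)
      have P: "path vp v pi = ?Y pi" "path vm v (- pi) = ?Y pi" using Xi_cis(1)[OF v, of pi] path_pi[OF v] by auto
      have "vp (pi, v) > 0" using pos(1)[OF bp(1) v] .
      moreover have "(?Y has_vector_derivative Fp (?Y pi)) (at pi within {..pi})"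
      proof (rule has_vector_derivative_transform_within[where f = "path vp v" and d = pi])
        show "(path vp v has_vector_derivative Fp (?Y pi)) (at pi within {..pi})"
          using path_vp[OF bp(1) v] P(1) by - (rule has_vector_derivative_at_within, simp)
        show "path vp v s = ?Y s" if "s \<in> {..pi}" "dist s pi < pi" for s
          using Xi_cis(1)[OF v, of s] that by (simp add: dist_real_def abs_if split: if_splits)
      qed auto
      then have "(?Y has_vector_derivative Fp (?Y pi)) (at_left pi)"
        by (rule has_vector_derivative_within_subset) auto
      \<comment> \<open>Beyond \<pi> the orbit is given by \<open>vm\<close> one full turn
        earlier.\<close>
      moreover have "(?Y has_vector_derivative Fm (?Y pi)) (at pi within {pi..})"
      proof (rule has_vector_derivative_transform_within[where f = "\<lambda>s. path vm v (s + (-2*pi))" and d = pi])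
        have "(path vm v has_vector_derivative Fm (?Y pi)) (at (pi + (-2*pi)) within (\<lambda>s. s + (-2*pi)) ` {pi..})"
          using path_vm[OF bp(2) v] P(2) by - (rule has_vector_derivative_at_within, simp)
        then show "((\<lambda>s. path vm v (s + (-2*pi))) has_vector_derivative Fm (?Y pi)) (at pi within {pi..})"
          by (rule has_vector_derivative_shift_within)
        fix s assume "s \<in> {pi..}" "dist s pi < pi"
        then show "path vm v (s + (-2*pi)) = ?Y s" using Xi_cis_late[OF v, of s] by (auto simp: dist_real_def)
      qed auto
      then have "(?Y has_vector_derivative Fm (?Y pi)) (at_right pi)"
        by (rule has_vector_derivative_within_subset) auto
      ultimately show ?thesis using 4 Y by (simp add: crossing_at_def ycoord_perturbed_field)
    qed
  qed
  \<comment> \<open>Every time is moved into (-\<pi>, \<pi>] by a shift that leaves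
    \<open>cis\<close> unchanged.\<close>
  obtain \<theta> where \<theta>: "- pi < \<theta>" "\<theta> \<le> pi" "cis t = cis \<theta>" using sphere_cis[of "cis t"] by auto
  have "cis (s + (\<theta> - t)) = cis s" for s
    by (simp add: cis_mult[symmetric] \<theta>(3)[symmetric] cis_divide[symmetric] cis_neq_zero)
  then show ?thesis using crossing_at_shift[of Fp Fm ?Y t "\<theta> - t"] main[OF \<theta>(1,2)] by simp
qed

lemma M_filled: "filled_by_closed_orbits (2 * pi) Fp Fm M"
  unfolding filled_by_closed_orbits_def
proof
  fix p assume "p \<in> M"
  then obtain c v where p: "p = Xi (c, v)" "c \<in> sphere 0 1" "v \<in> V" by (auto simp: M_def)
  then have v: "v \<in> K" using V by auto
  obtain \<theta> where \<theta>: "c = cis \<theta>" using sphere_cis[OF p(2)] by blast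
  define X where "X = (\<lambda>t. Xi (cis (t + \<theta>), v))"
  have "crossing_solution Fp Fm X"
    using crossing_at_shift[OF crossing_orbit[OF v]]
    unfolding crossing_solution_def X_def crossing_at_def by blast
  moreover have "X (t + 2*pi) = X t" for t
    by (simp add: X_def cis.ctr cos_add sin_add)
  ultimately have "periodic_crossing_solution (2*pi) Fp Fm X"
    by (simp add: periodic_crossing_solution_def)
  moreover have "X 0 = p" "range X \<subseteq> M" using p \<theta> by (auto simp: X_def M_def)
  ultimately show "\<exists>X. periodic_crossing_solution (2*pi) Fp Fm X \<and> X 0 = p \<and> range X \<subseteq> M" by blast
qed

end

lemma homeomorphism_prod:
  assumes f: "homeomorphism S S' f f'" and g: "homeomorphism T T' g g'"
  shows "homeomorphism (S \<times> T) (S' \<times> T') (\<lambda>x. (f (fst x), g (snd x))) (\<lambda>x. (f' (fst x), g' (snd x)))"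
proof -
  have i: "f ` S = S'" "f' ` S' = S" "g ` T = T'" "g' ` T' = T"
    and e: "\<And>x. x \<in> S \<Longrightarrow> f' (f x) = x" "\<And>x. x \<in> S' \<Longrightarrow> f (f' x) = x"
      "\<And>x. x \<in> T \<Longrightarrow> g' (g x) = x" "\<And>x. x \<in> T' \<Longrightarrow> g (g' x) = x"
    and c: "continuous_on S f" "continuous_on S' f'" "continuous_on T g" "continuous_on T' g'"
    using f g by (auto simp: homeomorphism_def)
  have m: "x \<in> S \<Longrightarrow> f x \<in> S'" "y \<in> S' \<Longrightarrow> f' y \<in> S" "u \<in> T \<Longrightarrow> g u \<in> T'" "w \<in> T' \<Longrightarrow> g' w \<in> T" for x y u w
    using i by auto
  show ?thesis
  proof (rule homeomorphismI)
    show "continuous_on (S \<times> T) (\<lambda>x. (f (fst x), g (snd x)))"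
      by (intro continuous_intros continuous_on_compose2[OF c(1)] continuous_on_compose2[OF c(3)]) auto
    show "continuous_on (S' \<times> T') (\<lambda>x. (f' (fst x), g' (snd x)))"
      by (intro continuous_intros continuous_on_compose2[OF c(2)] continuous_on_compose2[OF c(4)]) auto
  qed (use e m in auto)
qed

context periodic_family
begin

text \<open>The surface may have an edge where orbits cross y = 0. Continuing the plus and the minus
  solutions past the crossing yields two smooth immersions of the whole chart domain, and the
  surface switches between them.\<close>

lemma M_surface: "piecewise_smooth_surface M"
  unfolding piecewise_smooth_surface_def
proof
  fix p assume "p \<in> M"
  then obtain c0 v0 where p: "p = Xi (c0, v0)" "c0 \<in> sphere 0 1" "v0 \<in> V" by (auto simp: M_def)
  obtain \<theta>0 where \<theta>0: "- pi < \<theta>0" "\<theta>0 \<le> pi" "c0 = cis \<theta>0" using sphere_cis[OF p(2)] .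
  \<comment> \<open>A chart centred at 0 or at \<pi> contains exactly one of the two crossing
    angles; the one at \<pi> is chosen only for the point that the other omits.\<close>
  define a where "a = (if \<theta>0 = pi then pi else 0)"
  have a: "a = 0 \<or> a = pi" "\<theta>0 \<in> {a - pi<..<a + pi}" using \<theta>0 by (auto simp: a_def)
  obtain B \<zeta> where B: "open B" "v0 \<in> B" "B \<subseteq> V" "open (Z ` B)" "homeomorphism B (Z ` B) Z \<zeta>"
    "\<forall>k. Ck_on k (\<lambda>x. vp (fst x, \<zeta> (snd x))) ({-2*pi<..<2*pi} \<times> Z ` B)"
    "\<forall>k. Ck_on k (\<lambda>x. vm (fst x, \<zeta> (snd x))) ({-2*pi<..<2*pi} \<times> Z ` B)"
    using smooth_loc[OF p(3)] by (elim exE conjE)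
  have \<zeta>: "\<zeta> z \<in> B" "Z (\<zeta> z) = z" if "z \<in> Z ` B" for z
    using B(5) that by (auto simp: homeomorphism_def)
  define U where "U = {a - pi<..<a + pi} \<times> Z ` B"
  define A where "A = (sphere 0 1 - {- cis a}) \<times> B"
  \<comment> \<open>\<open>2 * a\<close> is 0 or a full turn. For a = \<pi> the plus solution is
    taken on (0, 2\<pi>) and the minus solution on (-2\<pi>, 0), which is why solutions are kept on
    (-2\<pi>, 2\<pi>).\<close>
  define wm where "wm = (\<lambda>x. vm (fst x - 2 * a, \<zeta> (snd x)))"
  define wp where "wp = (\<lambda>x. vp (fst x, \<zeta> (snd x)))"
  define g where "g = (\<lambda>w x. (w x * cos (fst x), w x * sin (fst x), snd x + J (fst x)))" for w :: "real \<times> real \<Rightarrow> real"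
  define \<sigma> where "\<sigma> = Xi \<circ> (\<lambda>x. (cis (fst x), \<zeta> (snd x)))"
  have U: "open U" using B(4) by (auto simp: U_def intro: open_Times)
  have rng: "\<bar>fst x\<bar> < 2*pi" "\<bar>fst x - 2*a\<bar> < 2*pi" "\<zeta> (snd x) \<in> K" "snd x \<in> Z ` B" if "x \<in> U" for x
  proof -
    show z: "snd x \<in> Z ` B" using that by (auto simp: U_def)
    then show "\<zeta> (snd x) \<in> K" using \<zeta>(1) B(3) V(2) by blast
    have "a - pi < fst x" "fst x < a + pi" using that by (auto simp: U_def)
    then show "\<bar>fst x\<bar> < 2*pi" "\<bar>fst x - 2*a\<bar> < 2*pi" using a(1) pi_gt_zero by (auto simp: abs_less_iff)
  qed
  have gp: "smooth_on (g wp) U \<and> (\<forall>u\<in>U. inj (frechet_derivative (g wp) (at u)))"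
    unfolding g_def
  proof (rule smooth_immersion[OF U _ J_smooth])
    show "Ck_on k wp U" for k unfolding wp_def
      by (rule Ck_on_subset[OF B(6)[rule_format]]) (use rng in \<open>force simp: abs_less_iff mem_Times_iff\<close>)
    show "wp x > 0" if "x \<in> U" for x unfolding wp_def by (rule pos(1)[OF rng(1,3)[OF that]])
  qed
  have gm: "smooth_on (g wm) U \<and> (\<forall>u\<in>U. inj (frechet_derivative (g wm) (at u)))"
    unfolding g_def
  proof (rule smooth_immersion[OF U _ J_smooth])
    show "Ck_on k wm U" for k
    proof -
      have "Ck_on k (\<lambda>x. (\<lambda>y. vm (fst y, \<zeta> (snd y))) (fst x - 2*a, snd x)) U"
      proof (rule Ck_on_compose[OF U _ B(7)[rule_format]])
        show "open ({-2*pi<..<2*pi} \<times> Z ` B)" using B(4) by (auto intro: open_Times)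
        show "Ck_on k (\<lambda>x. (fst x - 2*a, snd x)) U" by (intro Ck_on_Pair Ck_on_minus Ck_on_const Ck_on_fst Ck_on_snd U)
        show "(\<lambda>x. (fst x - 2*a, snd x)) ` U \<subseteq> {-2*pi<..<2*pi} \<times> Z ` B" using rng by (force simp: abs_less_iff)
      qed
      then show ?thesis by (simp add: wm_def)
    qed
    show "wm x > 0" if "x \<in> U" for x unfolding wm_def by (rule pos(2)[OF rng(2,3)[OF that]])
  qed
  have sel: "\<sigma> x \<in> {g wp x, g wm x}" if x: "x \<in> U" for x
  proof -
    have z: "Z (\<zeta> (snd x)) = snd x" using \<zeta>(2) rng(4)[OF x] .
    have gw: "g wp x = path vp (\<zeta> (snd x)) (fst x)" "g wm x = path vm (\<zeta> (snd x)) (fst x - 2*a)"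
      using a(1) J_per[of "fst x - 2*pi"] by (auto simp: g_def wp_def wm_def path_def z cos_diff sin_diff)
    have s: "\<sigma> x = Xi (cis (fst x), \<zeta> (snd x))" by (simp add: \<sigma>_def)
    have x': "a - pi < fst x" "fst x < a + pi" using x by (auto simp: U_def)
    show ?thesis
    proof (cases "a = 0")
      case True
      then show ?thesis using Xi_cis[OF rng(3)[OF x], of "fst x"] x' gw s by (cases "0 \<le> fst x") auto
    next
      case False
      then have "a = pi" using a(1) by simp
      then show ?thesis using Xi_cis(1)[OF rng(3)[OF x], of "fst x"] Xi_cis_late[OF rng(3)[OF x], of "fst x"] x' gw s
        by (cases "fst x \<le> pi") auto
    qed
  qed
  obtain Xi' where Xi': "homeomorphism (sphere 0 1 \<times> V) M Xi Xi'" by (rule Xi_homeomorphism)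
  have AV: "A \<subseteq> sphere 0 1 \<times> V" using B(3) by (auto simp: A_def)
  have "openin (top_of_set (sphere 0 1 \<times> V)) A"
  proof -
    have "A = (sphere 0 1 \<times> V) \<inter> ((- {- cis a}) \<times> B)" using B(3) by (auto simp: A_def)
    then show ?thesis using B(1) by (auto intro: openin_open_Int open_Times)
  qed
  then have "openin (top_of_set M) (Xi ` A)" using homeomorphism_imp_open_map[OF Xi'] by blast
  then obtain W where W: "open W" "Xi ` A = M \<inter> W" by (auto simp: openin_open)
  have "homeomorphism A (M \<inter> W) Xi Xi'"
    by (rule homeomorphism_of_subsets[OF Xi' AV]) (use W(2) in auto)
  moreover have "homeomorphism U A (\<lambda>x. (cis (fst x), \<zeta> (snd x))) (\<lambda>x. (a + Arg (fst x * cis (- a)), Z (snd x)))"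
    unfolding U_def A_def by (rule homeomorphism_prod[OF arc_homeomorphism homeomorphism_symD[OF B(5)]])
  ultimately have hom: "homeomorphism U (M \<inter> W) \<sigma> ((\<lambda>x. (a + Arg (fst x * cis (- a)), Z (snd x))) \<circ> Xi')"
    unfolding \<sigma>_def by (rule homeomorphism_compose[rotated])
  have "(c0, v0) \<in> A"
  proof -
    have "c0 \<in> sphere 0 1 - {- cis a}" using homeomorphism_image1[OF arc_homeomorphism[of a]] a(2) \<theta>0(3) by blast
    then show ?thesis using B(2) by (simp add: A_def)
  qed
  then have "p \<in> W" using W(2) p(1) by blast
  then show "\<exists>(U :: (real \<times> real) set) W \<sigma> \<tau> (G :: (real \<times> real \<Rightarrow> point3) set).
       open U \<and> open W \<and> p \<in> W \<and> homeomorphism U (M \<inter> W) \<sigma> \<tau> \<and> finite G \<and>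
       (\<forall>u\<in>U. \<exists>g\<in>G. \<sigma> u = g u) \<and>
       (\<forall>g\<in>G. smooth_on g U \<and> (\<forall>u\<in>U. inj (frechet_derivative g (at u))))"
    by (intro exI[of _ U] exI[of _ W] exI[of _ \<sigma>] exI[of _ "(\<lambda>x. (a + Arg (fst x * cis (- a)), Z (snd x))) \<circ> Xi'"]
        exI[of _ "{g wp, g wm}"] conjI U W(1) hom) (use sel gp gm in auto)
qed

end

section \<open>The averaged function\<close>

lemma deriv_zero_const:
  fixes f :: "real \<Rightarrow> real"
  assumes "\<And>x. (f has_real_derivative 0) (at x)"
  shows "f x = f y"
  using DERIV_isconst_all[of f x y] assms by blast

text \<open>The first and third terms of H1 change sign under a half-turn, so their integrals over
  two consecutive half-turns cancel. The mixed term is odd in \<theta>, so its integral from -\<pi>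
  to \<pi> vanishes. Hence the integral of \<open>h\<close> along the circle is periodic.\<close>

lemma rotating_exists:
  assumes cont: "continuous_on (UNIV - {(0, 0)}) h" and H1: "hyp_H1 h" and H2: "hyp_H2 h"
  obtains J where "rotating h J" "\<And>\<theta>. 0 \<le> \<theta> \<Longrightarrow> J \<theta> = I_h h \<theta>"
proof -
  obtain \<phi> P1 P2 P3 where P: "real_polynomial_function P1" "real_polynomial_function P2" "real_polynomial_function P3"
    and heq: "\<And>x y. (x, y) \<noteq> (0, 0) \<Longrightarrow> h (x, y) = \<phi> (x\<^sup>2 + y\<^sup>2) *
            (x * P1 (x\<^sup>2, y\<^sup>2) + x * y * P2 (x\<^sup>2, y\<^sup>2) + y * P3 (x\<^sup>2, y\<^sup>2))"
    using H1 unfolding hyp_H1_def by blast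
  \<comment> \<open>On the unit circle \<open>\<phi>\<close> enters through one value only, so
    \<open>h\<close> restricts to a trigonometric polynomial and \<open>J\<close> is smooth although
    \<open>\<phi>\<close> is merely continuous.\<close>
  define c where "c = \<phi> 1"
  define k1 where "k1 = (\<lambda>\<theta>. c * (cos \<theta> * P1 ((cos \<theta>)\<^sup>2, (sin \<theta>)\<^sup>2) + sin \<theta> * P3 ((cos \<theta>)\<^sup>2, (sin \<theta>)\<^sup>2)))"
  define k2 where "k2 = (\<lambda>\<theta>. c * (cos \<theta> * sin \<theta> * P2 ((cos \<theta>)\<^sup>2, (sin \<theta>)\<^sup>2)))"
  have k: "h (cos \<theta>, sin \<theta>) = k1 \<theta> + k2 \<theta>" for \<theta>
  proof -
    have "(cos \<theta>, sin \<theta>) \<noteq> (0, 0)" by (metis Pair_inject sin_zero_abs_cos_one abs_zero zero_neq_one)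
    from heq[OF this] show ?thesis by (simp add: k1_def k2_def c_def algebra_simps)
  qed
  have pol: "Ck_on k (\<lambda>\<theta>. P ((cos \<theta>)\<^sup>2, (sin \<theta>)\<^sup>2)) UNIV" if "real_polynomial_function P" for P :: "real \<times> real \<Rightarrow> real" and k
    by (rule Ck_on_compose[OF open_UNIV open_UNIV Ck_on_real_polynomial[OF open_UNIV that]])
      (intro Ck_on_Pair Ck_on_power open_UNIV conjunct1[OF Ck_on_sin_cos] conjunct2[OF Ck_on_sin_cos], simp)
  have sk: "Ck_on k k1 UNIV" "Ck_on k k2 UNIV" for k
    unfolding k1_def k2_def
    by (intro Ck_on_mult Ck_on_add Ck_on_const open_UNIV pol P conjunct1[OF Ck_on_sin_cos] conjunct2[OF Ck_on_sin_cos])+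
  define j where "j = (\<lambda>k \<theta>. Jint (\<lambda>x. k (fst x)) (\<theta>, ()))" for k :: "real \<Rightarrow> real"
  have dj: "(j k has_real_derivative k \<theta>) (at \<theta>)" if "continuous_on UNIV k" for k \<theta>
    using Jint_has_derivative[of "\<bar>\<theta>\<bar> + 1" "\<lambda>x. k (fst x)" "()" \<theta>] continuous_on_subset[OF that] by (simp add: j_def)
  have ck: "continuous_on UNIV k1" "continuous_on UNIV k2" using sk Ck_on_continuous by blast+
  note d1 = dj[OF ck(1)] and d2 = dj[OF ck(2)]
  have j0: "j k 0 = 0" for k by (simp add: j_def)
  have comp: "((\<lambda>\<theta>. j k (\<theta> + b)) has_real_derivative k (\<theta> + b)) (at \<theta>)" if "continuous_on UNIV k" for k b \<theta>
    using dj[OF that, of "\<theta> + b"] by (simp add: DERIV_shift)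
  have k1': "k1 (\<theta> + pi) = - k1 \<theta>" for \<theta> by (simp add: k1_def algebra_simps)
  have "((\<lambda>\<theta>. j k1 (\<theta> + pi) + j k1 \<theta>) has_real_derivative 0) (at \<theta>)" for \<theta>
    using DERIV_add[OF comp[OF ck(1), of pi \<theta>] d1[of \<theta>]] by (simp add: k1')
  note c1 = deriv_zero_const[OF this]
  have per1: "j k1 (\<theta> + 2*pi) = j k1 \<theta>" for \<theta>
    using c1[of "\<theta> + pi" \<theta>] by (simp add: algebra_simps)
  have k2': "k2 (- \<theta>) = - k2 \<theta>" "k2 (\<theta> + 2*pi) = k2 \<theta>" for \<theta> by (simp_all add: k2_def)
  have "((\<lambda>\<theta>. j k2 (- \<theta>) - j k2 \<theta>) has_real_derivative 0) (at \<theta>)" for \<theta>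
  proof -
    have "((\<lambda>\<theta>. j k2 (- \<theta>)) has_real_derivative k2 (- \<theta>) * (- 1)) (at \<theta>)"
      by (rule DERIV_chain2[OF d2]) (auto intro!: derivative_eq_intros)
    from DERIV_diff[OF this d2] show ?thesis by (simp add: k2')
  qed
  from deriv_zero_const[OF this] have even2: "j k2 (- \<theta>) = j k2 \<theta>" for \<theta>
    by (metis add.inverse_neutral diff_self eq_iff_diff_eq_0)
  have "((\<lambda>\<theta>. j k2 (\<theta> + 2*pi) - j k2 \<theta>) has_real_derivative 0) (at \<theta>)" for \<theta>
    using DERIV_diff[OF comp[OF ck(2), of "2*pi" \<theta>] d2[of \<theta>]] by (simp add: k2')
  note c2 = deriv_zero_const[OF this]
  \<comment> \<open>The increment over a turn is constant; at -\<pi> it is the difference of the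
    values at \<pi> and -\<pi>, which is 0 by evenness.\<close>
  have per2: "j k2 (\<theta> + 2*pi) = j k2 \<theta>" for \<theta>
    using c2[of \<theta> "- pi"] even2[of pi] by simp
  define J where "J = (\<lambda>\<theta>. j k1 \<theta> + j k2 \<theta>)"
  have dJ: "(J has_real_derivative h (cos \<theta>, sin \<theta>)) (at \<theta>)" for \<theta>
    unfolding k J_def by (intro DERIV_add d1 d2)
  have sJ: "Ck_on k J UNIV" for k
  proof (cases k)
    case 0
    then show ?thesis using dJ by (auto intro!: continuous_at_imp_continuous_on intro: DERIV_isCont)
  next
    case (Suc m)
    show ?thesis unfolding Suc
    proof (rule Ck_on_SucI[OF open_UNIV])
      show "(J has_derivative (*) (k1 x + k2 x)) (at x)" for x
        using dJ[of x] by (simp add: has_field_derivative_def k)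
      show "Ck_on m (\<lambda>x. (k1 x + k2 x) * v) UNIV" for v by (intro Ck_on_mult Ck_on_add Ck_on_const sk open_UNIV)
    qed
  qed
  have rad: "h (r * cos \<theta>, r * sin \<theta>) = h (cos \<theta>, sin \<theta>)" if r: "r > 0" for r \<theta>
  proof -
    have "\<exists>c. \<forall>x\<in>{0<..}. h (x * cos \<theta>, x * sin \<theta>) = c"
    proof (rule has_field_derivative_zero_constant)
      fix x :: real assume "x \<in> {0<..}"
      then have "((\<lambda>\<rho>. h (\<rho> * cos \<theta>, \<rho> * sin \<theta>)) has_real_derivative 0) (at x)"
        using H2 by (simp add: hyp_H2_def)
      then show "((\<lambda>\<rho>. h (\<rho> * cos \<theta>, \<rho> * sin \<theta>)) has_real_derivative 0) (at x within {0<..})"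
        by (rule has_field_derivative_at_within)
    qed simp
    then obtain c where "\<And>x. x > 0 \<Longrightarrow> h (x * cos \<theta>, x * sin \<theta>) = c" by auto
    from this[OF r] this[of 1] show ?thesis by simp
  qed
  have "rotating h J"
    by unfold_locales (use dJ sJ rad per1 per2 j0 in \<open>simp_all add: J_def del: Ck_on.simps\<close>)
  moreover have "J \<theta> = I_h h \<theta>" if "0 \<le> \<theta>" for \<theta>
  proof -
    have "((\<lambda>s. h (cos s, sin s)) has_integral J \<theta> - J 0) {0..\<theta>}"
    proof (rule fundamental_theorem_of_calculus[OF that])
      fix s
      show "(J has_vector_derivative h (cos s, sin s)) (at s within {0..\<theta>})"
        using has_vector_derivative_at_within dJ[of s] unfolding has_real_derivative_iff_has_vector_derivative by blast
    qed
    then show ?thesis by (simp add: I_h_def integral_unique J_def j0)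
  qed
  ultimately show ?thesis by (rule that)
qed

text \<open>The integrand has period 2\<pi> because \<open>J\<close> has, so the integral from \<pi>
  to 2\<pi> equals the one from -\<pi> to 0, which is \<open>- Jint\<close> at -\<pi>.\<close>

lemma psi_eq_avg:
  assumes rot: "rotating h J" and I: "\<And>\<theta>. 0 \<le> \<theta> \<Longrightarrow> J \<theta> = I_h h \<theta>"
  shows "psi h n ap am z r = avg (angular_field n ap J) (angular_field n am J) (r, z)"
proof -
  interpret rotating h J by (rule rot)
  have cont: "continuous_on UNIV (angular_field n a J)" for a
    using angular_field_smooth[OF J_smooth, of 0 n a] by simp
  have line: "continuous_on S (\<lambda>t. angular_field n a J (t, r, z))" for a S
    by (intro continuous_on_compose2[OF cont] continuous_intros) auto
  have p: "0 \<le> pi" "pi < 4" using pi_less_4 by auto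
  have P: "Jint (angular_field n ap J) (pi, r, z) =
      r * integral {0..pi} (\<lambda>\<theta>. Psi n ap (r * cos \<theta>, r * sin \<theta>, z + I_h h \<theta>))"
  proof -
    have "Jint (angular_field n ap J) (pi, r, z) = integral {0..pi} (\<lambda>t. angular_field n ap J (t, r, z))"
      by (rule Jint_pos[OF line p])
    also have "\<dots> = integral {0..pi} (\<lambda>\<theta>. r * Psi n ap (r * cos \<theta>, r * sin \<theta>, z + I_h h \<theta>))"
      by (rule integral_cong) (simp add: angular_field_def I)
    finally show ?thesis by simp
  qed
  let ?g = "\<lambda>t. angular_field n am J (t, r, z)" and ?\<Phi> = "\<lambda>t. Jint (angular_field n am J) (t, r, z)"
  have d: "(?\<Phi> has_real_derivative ?g t) (at t)" for t
    using Jint_has_derivative[OF line, of t "\<bar>t\<bar> + 1"] by simp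
  have "((\<lambda>t. ?\<Phi> (t + 2*pi) - ?\<Phi> t) has_real_derivative 0) (at t)" for t
  proof -
    have "((\<lambda>t. ?\<Phi> (t + 2*pi)) has_real_derivative ?g (t + 2*pi)) (at t)"
      using d[of "t + 2*pi"] by (simp add: DERIV_shift)
    from DERIV_diff[OF this d] show ?thesis by (simp add: angular_field_def J_per)
  qed
  \<comment> \<open>The constant increment over a turn, compared at -\<pi> and at 0, where
    \<open>?\<Phi>\<close> vanishes.\<close>
  from deriv_zero_const[OF this, of "- pi" 0] have s: "?\<Phi> (2*pi) - ?\<Phi> pi = - ?\<Phi> (- pi)" by simp
  have "(?g has_integral ?\<Phi> (2*pi) - ?\<Phi> pi) {pi..2*pi}"
  proof (rule fundamental_theorem_of_calculus)
    fix t
    show "(?\<Phi> has_vector_derivative ?g t) (at t within {pi..2*pi})"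
      using has_vector_derivative_at_within d[of t] unfolding has_real_derivative_iff_has_vector_derivative by blast
  qed simp
  then have "- ?\<Phi> (- pi) = integral {pi..2*pi} ?g" using s by (simp add: integral_unique)
  also have "\<dots> = integral {pi..2*pi} (\<lambda>\<theta>. r * Psi n am (r * cos \<theta>, r * sin \<theta>, z + I_h h \<theta>))"
  proof (rule integral_cong)
    fix t assume "t \<in> {pi..2*pi}"
    then have "0 \<le> t" using pi_gt_zero by (auto intro: order_trans[of 0 pi])
    then show "?g t = r * Psi n am (r * cos t, r * sin t, z + I_h h t)" by (simp add: angular_field_def I)
  qed
  finally show ?thesis using P by (simp add: psi_def avg_def distrib_left)
qed

lemma psi_zeros_eq:
  fixes n :: nat and ap am :: "nat \<Rightarrow> nat \<Rightarrow> nat \<Rightarrow> real"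
  assumes rot: "rotating h J" and I: "\<And>\<theta>. 0 \<le> \<theta> \<Longrightarrow> J \<theta> = I_h h \<theta>"
  defines "Gp \<equiv> angular_field n ap J" and "Gm \<equiv> angular_field n am J"
  shows "psi_zeros h n ap am = {p. fst p > 0 \<and> avg Gp Gm p = 0 \<and> avg (dr Gp) (dr Gm) p \<noteq> 0}"
    and "simple_zero h n ap am z0 r0 \<Longrightarrow> (r0, z0) \<in> psi_zeros h n ap am"
proof -
  interpret rotating h J by (rule rot)
  have C: "Ck_on 1 Gp UNIV" "Ck_on 1 Gm UNIV" unfolding Gp_def Gm_def by (intro angular_field_smooth J_smooth)+
  have e: "psi h n ap am z = (\<lambda>r. avg Gp Gm (r, z))" for z
    unfolding Gp_def Gm_def by (intro ext psi_eq_avg[OF rot I])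
  have d: "deriv (psi h n ap am z) r = avg (dr Gp) (dr Gm) (r, z)" for z r
    unfolding e by (rule DERIV_imp_deriv[OF avg_deriv_r[OF C]])
  show "psi_zeros h n ap am = {p. fst p > 0 \<and> avg Gp Gm p = 0 \<and> avg (dr Gp) (dr Gm) p \<noteq> 0}"
    unfolding psi_zeros_def S_set_def simple_zero_def d by (auto simp: e)
  show "simple_zero h n ap am z0 r0 \<Longrightarrow> (r0, z0) \<in> psi_zeros h n ap am"
    by (auto simp: psi_zeros_def S_set_def simple_zero_def)
qed

text \<open>\<open>\<Xi> (1, v)\<close> is the point on the half-plane \<theta> = 0. For \<epsilon>
  = 0 closeness to the curve \<gamma> is not asked, since the surface is a substitute there that the
  limits do not see.\<close>

definition swept_surface ::
  "(real \<times> real \<Rightarrow> real) \<Rightarrow> nat \<Rightarrow> (nat \<Rightarrow> nat \<Rightarrow> nat \<Rightarrow> real) \<Rightarrow> (nat \<Rightarrow> nat \<Rightarrow> nat \<Rightarrow> real) \<Rightarrow>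
   (real \<Rightarrow> real \<times> real) \<Rightarrow> real set \<Rightarrow> real \<Rightarrow> real \<Rightarrow> bool" where
  "swept_surface h n ap am \<gamma> V \<eta> \<epsilon> \<longleftrightarrow> (\<exists>(\<Xi> :: complex \<times> real \<Rightarrow> point3) \<Xi>' M R Z.
     homeomorphism (sphere 0 1 \<times> V) M \<Xi> \<Xi>' \<and> piecewise_smooth_surface M \<and>
     filled_by_closed_orbits (2*pi) (perturbed_field h n ap \<epsilon>) (perturbed_field h n am \<epsilon>) M \<and>
     (\<forall>v\<in>V. \<Xi> (1, v) = (R v, 0, Z v) \<and> R v > 0 \<and>
        (\<epsilon> \<noteq> 0 \<longrightarrow> Z v = snd (\<gamma> v) \<and> \<bar>R v - fst (\<gamma> v)\<bar> \<le> \<eta>)))"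

lemma surface_exists:
  fixes n :: nat and ap am :: "nat \<Rightarrow> nat \<Rightarrow> nat \<Rightarrow> real"
  defines "Gp \<equiv> \<lambda>J. angular_field n ap J" and "Gm \<equiv> \<lambda>J. angular_field n am J"
  assumes rot: "rotating h J"
    and \<gamma>: "homeomorphism V {p. fst p > 0 \<and> avg (Gp J) (Gm J) p = 0 \<and> avg (dr (Gp J)) (dr (Gm J)) p \<noteq> 0} \<gamma> e"
    and loc: "\<And>v. v \<in> V \<Longrightarrow> \<exists>O'. open O' \<and> v \<in> O' \<and> O' \<subseteq> V \<and> inj_on (\<lambda>v. snd (\<gamma> v)) O'"
    and K: "compact K" "K \<subseteq> V" and V': "open V'" "V' \<subseteq> K" and \<eta>: "\<eta> > 0"
  shows "\<exists>\<delta>>0. \<forall>\<epsilon>. \<bar>\<epsilon>\<bar> < \<delta> \<longrightarrow> swept_surface h n ap am \<gamma> V' \<eta> \<epsilon>"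
proof -
  interpret rotating h J by (rule rot)
  let ?N = "{p. fst p > 0 \<and> avg (Gp J) (Gm J) p = 0 \<and> avg (dr (Gp J)) (dr (Gm J)) p \<noteq> 0}"
  have sp: "Ck_on k (Gp J) UNIV" and sm: "Ck_on k (Gm J) UNIV" for k
    unfolding Gp_def Gm_def by (intro angular_field_smooth J_smooth)+
  have c\<gamma>: "continuous_on V \<gamma>" and \<gamma>V: "\<gamma> ` V = ?N" and e\<gamma>: "\<And>v. v \<in> V \<Longrightarrow> e (\<gamma> v) = v"
    using \<gamma> by (auto simp: homeomorphism_def)
  have cK: "continuous_on K \<gamma>" by (rule continuous_on_subset[OF c\<gamma> K(2)])
  have \<gamma>K: "compact (\<gamma> ` K)" by (rule compact_continuous_image[OF cK K(1)])
  have \<gamma>N: "fst p > 0 \<and> avg (Gp J) (Gm J) p = 0 \<and> avg (dr (Gp J)) (dr (Gm J)) p \<noteq> 0" if "p \<in> \<gamma> ` K" for p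
    using that \<gamma>V K(2) by blast
  have pi2: "{-2*pi<..<2*pi} = {-(2*pi)<..<2*pi}" by simp
  obtain \<delta> where \<delta>: "\<delta> > 0"
    and cont: "\<And>\<epsilon>. \<epsilon> \<noteq> 0 \<Longrightarrow> \<bar>\<epsilon>\<bar> < \<delta> \<Longrightarrow> persistent (Gp J) (Gm J) (\<gamma> ` K) \<eta> \<epsilon>"
    using continuation[OF sp[of 1] sm[of 1] \<gamma>K \<gamma>N \<eta>] by blast
  show ?thesis
  proof (intro exI[of _ \<delta>] conjI \<delta> allI impI)
    fix \<epsilon> :: real assume \<epsilon>: "\<bar>\<epsilon>\<bar> < \<delta>"
    have finish: "swept_surface h n ap am \<gamma> V' \<eta> \<epsilon>" if "periodic_family h J n ap am \<epsilon> K V' Z R vp vm"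
      and "\<And>v. v \<in> V' \<Longrightarrow> R v > 0 \<and> (\<epsilon> \<noteq> 0 \<longrightarrow> Z v = snd (\<gamma> v) \<and> \<bar>R v - fst (\<gamma> v)\<bar> \<le> \<eta>)" for Z R vp vm
    proof -
      interpret F: periodic_family h J n ap am \<epsilon> K V' Z R vp vm by (rule that(1))
      obtain \<Xi>' where X: "homeomorphism (sphere 0 1 \<times> V') F.M F.Xi \<Xi>'" by (rule F.Xi_homeomorphism)
      have "\<forall>v\<in>V'. F.Xi (1, v) = (R v, 0, Z v) \<and> R v > 0 \<and> (\<epsilon> \<noteq> 0 \<longrightarrow> Z v = snd (\<gamma> v) \<and> \<bar>R v - fst (\<gamma> v)\<bar> \<le> \<eta>)"
        using F.Xi_1 that(2) V'(2) by blast
      then show ?thesis unfolding swept_surface_def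
        by (intro exI[of _ F.Xi] exI[of _ \<Xi>'] exI[of _ F.M] exI[of _ R] exI[of _ Z] conjI X F.M_surface F.M_filled)
    qed
    show "swept_surface h n ap am \<gamma> V' \<eta> \<epsilon>"
    proof (cases "\<epsilon> = 0")
      case True
      \<comment> \<open>At \<epsilon> = 0 radii are constant and every orbit closes, so the orbits
        starting at radius 1 and height \<open>v\<close> form a surface of the right type.\<close>
      have "periodic_family h J n ap am \<epsilon> K V' (\<lambda>v. v) (\<lambda>_. 1) (\<lambda>_. 1) (\<lambda>_. 1)"
      proof unfold_locales
        fix v assume "v \<in> V'"
        then show "\<exists>B \<zeta>. open B \<and> v \<in> B \<and> B \<subseteq> V' \<and> open ((\<lambda>v. v) ` B) \<and> homeomorphism B ((\<lambda>v. v) ` B) (\<lambda>v. v) \<zeta> \<and>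
            (\<forall>k. Ck_on k (\<lambda>x. (\<lambda>_. 1 :: real) (fst x, \<zeta> (snd x))) ({-2*pi<..<2*pi} \<times> (\<lambda>v. v) ` B)) \<and>
            (\<forall>k. Ck_on k (\<lambda>x. (\<lambda>_. 1 :: real) (fst x, \<zeta> (snd x))) ({-2*pi<..<2*pi} \<times> (\<lambda>v. v) ` B))"
          using V'(1) homeomorphism_ident[of V']
          by (intro exI[of _ V'] exI[of _ "\<lambda>v. v"]) (auto intro!: Ck_on_const open_Times)
      qed (use K V' True in \<open>auto intro: inj_onI\<close>)
      then show ?thesis by (rule finish) (use True in auto)
    next
      case False
      obtain up um R where c: "continuous_on UNIV up" "continuous_on UNIV um" "continuous_on (\<gamma> ` K) R"
        and inj: "inj_on (\<lambda>p. (R p, snd p)) (\<gamma> ` K)"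
        and DE0: "\<forall>p\<in>\<gamma> ` K. R p > 0 \<and> \<bar>R p - fst p\<bar> \<le> \<eta> \<and>
      up (0, R p, snd p) = R p \<and> um (0, R p, snd p) = R p \<and>
      up (pi, R p, snd p) = um (- pi, R p, snd p) \<and>
      Jint (\<lambda>x. dr (Gp J) (fst x, up x, snd (snd x))) (pi, R p, snd p) \<noteq>
      Jint (\<lambda>x. dr (Gm J) (fst x, um x, snd (snd x))) (- pi, R p, snd p) \<and>
      (\<forall>\<theta>. \<bar>\<theta>\<bar> < 2 * pi \<longrightarrow> up (\<theta>, R p, snd p) > 0 \<and> um (\<theta>, R p, snd p) > 0 \<and>
        ((\<lambda>t. up (t, R p, snd p)) has_real_derivative \<epsilon> * Gp J (\<theta>, up (\<theta>, R p, snd p), snd p)) (at \<theta>) \<and>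
        ((\<lambda>t. um (t, R p, snd p)) has_real_derivative \<epsilon> * Gm J (\<theta>, um (\<theta>, R p, snd p), snd p)) (at \<theta>))"
        using cont[OF False \<epsilon>, unfolded persistent_def] by (elim exE conjE)
      have D: "R p > 0 \<and> \<bar>R p - fst p\<bar> \<le> \<eta> \<and>
      up (0, R p, snd p) = R p \<and> um (0, R p, snd p) = R p \<and>
      up (pi, R p, snd p) = um (- pi, R p, snd p) \<and>
      Jint (\<lambda>x. dr (Gp J) (fst x, up x, snd (snd x))) (pi, R p, snd p) \<noteq>
      Jint (\<lambda>x. dr (Gm J) (fst x, um x, snd (snd x))) (- pi, R p, snd p)" if "p \<in> \<gamma> ` K" for p
        using DE0 that by blast
      have E: "up (\<theta>, R p, snd p) > 0 \<and> um (\<theta>, R p, snd p) > 0 \<and>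
        ((\<lambda>t. up (t, R p, snd p)) has_real_derivative \<epsilon> * Gp J (\<theta>, up (\<theta>, R p, snd p), snd p)) (at \<theta>) \<and>
        ((\<lambda>t. um (t, R p, snd p)) has_real_derivative \<epsilon> * Gm J (\<theta>, um (\<theta>, R p, snd p), snd p)) (at \<theta>)" if "p \<in> \<gamma> ` K" "\<bar>\<theta>\<bar> < 2 * pi" for p \<theta>
        using DE0 that by blast
      define Z where "Z = (\<lambda>v. snd (\<gamma> v))"
      define R' where "R' = (\<lambda>v. R (\<gamma> v))"
      define vp where "vp = (\<lambda>x. up (fst x, R' (snd x), Z (snd x)))"
      define vm where "vm = (\<lambda>x. um (fst x, R' (snd x), Z (snd x)))"
      have cZ: "continuous_on K Z" unfolding Z_def by (intro continuous_intros cK)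
      have cR: "continuous_on K R'" unfolding R'_def by (rule continuous_on_compose2[OF c(3) cK]) simp
      have DE: "R' v > 0" "\<bar>R' v - fst (\<gamma> v)\<bar> \<le> \<eta>" "vp (0, v) = R' v" "vm (0, v) = R' v" "vp (pi, v) = vm (- pi, v)"
        if "v \<in> K" for v
        using D[of "\<gamma> v"] that by (auto simp: vp_def vm_def R'_def Z_def)
      have nd: "Jint (\<lambda>x. dr (Gp J) (fst x, up x, snd (snd x))) (pi, R' v, Z v) \<noteq>
          Jint (\<lambda>x. dr (Gm J) (fst x, um x, snd (snd x))) (- pi, R' v, Z v)" if "v \<in> K" for v
        using D[of "\<gamma> v"] that by (auto simp: R'_def Z_def)
      have EE: "vp (\<theta>, v) > 0" "vm (\<theta>, v) > 0"
        "((\<lambda>t. vp (t, v)) has_real_derivative \<epsilon> * Gp J (\<theta>, vp (\<theta>, v), Z v)) (at \<theta>)"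
        "((\<lambda>t. vm (t, v)) has_real_derivative \<epsilon> * Gm J (\<theta>, vm (\<theta>, v), Z v)) (at \<theta>)"
        if "v \<in> K" "\<bar>\<theta>\<bar> < 2*pi" for v \<theta>
        using E[of "\<gamma> v" \<theta>] that by (auto simp: vp_def vm_def R'_def Z_def)
      have cv: "continuous_on (S \<times> K) vp" "continuous_on (S \<times> K) vm" for S unfolding vp_def vm_def
        by (intro continuous_on_compose2[OF c(1)] continuous_on_compose2[OF c(2)] continuous_intros
            continuous_on_compose2[OF cZ] continuous_on_compose2[OF cR]; auto)+
      have "periodic_family h J n ap am \<epsilon> K V' Z R' vp vm"
      proof unfold_locales
        show "inj_on (\<lambda>v. (R' v, Z v)) K"
        proof (rule inj_onI)
          fix v w assume vw: "v \<in> K" "w \<in> K" "(R' v, Z v) = (R' w, Z w)"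
          then have "\<gamma> v = \<gamma> w" using inj by (auto simp: R'_def Z_def dest: inj_onD)
          then show "v = w" using e\<gamma>[of v] e\<gamma>[of w] vw K(2) by auto
        qed
        fix v assume v: "v \<in> V'"
        obtain O' where O': "open O'" "v \<in> O'" "inj_on (\<lambda>v. snd (\<gamma> v)) O'"
          using loc[of v] v V'(2) K(2) by blast
        \<comment> \<open>On \<open>B\<close> the height is injective, so z can replace the
          parameter \<open>v\<close>, in which the curve is only known to be continuous;
          \<open>smooth_periodic_family\<close> is applied over the heights.\<close>
        define B where "B = O' \<inter> V'"
        have B: "open B" "v \<in> B" "B \<subseteq> V'" "B \<subseteq> K" "inj_on Z B" "continuous_on B Z"
          using O' v V' cZ by (auto simp: B_def Z_def intro: inj_on_subset continuous_on_subset)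
        have oZ: "open (Z ` B)" by (rule invariance_of_domain[OF B(6,1,5)])
        obtain \<zeta> where \<zeta>: "homeomorphism B (Z ` B) Z \<zeta>"
          using invariance_of_domain_homeomorphism[OF B(1,6) _ B(5)] by auto
        have \<zeta>B: "\<zeta> z \<in> K" "Z (\<zeta> z) = z" if "z \<in> Z ` B" for z
          using \<zeta> that B(4) by (auto simp: homeomorphism_def)
        have c\<zeta>: "continuous_on (Z ` B) \<zeta>" using \<zeta> by (simp add: homeomorphism_def)
        have cc: "continuous_on ({-(2*pi)<..<2*pi} \<times> Z ` B) (\<lambda>x. w (fst x, \<zeta> (snd x)))"
          if "\<And>S. continuous_on (S \<times> K) w" for w :: "real \<times> real \<Rightarrow> real"
          by (rule continuous_on_compose2[OF that[of UNIV]])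
            (use \<zeta>B(1) in \<open>auto intro!: continuous_intros continuous_on_compose2[OF c\<zeta>]\<close>)
        have "Ck_on k (\<lambda>x. vp (fst x, \<zeta> (snd x))) ({-(2*pi)<..<2*pi} \<times> Z ` B) \<and>
            Ck_on k (\<lambda>x. vm (fst x, \<zeta> (snd x))) ({-(2*pi)<..<2*pi} \<times> Z ` B)" for k
        proof (rule smooth_periodic_family[OF sp sm False _ oZ cc[OF cv(1)] cc[OF cv(2)]])
          show "pi < 2 * pi" using pi_gt_zero by linarith
          fix z assume z: "z \<in> Z ` B"
          note zz = \<zeta>B[OF z]
          show "((\<lambda>t. (\<lambda>x. vp (fst x, \<zeta> (snd x))) (t, z)) has_real_derivative
              \<epsilon> * Gp J (t, (\<lambda>x. vp (fst x, \<zeta> (snd x))) (t, z), z)) (at t)" if "\<bar>t\<bar> < 2*pi" for t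
            using EE(3)[OF zz(1) that] zz(2) by simp
          show "((\<lambda>t. (\<lambda>x. vm (fst x, \<zeta> (snd x))) (t, z)) has_real_derivative
              \<epsilon> * Gm J (t, (\<lambda>x. vm (fst x, \<zeta> (snd x))) (t, z), z)) (at t)" if "\<bar>t\<bar> < 2*pi" for t
            using EE(4)[OF zz(1) that] zz(2) by simp
          show "vp (fst (0, z), \<zeta> (snd (0 :: real, z))) = vm (fst (0, z), \<zeta> (snd (0 :: real, z)))" using DE(3,4)[OF zz(1)] by simp
          show "vp (fst (pi, z), \<zeta> (snd (pi, z))) = vm (fst (- pi, z), \<zeta> (snd (- pi, z)))" using DE(5)[OF zz(1)] by simp
          have "Jint (\<lambda>x. dr (Gp J) (fst x, vp (fst x, \<zeta> (snd x)), snd x)) (\<theta>, z) =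
              Jint (\<lambda>x. dr (Gp J) (fst x, up x, snd (snd x))) (\<theta>, R' (\<zeta> z), Z (\<zeta> z))"
            "Jint (\<lambda>x. dr (Gm J) (fst x, vm (fst x, \<zeta> (snd x)), snd x)) (\<theta>, z) =
              Jint (\<lambda>x. dr (Gm J) (fst x, um x, snd (snd x))) (\<theta>, R' (\<zeta> z), Z (\<zeta> z))" for \<theta>
            by (simp_all add: Jint_def vp_def vm_def zz(2))
          then show "Jint (\<lambda>x. dr (Gp J) (fst x, vp (fst x, \<zeta> (snd x)), snd x)) (pi, z) \<noteq>
            Jint (\<lambda>x. dr (Gm J) (fst x, vm (fst x, \<zeta> (snd x)), snd x)) (- pi, z)"
            using nd[OF zz(1)] by simp
        qed
        then show "\<exists>B \<zeta>. open B \<and> v \<in> B \<and> B \<subseteq> V' \<and> open (Z ` B) \<and> homeomorphism B (Z ` B) Z \<zeta> \<and>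
            (\<forall>k. Ck_on k (\<lambda>x. vp (fst x, \<zeta> (snd x))) ({-2*pi<..<2*pi} \<times> Z ` B)) \<and>
            (\<forall>k. Ck_on k (\<lambda>x. vm (fst x, \<zeta> (snd x))) ({-2*pi<..<2*pi} \<times> Z ` B))"
          unfolding pi2 by (intro exI[of _ B] exI[of _ \<zeta>] conjI B oZ \<zeta>) blast+
      qed (use K V' cZ cv DE EE in \<open>auto simp: Gp_def Gm_def\<close>)
      then show ?thesis by (rule finish) (use V'(2) DE Z_def in auto)
    qed
  qed
qed

section \<open>The revolution surface as a product, and the choice of the level\<close>

lemma revolution_homeomorphism:
  fixes V :: "real set" and N :: "(real \<times> real) set"
  assumes \<gamma>: "homeomorphism V N \<gamma> e" and pos: "\<And>p. p \<in> N \<Longrightarrow> fst p > 0"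
  obtains \<Lambda> \<Lambda>' where "homeomorphism (revolution N) (sphere (0::complex) 1 \<times> V) \<Lambda> \<Lambda>'"
    "\<And>r z. (r, z) \<in> N \<Longrightarrow> \<Lambda> (r, 0, z) = (1, e (r, z))"
proof -
  define \<rho> where "\<rho> = (\<lambda>p :: point3. sqrt ((fst p)\<^sup>2 + (ycoord p)\<^sup>2))"
  define \<Lambda> where "\<Lambda> = (\<lambda>p :: point3. (Complex (fst p / \<rho> p) (ycoord p / \<rho> p), e (\<rho> p, snd (snd p))))"
  define \<Lambda>' where "\<Lambda>' = (\<lambda>q :: complex \<times> real. (fst (\<gamma> (snd q)) * Re (fst q), fst (\<gamma> (snd q)) * Im (fst q), snd (\<gamma> (snd q))))"
  have rho: "\<rho> (r * cos \<theta>, r * sin \<theta>, z) = r" if "r > 0" for r \<theta> z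
  proof -
    have "(r * cos \<theta>)\<^sup>2 + (r * sin \<theta>)\<^sup>2 = r\<^sup>2 * ((sin \<theta>)\<^sup>2 + (cos \<theta>)\<^sup>2)"
      unfolding power_mult_distrib distrib_left by simp
    then show ?thesis using that by (simp add: \<rho>_def)
  qed
  have L: "\<Lambda> (r * cos \<theta>, r * sin \<theta>, z) = (cis \<theta>, e (r, z))" if "r > 0" for r \<theta> z
    using rho[OF that] that by (simp add: \<Lambda>_def complex_eq_iff)
  have g: "\<gamma> v \<in> N" "e (\<gamma> v) = v" if "v \<in> V" for v using \<gamma> that by (auto simp: homeomorphism_def)
  have g': "e p \<in> V" "\<gamma> (e p) = p" if "p \<in> N" for p using \<gamma> that by (auto simp: homeomorphism_def)
  have c: "continuous_on V \<gamma>" "continuous_on N e" using \<gamma> by (auto simp: homeomorphism_def)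
  have rev: "\<exists>r \<theta> z. p = (r * cos \<theta>, r * sin \<theta>, z) \<and> (r, z) \<in> N \<and> r > 0" if "p \<in> revolution N" for p
    using that pos unfolding revolution_def by fastforce
  have cr: "continuous_on S \<rho>" for S unfolding \<rho>_def by (intro continuous_intros)
  have rp: "\<rho> p > 0" "(\<rho> p, snd (snd p)) \<in> N" if "p \<in> revolution N" for p
    using rev[OF that] rho by auto
  have "homeomorphism (revolution N) (sphere (0::complex) 1 \<times> V) \<Lambda> \<Lambda>'"
  proof (rule homeomorphismI)
    have "continuous_on (revolution N) (\<lambda>p. (complex_of_real (fst p / \<rho> p) + \<i> * complex_of_real (ycoord p / \<rho> p), e (\<rho> p, snd (snd p))))"
      by (intro continuous_intros cr continuous_on_compose2[OF c(2)]) (use rp in \<open>fastforce+\<close>)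
    then show "continuous_on (revolution N) \<Lambda>" by (simp add: \<Lambda>_def Complex_eq)
    show "continuous_on (sphere 0 1 \<times> V) \<Lambda>'" unfolding \<Lambda>'_def
      by (intro continuous_intros continuous_on_compose2[OF c(1)]) auto
    show "\<Lambda> ` revolution N \<subseteq> sphere 0 1 \<times> V"
    proof (rule image_subsetI)
      fix p assume "p \<in> revolution N"
      then obtain r \<theta> z where "p = (r * cos \<theta>, r * sin \<theta>, z)" "(r, z) \<in> N" "r > 0" using rev by blast
      then show "\<Lambda> p \<in> sphere 0 1 \<times> V" using L g'(1) by simp
    qed
    show "\<Lambda>' ` (sphere 0 1 \<times> V) \<subseteq> revolution N"
    proof (rule image_subsetI)
      fix q assume "q \<in> (sphere 0 1 :: complex set) \<times> V"
      then obtain c v where q: "q = (c, v)" "norm c = 1" "v \<in> V" by auto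
      have "c \<noteq> 0" using q by auto
      then have "c = cis (Arg c)" using cis_Arg[of c] q by (simp add: sgn_div_norm)
      then have "Re c = cos (Arg c)" "Im c = sin (Arg c)" by (metis cis.sel)+
      moreover have "(fst (\<gamma> v), snd (\<gamma> v)) \<in> N" using g(1)[OF q(3)] by simp
      ultimately show "\<Lambda>' q \<in> revolution N" unfolding revolution_def \<Lambda>'_def q(1) by fastforce
    qed
    show "\<Lambda>' (\<Lambda> p) = p" if p: "p \<in> revolution N" for p
    proof -
      obtain r \<theta> z where "p = (r * cos \<theta>, r * sin \<theta>, z)" "(r, z) \<in> N" "r > 0" using rev[OF p] by blast
      then show ?thesis using L g'(2)[of "(r, z)"] by (simp add: \<Lambda>'_def)
    qed
    show "\<Lambda> (\<Lambda>' q) = q" if q0: "q \<in> sphere 0 1 \<times> V" for q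
    proof -
      obtain c v where q: "q = (c, v)" "norm c = 1" "v \<in> V" using q0 by auto
      have "c \<noteq> 0" using q by auto
      then have cc: "c = cis (Arg c)" using cis_Arg[of c] q by (simp add: sgn_div_norm)
      then have "Re c = cos (Arg c)" "Im c = sin (Arg c)" by (metis cis.sel)+
      then have "\<Lambda> (\<Lambda>' q) = (cis (Arg c), e (fst (\<gamma> v), snd (\<gamma> v)))"
        using L[OF pos[OF g(1)[OF q(3)]]] by (simp add: \<Lambda>'_def q)
      then show ?thesis using cc g(2)[OF q(3)] q(1) by simp
    qed
  qed
  moreover have "\<Lambda> (r, 0, z) = (1, e (r, z))" if "(r, z) \<in> N" for r z
    using L[of r 0 z] pos[OF that] by simp
  ultimately show ?thesis by (rule that)
qed

text \<open>Slow enough growth: a level \<open>m\<close> is used only once \<open>\<epsilon>\<close> is below its threshold \<open>\<delta> m\<close>.\<close>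

lemma level_selection:
  fixes \<delta> :: "nat \<Rightarrow> real"
  assumes \<delta>: "\<And>m. \<delta> m > 0"
  obtains L :: "real \<Rightarrow> nat" where "\<And>\<epsilon>. \<bar>\<epsilon>\<bar> < \<delta> 0 \<Longrightarrow> \<bar>\<epsilon>\<bar> < \<delta> (L \<epsilon>)" "filterlim L sequentially (at 0)"
proof -
  \<comment> \<open>The bound on \<open>real m * \<bar>\<epsilon>\<bar>\<close> makes the set finite
    for nonzero \<epsilon>, even if the thresholds do not tend to 0.\<close>
  define A where "A = (\<lambda>\<epsilon>. {m. real m * \<bar>\<epsilon>\<bar> \<le> 1 \<and> (\<forall>k\<le>m. \<bar>\<epsilon>\<bar> < \<delta> k)})"
  \<comment> \<open>For \<epsilon> = 0 every level is admissible and the maximum does not exist; the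
    default 0 is admissible.\<close>
  define L where "L = (\<lambda>\<epsilon>. if \<epsilon> = 0 then 0 else Max (A \<epsilon>))"
  have fin: "finite (A \<epsilon>)" if "\<epsilon> \<noteq> 0" for \<epsilon>
  proof (rule finite_subset)
    show "A \<epsilon> \<subseteq> {..nat \<lceil>1 / \<bar>\<epsilon>\<bar>\<rceil>}"
    proof
      fix m assume "m \<in> A \<epsilon>"
      then have "real m \<le> 1 / \<bar>\<epsilon>\<bar>" using that by (simp add: A_def field_simps)
      also have "\<dots> \<le> of_int \<lceil>1 / \<bar>\<epsilon>\<bar>\<rceil>" by simp
      finally have "int m \<le> \<lceil>1 / \<bar>\<epsilon>\<bar>\<rceil>" by linarith
      then show "m \<in> {..nat \<lceil>1 / \<bar>\<epsilon>\<bar>\<rceil>}" by simp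
    qed
  qed simp
  show ?thesis
  proof (rule that[of L])
    fix \<epsilon> assume \<epsilon>: "\<bar>\<epsilon>\<bar> < \<delta> 0"
    show "\<bar>\<epsilon>\<bar> < \<delta> (L \<epsilon>)"
    proof (cases "\<epsilon> = 0")
      case True
      then show ?thesis using \<delta> by (simp add: L_def)
    next
      case False
      have "0 \<in> A \<epsilon>" using \<epsilon> by (simp add: A_def)
      then have "Max (A \<epsilon>) \<in> A \<epsilon>" using fin[OF False] by (intro Max_in) auto
      moreover have "L \<epsilon> = Max (A \<epsilon>)" using False by (simp add: L_def)
      ultimately have "L \<epsilon> \<in> A \<epsilon>" by metis
      then show ?thesis unfolding A_def by blast
    qed
  next
    show "filterlim L sequentially (at 0)"
      unfolding filterlim_at_top
    proof
      fix M :: nat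
      define d where "d = Min (insert (1 / (real M + 1)) (\<delta> ` {..M}))"
      have d: "d > 0" using \<delta> by (auto simp: d_def)
      have d': "d \<le> 1 / (real M + 1)" "\<And>k. k \<le> M \<Longrightarrow> d \<le> \<delta> k"
        unfolding d_def by (rule Min_le; simp)+
      have "M \<le> L \<epsilon>" if "\<epsilon> \<noteq> 0" "\<bar>\<epsilon>\<bar> < d" for \<epsilon>
      proof -
        have "real M * \<bar>\<epsilon>\<bar> \<le> (real M + 1) * (1 / (real M + 1))"
          using that d'(1) by (intro mult_mono) auto
        also have "\<dots> = 1" by simp
        finally have "M \<in> A \<epsilon>" using that d'(2) by (force simp: A_def)
        then show ?thesis using fin[OF that(1)] that(1) by (simp add: L_def)
      qed
      then show "\<forall>\<^sub>F \<epsilon> in at 0. M \<le> L \<epsilon>"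
        unfolding eventually_at using d by (intro exI[of _ d]) (auto simp: dist_real_def)
    qed
  qed
qed

theorem mainTheorem1:
  fixes h :: "real \<times> real \<Rightarrow> real"
    and n :: nat
    and ap am :: "nat \<Rightarrow> nat \<Rightarrow> nat \<Rightarrow> real"
  assumes n: "n \<ge> 1"
    and cont: "continuous_on (UNIV - {(0, 0)}) h"
    and H1: "hyp_H1 h"
    and H2: "hyp_H2 h"
    and ex_zero: "\<exists>z0 r0. simple_zero h n ap am z0 r0"
  shows "\<exists>\<epsilon>0>0.
    (\<forall>z0 \<in> S_set h n ap am. \<forall>r0. simple_zero h n ap am z0 r0 \<longrightarrow>
       (\<exists>X :: real \<Rightarrow> real \<Rightarrow> point3.
          (\<forall>\<epsilon>. \<bar>\<epsilon>\<bar> < \<epsilon>0 \<longrightarrow>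
             periodic_crossing_solution (2 * pi)
               (perturbed_field h n ap \<epsilon>) (perturbed_field h n am \<epsilon>) (X \<epsilon>)) \<and>
          ((\<lambda>\<epsilon>. X \<epsilon> 0) \<longlongrightarrow> (r0, 0, z0)) (at 0)))
    \<and>
    (\<exists>(M :: real \<Rightarrow> point3 set) \<Phi> \<Phi>'.
       (\<forall>\<epsilon>. \<bar>\<epsilon>\<bar> < \<epsilon>0 \<longrightarrow>
          piecewise_smooth_surface (M \<epsilon>) \<and>
          homeomorphism (revolution (psi_zeros h n ap am)) (M \<epsilon>) (\<Phi> \<epsilon>) (\<Phi>' \<epsilon>) \<and>
          filled_by_closed_orbits (2 * pi)
            (perturbed_field h n ap \<epsilon>) (perturbed_field h n am \<epsilon>) (M \<epsilon>) \<and>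
          (\<forall>(r, z0) \<in> psi_zeros h n ap am. \<exists>\<rho>>0. \<exists>\<zeta>. \<Phi> \<epsilon> (r, 0, z0) = (\<rho>, 0, \<zeta>))) \<and>
       (\<forall>(r, z0) \<in> psi_zeros h n ap am. ((\<lambda>\<epsilon>. \<Phi> \<epsilon> (r, 0, z0)) \<longlongrightarrow> (r, 0, z0)) (at 0)))"
proof -
  obtain J where rot: "rotating h J" and I: "\<And>\<theta>. 0 \<le> \<theta> \<Longrightarrow> J \<theta> = I_h h \<theta>"
    by (rule rotating_exists[OF cont H1 H2]) (rule that)
  interpret rotating h J by (rule rot)
  define Gp where "Gp = angular_field n ap J"
  define Gm where "Gm = angular_field n am J"
  define N where "N = psi_zeros h n ap am"
  have C: "Ck_on 1 Gp UNIV" "Ck_on 1 Gm UNIV" unfolding Gp_def Gm_def by (intro angular_field_smooth J_smooth)+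
  have N: "N = {p. fst p > 0 \<and> avg Gp Gm p = 0 \<and> avg (dr Gp) (dr Gm) p \<noteq> 0}"
    unfolding N_def Gp_def Gm_def by (rule psi_zeros_eq(1)[OF rot I])
  have cdr: "continuous_on UNIV (dr Gp)" "continuous_on UNIV (dr Gm)"
    using C unfolding One_nat_def Ck_on.simps by blast+
  have "locally_graph N" unfolding N
    by (rule simple_zeros_locally_graph[OF avg_continuous avg_continuous avg_deriv_r])
      (use C cdr Ck_on_continuous in blast)+
  then obtain V :: "real set" and e :: "real \<times> real \<Rightarrow> real" and \<gamma> where V: "open V" "V \<subseteq> {0<..<1}" and \<gamma>: "homeomorphism V N \<gamma> e"
    and loc: "\<And>v. v \<in> V \<Longrightarrow> \<exists>O'. open O' \<and> v \<in> O' \<and> O' \<subseteq> V \<and> inj_on (\<lambda>v. snd (\<gamma> v)) O'"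
    by (rule locally_graph_parametrization) blast
  have "N \<noteq> {}" using ex_zero psi_zeros_eq(2)[OF rot I] unfolding N_def by blast
  then have "V \<noteq> {}" using \<gamma> by (auto simp: homeomorphism_def)
  then obtain s :: "nat \<Rightarrow> real \<Rightarrow> real" and K where K: "\<And>m. compact (K m)" "\<And>m. K m \<subseteq> V" "\<And>m. s m ` V \<subseteq> K m"
    and s: "\<And>m. continuous_on V (s m)" "\<And>m. inj_on (s m) V" "\<And>v. v \<in> V \<Longrightarrow> (\<lambda>m. s m v) \<longlonglongrightarrow> v"
    by (rule open_self_embeddings[OF V]) blast
  have os: "open (s m ` V)" for m by (rule invariance_of_domain[OF s(1) V(1) s(2)])
  \<comment> \<open>Each level has its own compact part, tolerance and threshold. The threshold of
    level 0 becomes the common bound on \<epsilon>; smaller \<epsilon> allow better levels.\<close>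
  define good where "good = (\<lambda>m. swept_surface h n ap am \<gamma> (s m ` V) (1 / (real m + 1)))"
  have "\<exists>\<delta>>0. \<forall>\<epsilon>. \<bar>\<epsilon>\<bar> < \<delta> \<longrightarrow> good m \<epsilon>" for m
    unfolding good_def
    by (rule surface_exists[OF rot \<gamma>[unfolded N Gp_def Gm_def] loc K(1,2) os K(3)]) simp_all
  then obtain \<delta> where \<delta>: "\<And>m. \<delta> m > 0" "\<And>m \<epsilon>. \<bar>\<epsilon>\<bar> < \<delta> m \<Longrightarrow> good m \<epsilon>" by metis
  obtain L where L: "\<And>\<epsilon>. \<bar>\<epsilon>\<bar> < \<delta> 0 \<Longrightarrow> \<bar>\<epsilon>\<bar> < \<delta> (L \<epsilon>)" "filterlim L sequentially (at 0)"
    by (rule level_selection[of \<delta>, OF \<delta>(1)]) (rule that)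
  obtain \<Lambda> \<Lambda>' where \<Lambda>: "homeomorphism (revolution N) (sphere (0::complex) 1 \<times> V) \<Lambda> \<Lambda>'"
    "\<And>r z. (r, z) \<in> N \<Longrightarrow> \<Lambda> (r, 0, z) = (1, e (r, z))"
    by (rule revolution_homeomorphism[OF \<gamma>]) (use N in auto)
  \<comment> \<open>The simple zero whose continuation represents \<open>p\<close>. It tends to
    \<open>p\<close> by convergence of the embeddings, while the starting point of the closed orbit
    has the same height as \<open>w\<close> and a radius within
    \<open>1 / (real (L \<epsilon>) + 1)\<close> of it.\<close>
  define w where "w = (\<lambda>\<epsilon> p. \<gamma> (s (L \<epsilon>) (e p)))"
  define P where "P = (\<lambda>\<epsilon> M \<Phi> \<Phi>'. piecewise_smooth_surface M \<and>
      homeomorphism (revolution N) M \<Phi> \<Phi>' \<and>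
      filled_by_closed_orbits (2 * pi) (perturbed_field h n ap \<epsilon>) (perturbed_field h n am \<epsilon>) M \<and>
      (\<forall>r z. (r, z) \<in> N \<longrightarrow> (\<exists>\<rho>>0. \<exists>\<zeta>. \<Phi> (r, 0, z) = (\<rho>, 0, \<zeta>) \<and>
        (\<epsilon> \<noteq> 0 \<longrightarrow> \<zeta> = snd (w \<epsilon> (r, z)) \<and> \<bar>\<rho> - fst (w \<epsilon> (r, z))\<bar> \<le> 1 / (real (L \<epsilon>) + 1)))))"
  have "\<exists>M \<Phi> \<Phi>'. P \<epsilon> M \<Phi> \<Phi>'" if \<epsilon>: "\<bar>\<epsilon>\<bar> < \<delta> 0" for \<epsilon>
  proof -
    let ?m = "L \<epsilon>"
    have "good ?m \<epsilon>" using \<delta>(2) L(1)[OF \<epsilon>] by blast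
    then obtain \<Xi> :: "complex \<times> real \<Rightarrow> point3" and \<Xi>' M R Z where X:
      "homeomorphism (sphere 0 1 \<times> s ?m ` V) M \<Xi> \<Xi>'" "piecewise_smooth_surface M"
      "filled_by_closed_orbits (2*pi) (perturbed_field h n ap \<epsilon>) (perturbed_field h n am \<epsilon>) M"
      "\<forall>v\<in>s ?m ` V. \<Xi> (1, v) = (R v, 0, Z v) \<and> R v > 0 \<and>
        (\<epsilon> \<noteq> 0 \<longrightarrow> Z v = snd (\<gamma> v) \<and> \<bar>R v - fst (\<gamma> v)\<bar> \<le> 1 / (real ?m + 1))"
      unfolding good_def swept_surface_def by (elim exE conjE)
    obtain s' where s': "homeomorphism V (s ?m ` V) (s ?m) s'"
      using invariance_of_domain_homeomorphism[OF V(1) s(1) _ s(2)] by auto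
    have hid: "homeomorphism (sphere (0::complex) 1) (sphere 0 1) (\<lambda>x. x) (\<lambda>x. x)" by (simp add: homeomorphism_ident)
    \<comment> \<open>Polar coordinates and the parameter of the curve, then the self-embedding of
      the parameter set, then the surface of closed orbits; the circle coordinate is kept, so the
      half-plane \<theta> = 0 goes to itself.\<close>
    define \<Phi> where "\<Phi> = \<Xi> \<circ> ((\<lambda>x. (fst x, s ?m (snd x))) \<circ> \<Lambda>)"
    have hom: "homeomorphism (revolution N) M \<Phi> ((\<Lambda>' \<circ> (\<lambda>x. (fst x, s' (snd x)))) \<circ> \<Xi>')"
      unfolding \<Phi>_def
      by (rule homeomorphism_compose[OF homeomorphism_compose[OF \<Lambda>(1) homeomorphism_prod[OF hid s']] X(1)])
    have "\<exists>\<rho>>0. \<exists>\<zeta>. \<Phi> (r, 0, z) = (\<rho>, 0, \<zeta>) \<and>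
        (\<epsilon> \<noteq> 0 \<longrightarrow> \<zeta> = snd (w \<epsilon> (r, z)) \<and> \<bar>\<rho> - fst (w \<epsilon> (r, z))\<bar> \<le> 1 / (real (L \<epsilon>) + 1))" if "(r, z) \<in> N" for r z
    proof -
      have "e (r, z) \<in> V" using \<gamma> that by (auto simp: homeomorphism_def)
      then have "s ?m (e (r, z)) \<in> s ?m ` V" by blast
      from X(4)[rule_format, OF this] show ?thesis
        using \<Lambda>(2)[OF that] by (auto simp: \<Phi>_def w_def)
    qed
    then have "P \<epsilon> M \<Phi> ((\<Lambda>' \<circ> (\<lambda>x. (fst x, s' (snd x)))) \<circ> \<Xi>')"
      unfolding P_def using X(2,3) hom by blast
    then show ?thesis by blast
  qed
  then obtain M \<Phi> \<Phi>' where MP: "\<And>\<epsilon>. \<bar>\<epsilon>\<bar> < \<delta> 0 \<Longrightarrow> P \<epsilon> (M \<epsilon>) (\<Phi> \<epsilon>) (\<Phi>' \<epsilon>)" by metis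
  have lim: "((\<lambda>\<epsilon>. \<Phi> \<epsilon> (r, 0, z)) \<longlongrightarrow> (r, 0, z)) (at 0)" if rz: "(r, z) \<in> N" for r z
  proof -
    let ?v = "e (r, z)"
    have v: "?v \<in> V" "\<gamma> ?v = (r, z)" using \<gamma> rz by (auto simp: homeomorphism_def)
    have "((\<lambda>\<epsilon>. s (L \<epsilon>) ?v) \<longlongrightarrow> ?v) (at 0)"
      using filterlim_compose[OF s(3)[OF v(1)] L(2)] .
    moreover have "s (L \<epsilon>) ?v \<in> V" for \<epsilon> using K(2,3) v(1) by blast
    moreover have "continuous_on V \<gamma>" using \<gamma> by (simp add: homeomorphism_def)
    ultimately have wl: "((\<lambda>\<epsilon>. w \<epsilon> (r, z)) \<longlongrightarrow> (r, z)) (at 0)"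
      unfolding w_def using continuous_on_tendsto_compose[of V \<gamma> "\<lambda>\<epsilon>. s (L \<epsilon>) ?v" ?v "at 0"] v by simp
    have ev: "\<forall>\<^sub>F \<epsilon> in at 0. \<epsilon> \<noteq> 0 \<and> \<bar>\<epsilon>\<bar> < \<delta> 0"
      unfolding eventually_at using \<delta>(1)[of 0] by (intro exI[of _ "\<delta> 0"]) (auto simp: dist_real_def)
    have form: "\<forall>\<^sub>F \<epsilon> in at 0. \<Phi> \<epsilon> (r, 0, z) = (fst (\<Phi> \<epsilon> (r, 0, z)), 0, snd (w \<epsilon> (r, z))) \<and>
        \<bar>fst (\<Phi> \<epsilon> (r, 0, z)) - fst (w \<epsilon> (r, z))\<bar> \<le> 1 / (real (L \<epsilon>) + 1)"
      using ev
    proof eventually_elim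
      case (elim \<epsilon>)
      then obtain \<rho> \<zeta> where "\<Phi> \<epsilon> (r, 0, z) = (\<rho>, 0, \<zeta>)" "\<zeta> = snd (w \<epsilon> (r, z))" "\<bar>\<rho> - fst (w \<epsilon> (r, z))\<bar> \<le> 1 / (real (L \<epsilon>) + 1)"
        using MP[of \<epsilon>] rz unfolding P_def by blast
      then show ?case by simp
    qed
    have "(\<lambda>m. 1 / (real m + 1)) \<longlonglongrightarrow> 0"
      using LIMSEQ_inverse_real_of_nat by (simp add: inverse_eq_divide add.commute)
    then have z0: "((\<lambda>\<epsilon>. 1 / (real (L \<epsilon>) + 1)) \<longlongrightarrow> 0) (at 0)" by (rule filterlim_compose[OF _ L(2)])
    have "((\<lambda>\<epsilon>. fst (\<Phi> \<epsilon> (r, 0, z)) - fst (w \<epsilon> (r, z))) \<longlongrightarrow> 0) (at 0)"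
      by (rule Lim_null_comparison[OF _ z0]) (use form in \<open>eventually_elim, simp\<close>)
    from tendsto_add[OF this tendsto_fst[OF wl]]
    have "((\<lambda>\<epsilon>. fst (\<Phi> \<epsilon> (r, 0, z))) \<longlongrightarrow> r) (at 0)" by simp
    then have "((\<lambda>\<epsilon>. (fst (\<Phi> \<epsilon> (r, 0, z)), 0 :: real, snd (w \<epsilon> (r, z)))) \<longlongrightarrow> (r, 0, z)) (at 0)"
      using tendsto_snd[OF wl] by (intro tendsto_Pair tendsto_const) simp_all
    then show ?thesis by (rule Lim_transform_eventually) (use form in \<open>eventually_elim, metis\<close>)
  qed
  have part2: "(\<forall>\<epsilon>. \<bar>\<epsilon>\<bar> < \<delta> 0 \<longrightarrow>
          piecewise_smooth_surface (M \<epsilon>) \<and>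
          homeomorphism (revolution N) (M \<epsilon>) (\<Phi> \<epsilon>) (\<Phi>' \<epsilon>) \<and>
          filled_by_closed_orbits (2 * pi)
            (perturbed_field h n ap \<epsilon>) (perturbed_field h n am \<epsilon>) (M \<epsilon>) \<and>
          (\<forall>(r, z0) \<in> N. \<exists>\<rho>>0. \<exists>\<zeta>. \<Phi> \<epsilon> (r, 0, z0) = (\<rho>, 0, \<zeta>))) \<and>
       (\<forall>(r, z0) \<in> N. ((\<lambda>\<epsilon>. \<Phi> \<epsilon> (r, 0, z0)) \<longlongrightarrow> (r, 0, z0)) (at 0))"
    using MP lim unfolding P_def by fast
  have part1: "\<exists>X :: real \<Rightarrow> real \<Rightarrow> point3.
          (\<forall>\<epsilon>. \<bar>\<epsilon>\<bar> < \<delta> 0 \<longrightarrow>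
             periodic_crossing_solution (2 * pi)
               (perturbed_field h n ap \<epsilon>) (perturbed_field h n am \<epsilon>) (X \<epsilon>)) \<and>
          ((\<lambda>\<epsilon>. X \<epsilon> 0) \<longlongrightarrow> (r0, 0, z0)) (at 0)" if "simple_zero h n ap am z0 r0" for z0 r0
  proof -
    have N0: "(r0, z0) \<in> N" using psi_zeros_eq(2)[OF rot I that] by (simp add: N_def)
    have "(r0 * cos 0, r0 * sin 0, z0) \<in> revolution N" using N0 unfolding revolution_def by blast
    then have rev: "(r0, 0, z0) \<in> revolution N" by simp
    have "\<exists>X. periodic_crossing_solution (2*pi) (perturbed_field h n ap \<epsilon>) (perturbed_field h n am \<epsilon>) X \<and> X 0 = \<Phi> \<epsilon> (r0, 0, z0)"
      if "\<bar>\<epsilon>\<bar> < \<delta> 0" for \<epsilon>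
    proof -
      have "\<Phi> \<epsilon> (r0, 0, z0) \<in> M \<epsilon>"
        using MP[OF that] homeomorphism_image1[of "revolution N" "M \<epsilon>" "\<Phi> \<epsilon>" "\<Phi>' \<epsilon>"] rev unfolding P_def by blast
      then show ?thesis using MP[OF that] unfolding P_def filled_by_closed_orbits_def by blast
    qed
    then obtain X where X: "\<And>\<epsilon>. \<bar>\<epsilon>\<bar> < \<delta> 0 \<Longrightarrow> periodic_crossing_solution (2*pi) (perturbed_field h n ap \<epsilon>) (perturbed_field h n am \<epsilon>) (X \<epsilon>)"
      "\<And>\<epsilon>. \<bar>\<epsilon>\<bar> < \<delta> 0 \<Longrightarrow> X \<epsilon> 0 = \<Phi> \<epsilon> (r0, 0, z0)" by metis
    have "((\<lambda>\<epsilon>. X \<epsilon> 0) \<longlongrightarrow> (r0, 0, z0)) (at 0)"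
    proof (rule Lim_transform_eventually[OF lim[OF N0]])
      show "\<forall>\<^sub>F \<epsilon> in at 0. \<Phi> \<epsilon> (r0, 0, z0) = X \<epsilon> 0"
        unfolding eventually_at using \<delta>(1)[of 0] X(2) by (intro exI[of _ "\<delta> 0"]) (auto simp: dist_real_def)
    qed
    then show ?thesis using X(1) by blast
  qed
  show ?thesis
    using \<delta>(1)[of 0] part1 part2[unfolded N_def] by blast
qed

end
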